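(* Let $T$ be an arbitrary Calderón–Zygmund operator on $\mathbb{R}^d$ with parameter $\epsilon$. Then there is a constant $c_1$, depending only on $d$ and $\epsilon$, such that for every weight $w\in A_2$, $$\|T\|_{L^2(w)\to L^{2,\infty}(w)}\le c_1\,[w]_{A_2}\log(1+[w]_{A_2}).$$
   Context: A weight $w$ on $\mathbb{R}^d$ is an a.e. positive locally integrable function; $L^2(w)=L^2(\mathbb{R}^d,w\,dx)$, $w(E)=\int_E w\,dx$, $\langle w\rangle_I=|I|^{-1}\int_I w\,dx$. $w\in A_2$ means $[w]_{A_2}:=\sup_I\langle w\rangle_I\langle w^{-1}\rangle_I<\infty$ (supremum over all cubes $I$). A Calderón–Zygmund operator (with parameter $\epsilon>0$) is a linear operator $T$ bounded on $L^2(\mathbb{R}^d,dx)$ (Lebesgue measure) for which there is a kernel $K$ with $(Tf,g)=\iint K(x,y)f(y)g(x)\,dy\,dx$ for all nice $f,g$ with disjoint supports, where $|K(x,y)|\le |x-y|^{-d}$ and $|K(x,y)-K(x',y)|+|K(y,x)-K(y,x')|\le \frac{|x-x'|^{\epsilon}}{|x-y|^{d+\epsilon}}$ whenever $|x-x'|\le\frac12|x-y|$. $\|f\|_{L^{2,\infty}(w)}=\sup_{t>0}t\,w(\{x:|f(x)|>t\})^{1/2}$, and $\|T\|_{L^2(w)\to L^{2,\infty}(w)}$ is the smallest constant $B$ with $\|Tf\|_{L^{2,\infty}(w)}\le B\|f\|_{L^2(w)}$.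
   Formalization: The constant c_1 depends on d, ε and also on an upper bound N for the norm of T on L^2(dx); with c_1 depending on d and ε only the claim fails, since T = M·Id (kernel 0) with w = 1 has weak norm M for arbitrary M. *)

theory Defs
  imports "HOL-Analysis.Analysis"
begin

definition cubes :: "(real ^ 'n) set set" where
  "cubes = {cbox a (\<chi> i. a $ i + l) | a l. 0 < l}"

definition weight :: "(real ^ 'n \<Rightarrow> real) \<Rightarrow> bool" where
  "weight w \<longleftrightarrow> w \<in> borel_measurable lebesgue \<and> (AE x in lebesgue. 0 < w x) \<and>
     (\<forall>C. compact C \<longrightarrow> set_integrable lebesgue C w)"

(* The averages take values in [0, \<infinity>], because 1/w need not be locally integrable. *)
definition average :: "(real ^ 'n \<Rightarrow> real) \<Rightarrow> (real ^ 'n) set \<Rightarrow> ennreal" where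
  "average w I = (\<integral>\<^sup>+ x\<in>I. ennreal (w x) \<partial>lebesgue) / emeasure lebesgue I"

definition A2_char :: "(real ^ 'n \<Rightarrow> real) \<Rightarrow> ennreal" where
  "A2_char w = (SUP I\<in>cubes. average w I * average (\<lambda>x. inverse (w x)) I)"

definition A2 :: "(real ^ 'n \<Rightarrow> real) set" where
  "A2 = {w. weight w \<and> A2_char w < \<infinity>}"

definition weighted :: "(real ^ 'n \<Rightarrow> real) \<Rightarrow> (real ^ 'n) measure" where
  "weighted w = density lebesgue (\<lambda>x. ennreal (w x))"

definition ennreal_sqrt :: "ennreal \<Rightarrow> ennreal" where
  "ennreal_sqrt a = (if a = \<infinity> then \<infinity> else ennreal (sqrt (enn2real a)))"

definition L2_norm :: "'a measure \<Rightarrow> ('a \<Rightarrow> complex) \<Rightarrow> ennreal" where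
  "L2_norm M f = ennreal_sqrt (\<integral>\<^sup>+ x. ennreal ((cmod (f x))\<^sup>2) \<partial>M)"

(* The elements are functions, not classes modulo null sets. *)
definition L2_space :: "'a measure \<Rightarrow> ('a \<Rightarrow> complex) set" where
  "L2_space M = {f \<in> borel_measurable M. L2_norm M f < \<infinity>}"

definition weak_L2_norm :: "'a measure \<Rightarrow> ('a \<Rightarrow> complex) \<Rightarrow> ennreal" where
  "weak_L2_norm M f =
     (SUP t\<in>{0<..}. ennreal t * ennreal_sqrt (emeasure M {x \<in> space M. t < cmod (f x)}))"

definition operator_norm ::
  "('a \<Rightarrow> ennreal) \<Rightarrow> ('b \<Rightarrow> ennreal) \<Rightarrow> 'a set \<Rightarrow> ('a \<Rightarrow> 'b) \<Rightarrow> ennreal" where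
  "operator_norm p q D T = Inf {B. \<forall>f\<in>D. q (T f) \<le> B * p f}"

(* Norm of T from L^2(dx) to L^2(dx). *)
definition strong_norm ::
  "((real ^ 'n \<Rightarrow> complex) \<Rightarrow> (real ^ 'n \<Rightarrow> complex)) \<Rightarrow> ennreal" where
  "strong_norm T = operator_norm (L2_norm lebesgue) (L2_norm lebesgue) (L2_space lebesgue) T"

(* Norm of T from L^2(w) to weak L^2(w).  Since T is given on L^2(dx), the bound is tested on
   the intersection of L^2(dx) and L^2(w), which is dense in L^2(w) for every weight w. *)
definition weak_norm ::
  "(real ^ 'n \<Rightarrow> real) \<Rightarrow> ((real ^ 'n \<Rightarrow> complex) \<Rightarrow> (real ^ 'n \<Rightarrow> complex)) \<Rightarrow> ennreal" where
  "weak_norm w T = operator_norm (L2_norm (weighted w)) (weak_L2_norm (weighted w))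
     (L2_space lebesgue \<inter> L2_space (weighted w)) T"

(* Linearity holds up to null sets.  Together with the norm bound it implies that
   T respects equality almost everywhere. *)
definition bounded_on_L2 ::
  "((real ^ 'n \<Rightarrow> complex) \<Rightarrow> (real ^ 'n \<Rightarrow> complex)) \<Rightarrow> bool" where
  "bounded_on_L2 T \<longleftrightarrow>
     (\<forall>f\<in>L2_space lebesgue. T f \<in> L2_space lebesgue) \<and>
     (\<forall>f\<in>L2_space lebesgue. \<forall>g\<in>L2_space lebesgue. \<forall>a b.
        AE x in lebesgue. T (\<lambda>x. a * f x + b * g x) x = a * T f x + b * T g x) \<and>
     strong_norm T < \<infinity>"

definition cz_kernel :: "real \<Rightarrow> (real ^ 'n \<Rightarrow> real ^ 'n \<Rightarrow> complex) \<Rightarrow> bool" where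
  "cz_kernel \<epsilon> K \<longleftrightarrow>
     (\<forall>x y. x \<noteq> y \<longrightarrow> cmod (K x y) \<le> 1 / norm (x - y) powr real CARD('n)) \<and>
     (\<forall>x x' y. x \<noteq> y \<and> norm (x - x') \<le> norm (x - y) / 2 \<longrightarrow>
        cmod (K x y - K x' y) + cmod (K y x - K y x')
          \<le> norm (x - x') powr \<epsilon> / norm (x - y) powr (real CARD('n) + \<epsilon>))"

definition support :: "(real ^ 'n \<Rightarrow> complex) \<Rightarrow> (real ^ 'n) set" where
  "support f = closure {x. f x \<noteq> 0}"

(* The "nice" functions are the continuous functions with compact support; the pairing
   (u, v) is the bilinear integral of u * v. *)
definition has_kernel :: "((real ^ 'n \<Rightarrow> complex) \<Rightarrow> (real ^ 'n \<Rightarrow> complex)) \<Rightarrow>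
    (real ^ 'n \<Rightarrow> real ^ 'n \<Rightarrow> complex) \<Rightarrow> bool" where
  "has_kernel T K \<longleftrightarrow>
     (\<forall>f g. continuous_on UNIV f \<and> compact (support f) \<and>
            continuous_on UNIV g \<and> compact (support g) \<and> support f \<inter> support g = {} \<longrightarrow>
        (LINT x|lebesgue. T f x * g x) = (LINT x|lebesgue. LINT y|lebesgue. K x y * f y * g x))"

definition cz_operator ::
  "real \<Rightarrow> ((real ^ 'n \<Rightarrow> complex) \<Rightarrow> (real ^ 'n \<Rightarrow> complex)) \<Rightarrow> bool" where
  "cz_operator \<epsilon> T \<longleftrightarrow> bounded_on_L2 T \<and> (\<exists>K. cz_kernel \<epsilon> K \<and> has_kernel T K)"

end

theory Submission
  imports Defs
begin

text \<open>
  The proof gives the linear bound \<open>weak_norm w T \<le> C * [w]\<close> with \<open>C\<close> depending on the dimension, on \<open>\<epsilon>\<close>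
  and on the bound for the norm of \<open>T\<close> on unweighted square integrable functions. Since \<open>[w] \<ge> 1\<close>
  (\<open>W_ge_1\<close>), the factor \<open>ln (1 + [w])\<close> is at least \<open>ln 2\<close>, and the stated inequality follows.

  The weight enters only at the end. First \<open>T\<close> is dominated pointwise by a positive sum over
  dyadic cubes (\<open>sparse_domination\<close>): if \<open>3Q\<close> denotes the triple of a cube \<open>Q\<close>, then almost everywhere
  on \<open>Q\<close> the value \<open>\<bar>T(f 1_{3Q})\<bar>\<close> is at most a constant times the sum of the averages of \<open>\<bar>f\<bar>\<close> over the
  triples \<open>3R\<close> of those cubes \<open>R\<close> of a family that contain the point. The family is sparse: every \<open>R\<close> has a
  subset of at least half its measure, and these subsets are disjoint. It comes from a stopping
  time. The children of \<open>Q\<close> are the maximal subcubes \<open>P\<close> on which the average over \<open>3P\<close> jumps, or on which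
  \<open>\<bar>T(f 1_{3Q})\<bar>\<close> is large on a fixed proportion of the cube. Off the children the
  function is bounded by the average over \<open>3Q\<close>. On a child \<open>P\<close> it differs from \<open>T(f 1_{3P})\<close> by the image of
  \<open>f 1_{3Q - 3P}\<close>, which oscillates little on \<open>P\<close> because the kernel is smooth, and which is controlled at one
  point of \<open>P\<close> because both functions are controlled on a large part of \<open>P\<close> (\<open>child_step\<close>). Iteration gives the
  sum. That the children have small total measure is the weak type (1,1) estimate for \<open>T\<close>
  (\<open>weak_type_1_1\<close>, by the Calderon-Zygmund decomposition) and for the maximal function over triples.

  Then, for a set \<open>H \<subseteq> Q\<close>, the weighted integral of the sum over \<open>H\<close> is estimated cube by cube
  (\<open>sparse_pairing\<close>). With \<open>\<sigma> = 1/w\<close>, the average of \<open>\<bar>f\<bar>\<close> over \<open>3R\<close> is a \<open>\<sigma>\<close>-average of \<open>\<bar>f\<bar> w\<close> times \<open>\<sigma>(3R) / |3R|\<close>,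
  and \<open>w(R \<inter> H)\<close> is a \<open>w\<close>-average of \<open>1_H\<close> times \<open>w(R)\<close>. The product \<open>\<sigma>(3R) w(R)\<close> is at most \<open>[w] |3R|\<^sup>2\<close>, the measure of
  \<open>3R\<close> is comparable to that of the disjoint part of \<open>R\<close>, and the latter is dominated by the
  geometric mean of its \<open>\<sigma>\<close>- and \<open>w\<close>-measures. What remains is the square of a maximal
  function integrated against its own measure, and such maximal functions over laminar families of sets
  are bounded on square integrable functions with a constant that does not depend on the measure
  (\<open>laminar_maximal_L2\<close>). Choosing \<open>H\<close> as the part of \<open>Q\<close> where \<open>\<bar>T(f 1_{3Q})\<bar>\<close> exceeds \<open>t\<close> gives the weak type bound there,
  uniformly in \<open>Q\<close>; letting \<open>Q\<close> increase to an orthant and adding the orthants gives it for \<open>T f\<close>.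
\<close>

section \<open>Dyadic cubes and their triples\<close>

text \<open>A dyadic cube is represented by its level \<open>k\<close> and its integer position \<open>m\<close>: it is the half-open cube of
side \<open>2 powi (- k)\<close> with corner \<open>m * 2 powi (- k)\<close>. The description by floors makes nesting a matter of
integer division, and the indices form a countable type.\<close>

definition cube :: "int \<times> (int ^ 'n) \<Rightarrow> (real ^ 'n) set" where
  "cube p = {y. \<forall>i. \<lfloor>2 powi fst p * y $ i\<rfloor> = snd p $ i}"

text \<open>The union of the cube and of its neighbours of the same level, that is the concentric cube of three times the side.\<close>

definition triple :: "int \<times> (int ^ 'n) \<Rightarrow> (real ^ 'n) set" where
  "triple p = {y. \<forall>i. \<bar>\<lfloor>2 powi fst p * y $ i\<rfloor> - snd p $ i\<bar> \<le> 1}"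

definition side :: "int \<times> (int ^ 'n) \<Rightarrow> real" where
  "side p = 2 powi (- fst p)"

text \<open>The dyadic ancestor \<open>j\<close> levels above.\<close>

definition anc :: "nat \<Rightarrow> int \<times> (int ^ 'n) \<Rightarrow> int \<times> (int ^ 'n)" where
  "anc j p = (fst p - int j, \<chi> i. snd p $ i div 2 ^ j)"

lemma side_pos [simp]: "0 < side p" by (simp add: side_def)

lemma anc_0 [simp]: "anc 0 p = p" by (simp add: anc_def vec_eq_iff prod_eq_iff)

lemma fst_anc [simp]: "fst (anc j p) = fst p - int j" by (simp add: anc_def)

lemma anc_anc: "anc i (anc j p) = anc (i + j) p"
  by (simp add: anc_def vec_eq_iff zdiv_zmult2_eq[symmetric] power_add mult.commute)

lemma side_anc: "side (anc j p) = 2 ^ j * side p"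
  by (simp add: side_def power_int_diff power_int_minus field_simps)

lemma floor_coarser: "\<lfloor>2 powi (k - int j) * (y::real)\<rfloor> = \<lfloor>2 powi k * y\<rfloor> div 2 ^ j"
proof -
  have "2 powi (k - int j) * y = (2 powi k * y) / real_of_int (2 ^ j)"
    by (simp add: power_int_diff)
  then show ?thesis
    by (simp only: floor_divide_real_eq_div zero_le_power zero_le_numeral)
qed

lemma cube_subset_anc: "cube p \<subseteq> cube (anc j p)"
  by (auto simp: cube_def anc_def floor_coarser)

lemma div_diff_le_1:
  fixes a b c :: int
  assumes "\<bar>a - b\<bar> \<le> 1" "0 < c"
  shows "\<bar>a div c - b div c\<bar> \<le> 1"
proof -
  have *: "y div c \<le> x div c + 1" if "y \<le> x + 1" for x y
  proof -
    have "y div c \<le> (x + c) div c" using that assms(2) by (intro zdiv_mono1) auto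
    then show ?thesis using assms(2) by simp
  qed
  show ?thesis using *[of a b] *[of b a] assms(1) by linarith
qed

lemma triple_subset_anc: "triple p \<subseteq> triple (anc j p)"
  by (auto simp: triple_def anc_def floor_coarser intro!: div_diff_le_1)

lemma triple_anc_mono: "i \<le> j \<Longrightarrow> triple (anc i p) \<subseteq> triple (anc j p)"
  using triple_subset_anc[of "anc i p" "j - i"] by (simp add: anc_anc)

lemma cube_subset_triple: "cube p \<subseteq> triple p"
  by (auto simp: cube_def triple_def)

lemma floor_scaled_iff:
  fixes a :: int and p :: "int \<times> (int ^ 'n)" and y :: real
  shows "a \<le> \<lfloor>2 powi fst p * y\<rfloor> \<longleftrightarrow> side p * real_of_int a \<le> y"
    "\<lfloor>2 powi fst p * y\<rfloor> < a \<longleftrightarrow> y < side p * real_of_int a"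
proof -
  have *: "side p = 1 / 2 powi fst p" by (simp add: side_def power_int_minus field_simps)
  show "a \<le> \<lfloor>2 powi fst p * y\<rfloor> \<longleftrightarrow> side p * real_of_int a \<le> y"
    unfolding * by (simp add: le_floor_iff field_simps)
  show "\<lfloor>2 powi fst p * y\<rfloor> < a \<longleftrightarrow> y < side p * real_of_int a"
    unfolding * by (simp add: floor_less_iff field_simps)
qed

lemma cube_eq: "cube p = {y. \<forall>i. side p * real_of_int (snd p $ i) \<le> y $ i \<and>
    y $ i < side p * real_of_int (snd p $ i) + side p}"
proof -
  have "\<lfloor>2 powi fst p * t\<rfloor> = m \<longleftrightarrow> side p * real_of_int m \<le> t \<and> t < side p * real_of_int m + side p"
    for t m
    using floor_scaled_iff[where a=m and p=p and y=t] floor_scaled_iff[where a="m+1" and p=p and y=t]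
    by (auto simp: algebra_simps)
  then show ?thesis by (simp add: cube_def)
qed

lemma triple_eq: "triple p = {y. \<forall>i. side p * real_of_int (snd p $ i - 1) \<le> y $ i \<and>
    y $ i < side p * real_of_int (snd p $ i - 1) + 3 * side p}"
proof -
  have "\<bar>\<lfloor>2 powi fst p * t\<rfloor> - m\<bar> \<le> 1 \<longleftrightarrow>
      side p * real_of_int (m - 1) \<le> t \<and> t < side p * real_of_int (m - 1) + 3 * side p"
    for t m
  proof -
    have "\<bar>\<lfloor>2 powi fst p * t\<rfloor> - m\<bar> \<le> 1 \<longleftrightarrow> m - 1 \<le> \<lfloor>2 powi fst p * t\<rfloor> \<and> \<lfloor>2 powi fst p * t\<rfloor> < m + 2"
      by linarith
    then show ?thesis unfolding floor_scaled_iff by (auto simp: algebra_simps)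
  qed
  then show ?thesis by (simp add: triple_def)
qed

lemma cube_nonempty: "cube p \<noteq> {}"
proof -
  have "(\<chi> i. side p * real_of_int (snd p $ i)) \<in> cube p" by (simp add: cube_eq)
  then show ?thesis by blast
qed

lemma exists_cube: "\<exists>p. fst p = k \<and> y \<in> cube p"
  by (rule exI[of _ "(k, \<chi> i. \<lfloor>2 powi k * y $ i\<rfloor>)"]) (simp add: cube_def)

lemma cubes_meet_imp_anc:
  assumes "y \<in> cube p" "y \<in> cube q" "fst q \<le> fst p"
  shows "q = anc (nat (fst p - fst q)) p"
proof -
  have "y \<in> cube (anc (nat (fst p - fst q)) p)" using assms(1) cube_subset_anc by blast
  with assms show ?thesis
    by (auto simp: cube_def anc_def prod_eq_iff vec_eq_iff)
qed

lemma cubes_laminar: "cube p \<inter> cube q = {} \<or> (\<exists>j. q = anc j p) \<or> (\<exists>j. p = anc j q)"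
  using cubes_meet_imp_anc[of _ p q] cubes_meet_imp_anc[of _ q p] by (meson disjoint_iff nle_le)

lemma half_open_box_measure:
  fixes a :: "real ^ 'n"
  assumes "0 < l"
  defines "S \<equiv> {y. \<forall>i. a $ i \<le> y $ i \<and> y $ i < a $ i + l}"
  shows "S \<in> sets borel" "emeasure lebesgue S = ennreal (l ^ CARD('n))"
    "S \<subseteq> cbox a (\<chi> i. a $ i + l)" "emeasure lebesgue (cbox a (\<chi> i. a $ i + l)) = ennreal (l ^ CARD('n))"
proof -
  let ?b = "(\<chi> i. a $ i + l) :: real ^ 'n"
  have S: "S = (\<Inter>i. {y. a $ i \<le> y $ i} \<inter> {y. y $ i < a $ i + l})" by (auto simp: S_def)
  have "{y::real^'n. a $ i \<le> y $ i} \<in> sets borel" "{y::real^'n. y $ i < a $ i + l} \<in> sets borel" for i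
    by (auto intro!: borel_closed borel_open closed_Collect_le open_Collect_less continuous_intros)
  then show [measurable]: "S \<in> sets borel" unfolding S by auto
  show sub: "S \<subseteq> cbox a ?b" by (auto simp: S_def mem_box_cart less_imp_le)
  have sup: "box a ?b \<subseteq> S" by (auto simp: S_def mem_box_cart less_imp_le)
  have "measure lborel (cbox a ?b) = l ^ CARD('n)"
    using assms(1) by (subst content_cbox_cart) (auto simp: interval_ne_empty_cart less_imp_le)
  moreover have "emeasure lebesgue (cbox a ?b) = ennreal (measure lborel (cbox a ?b))"
    by (simp add: emeasure_eq_measure2 emeasure_lborel_cbox_eq content_cbox_if)
  ultimately show c: "emeasure lebesgue (cbox a ?b) = ennreal (l ^ CARD('n))" by simp
  have "emeasure lebesgue (box a ?b) = emeasure lebesgue (cbox a ?b)"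
    by (simp add: emeasure_lborel_cbox_eq emeasure_lborel_box_eq)
  moreover have "emeasure lebesgue S \<le> emeasure lebesgue (cbox a ?b)"
    "emeasure lebesgue (box a ?b) \<le> emeasure lebesgue S"
    using sub sup by (auto intro!: emeasure_mono)
  ultimately show "emeasure lebesgue S = ennreal (l ^ CARD('n))" using c by simp
qed

definition vol :: "int \<times> (int ^ 'n) \<Rightarrow> real" where
  "vol p = side p ^ CARD('n)"

lemma vol_pos [simp]: "0 < vol p" by (simp add: vol_def)

lemma vol_anc: "vol (anc j (p :: int \<times> (int ^ 'n))) = (2 ^ j) ^ CARD('n) * vol p"
  by (simp add: vol_def side_anc power_mult_distrib)

lemma cube_borel [measurable]: "cube p \<in> sets borel"
  and emeasure_cube: "emeasure lebesgue (cube p) = ennreal (vol p)"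
  using half_open_box_measure(1,2)[of "side p" "\<chi> i. side p * real_of_int (snd p $ i)"]
  by (simp_all add: cube_eq vol_def)

lemma triple_borel [measurable]: "triple (p :: int \<times> (int ^ 'n)) \<in> sets borel"
  and emeasure_triple: "emeasure lebesgue (triple p) = ennreal (3 ^ CARD('n) * vol p)"
  and triple_in_cbox: "\<exists>I\<in>cubes. triple p \<subseteq> I \<and> emeasure lebesgue I = ennreal (3 ^ CARD('n) * vol p)"
proof -
  define a where "a = ((\<chi> i. side p * real_of_int (snd p $ i - 1)) :: real ^ 'n)"
  have l: "0 < 3 * side p" by simp
  note * = half_open_box_measure[OF l, of a]
  have t: "triple p = {y. \<forall>i. a $ i \<le> y $ i \<and> y $ i < a $ i + 3 * side p}"
    by (simp add: triple_eq a_def)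
  have v: "(3 * side p) ^ CARD('n) = 3 ^ CARD('n) * vol p"
    by (simp add: vol_def power_mult_distrib)
  show "triple p \<in> sets borel" "emeasure lebesgue (triple p) = ennreal (3 ^ CARD('n) * vol p)"
    using *(1,2) unfolding t v by simp_all
  have "cbox a (\<chi> i. a $ i + 3 * side p) \<in> cubes"
    unfolding cubes_def using l by blast
  then show "\<exists>I\<in>cubes. triple p \<subseteq> I \<and> emeasure lebesgue I = ennreal (3 ^ CARD('n) * vol p)"
    using *(3,4) unfolding t v by blast
qed

lemma cube_lebesgue [measurable]: "cube p \<in> sets lebesgue" and
  triple_lebesgue [measurable]: "triple p \<in> sets lebesgue"
  by (auto intro: sets_completionI_sets)

lemma bounded_triple: "bounded (triple p)"
proof -
  obtain a b where "triple p \<subseteq> cbox a b"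
    using triple_in_cbox[of p] by (auto simp: cubes_def)
  then show ?thesis using bounded_cbox bounded_subset by blast
qed

lemma norm_cube_diff_le:
  fixes x y :: "real ^ 'n"
  assumes "x \<in> cube p" "y \<in> cube p"
  shows "norm (x - y) \<le> real CARD('n) * side p"
proof -
  have "norm (x - y) \<le> (\<Sum>i\<in>UNIV. \<bar>(x - y) $ i\<bar>)" by (rule norm_le_l1_cart)
  also have "\<dots> \<le> (\<Sum>i\<in>(UNIV::'n set). side p)"
  proof (rule sum_mono)
    fix i
    have "side p * real_of_int (snd p $ i) \<le> x $ i \<and> x $ i < side p * real_of_int (snd p $ i) + side p"
      "side p * real_of_int (snd p $ i) \<le> y $ i \<and> y $ i < side p * real_of_int (snd p $ i) + side p"
      using assms by (auto simp: cube_eq)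
    then show "\<bar>(x - y) $ i\<bar> \<le> side p" by (auto simp: abs_le_iff)
  qed
  finally show ?thesis by simp
qed

lemma norm_outside_triple_ge:
  assumes "x \<in> cube p" "y \<notin> triple p"
  shows "side p \<le> norm (x - y)"
proof -
  obtain i where i: "\<not> (side p * real_of_int (snd p $ i - 1) \<le> y $ i \<and>
      y $ i < side p * real_of_int (snd p $ i - 1) + 3 * side p)"
    using assms(2) by (auto simp: triple_eq)
  have "side p * real_of_int (snd p $ i) \<le> x $ i \<and> x $ i < side p * real_of_int (snd p $ i) + side p"
    using assms(1) by (auto simp: cube_eq)
  then have "side p \<le> \<bar>(x - y) $ i\<bar>" using i by (auto simp: algebra_simps abs_le_iff)
  also have "\<dots> \<le> norm (x - y)" by (rule component_le_norm_cart)
  finally show ?thesis .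
qed

lemma int_div_power2_cases: "\<exists>j0. \<forall>j\<ge>j0. (m::int) div 2 ^ j \<in> {-1, 0}"
proof -
  have "m div 2 ^ j \<in> {-1, 0}" if "j \<ge> nat \<bar>m\<bar>" for j
  proof -
    have "int j < 2 ^ j" by (metis of_nat_less_two_power)
    then have "\<bar>m\<bar> < 2 ^ j" using that by linarith
    then show ?thesis
      by (cases "m \<ge> 0") (auto simp: div_pos_pos_trivial div_eq_minus1 zdiv_eq_0_iff int_div_pos_eq[of m "2^j" "-1" "m + 2^j"])
  qed
  then show ?thesis by blast
qed

text \<open>The ancestors of a cube only fill an orthant, but their triples exhaust the space: far enough up, both indices
are \<open>0\<close> or \<open>-1\<close> in each coordinate.\<close>

lemma exists_anc_triple: "\<exists>j. y \<in> triple (anc j p)"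
proof -
  have "\<exists>j0. \<forall>j\<ge>j0. \<bar>\<lfloor>2 powi fst p * y $ i\<rfloor> div 2 ^ j - snd p $ i div 2 ^ j\<bar> \<le> 1" for i
  proof -
    obtain a b where "\<forall>j\<ge>a. \<lfloor>2 powi fst p * y $ i\<rfloor> div 2 ^ j \<in> {-1, 0}"
      "\<forall>j\<ge>b. snd p $ i div 2 ^ j \<in> {-1, 0}"
      using int_div_power2_cases by metis
    then show ?thesis by (intro exI[of _ "max a b"]) force
  qed
  then obtain J where J: "\<And>i j. j \<ge> J i \<Longrightarrow> \<bar>\<lfloor>2 powi fst p * y $ i\<rfloor> div 2 ^ j - snd p $ i div 2 ^ j\<bar> \<le> 1"
    by metis
  have "J i \<le> Max (range J)" for i by (rule Max_ge) auto
  then show ?thesis using J by (auto simp: triple_def anc_def floor_coarser intro!: exI[of _ "Max (range J)"])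
qed

text \<open>The corner of the triple at level \<open>k\<close> is \<open>(m - 1) * 2 powi (- k)\<close>. Modulo \<open>3\<close> the number \<open>2\<close> is \<open>-1\<close>, so the class is the residue of the
corner in the dyadic rationals modulo \<open>3\<close>. Within one class the triples of a given level tile the space, and the tilings are nested.\<close>

definition triple_class :: "int \<times> (int ^ 'n) \<Rightarrow> int ^ 'n" where
  "triple_class p = (\<chi> i. (if even (fst p) then snd p $ i - 1 else 1 - snd p $ i) mod 3)"

lemma finite_range_triple_class:
  "finite (range (triple_class :: int \<times> (int ^ 'n) \<Rightarrow> _))"
  "card (range (triple_class :: int \<times> (int ^ 'n) \<Rightarrow> _)) \<le> 3 ^ CARD('n)"
proof -
  let ?f = "\<lambda>h. (\<chi> i. h i) :: int ^ 'n" and ?X = "(UNIV::'n set) \<rightarrow>\<^sub>E {0, 1, 2::int}"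
  have sub: "range (triple_class :: int \<times> (int ^ 'n) \<Rightarrow> _) \<subseteq> ?f ` ?X"
  proof
    fix c assume "c \<in> range (triple_class :: int \<times> (int ^ 'n) \<Rightarrow> _)"
    then have "c $ i \<in> {0, 1, 2}" for i by (auto simp: triple_class_def)
    then have "c = ?f (($) c)" "($) c \<in> ?X" by (auto simp: vec_eq_iff)
    then show "c \<in> ?f ` ?X" by blast
  qed
  have fin: "finite ?X" by (intro finite_PiE) auto
  show "finite (range (triple_class :: int \<times> (int ^ 'n) \<Rightarrow> _))"
    using sub fin finite_subset by blast
  have "card (range (triple_class :: int \<times> (int ^ 'n) \<Rightarrow> _)) \<le> card (?f ` ?X)"
    using sub fin by (intro card_mono) auto
  also have "\<dots> \<le> card ?X" using fin by (rule card_image_le)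
  also have "\<dots> = 3 ^ CARD('n)" by (subst card_PiE) (auto simp: numeral_3_eq_3)
  finally show "card (range (triple_class :: int \<times> (int ^ 'n) \<Rightarrow> _)) \<le> 3 ^ CARD('n)" .
qed

lemma power2_mod3: "(2::int) ^ j mod 3 = (if even j then 1 else 2)"
proof (induction j)
  case (Suc j)
  have "(2::int) ^ Suc j mod 3 = (2 * (2 ^ j mod 3)) mod 3" by (simp add: mod_mult_right_eq)
  then show ?case using Suc by (auto split: if_splits)
qed auto

lemma div_ge_iff: "0 < (c::int) \<Longrightarrow> a \<le> b div c \<longleftrightarrow> a * c \<le> b"
proof
  assume c: "0 < c" and "a \<le> b div c"
  then have "a * c \<le> (b div c) * c" by (simp add: mult_right_mono)
  also have "\<dots> \<le> b" using c by (simp add: minus_mod_eq_div_mult[symmetric])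
  finally show "a * c \<le> b" .
next
  assume c: "0 < c" and "a * c \<le> b"
  then have "(a * c) div c \<le> b div c" by (intro zdiv_mono1)
  then show "a \<le> b div c" using c by simp
qed

text \<open>Corners in the same class differ by a multiple of three times the smaller side, hence the small triple
is a cell of the grid that subdivides the large one.\<close>

lemma triples_laminar_aux:
  assumes "triple_class p = triple_class q" "fst q \<le> fst p" "triple p \<inter> triple q \<noteq> {}"
  shows "triple p \<subseteq> triple q"
proof -
  define j where "j = nat (fst p - fst q)"
  have fq: "fst q = fst p - int j" using assms(2) by (simp add: j_def)
  obtain z where z: "z \<in> triple p" "z \<in> triple q" using assms(3) by blast
  show ?thesis
  proof
    fix y assume y: "y \<in> triple p"
    have "\<bar>\<lfloor>2 powi fst q * y $ i\<rfloor> - snd q $ i\<bar> \<le> 1" for i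
    proof -
      define a b n m where "a = \<lfloor>2 powi fst p * y $ i\<rfloor>" "b = \<lfloor>2 powi fst p * z $ i\<rfloor>"
        "n = snd p $ i" "m = snd q $ i"
      note defs = this
      have a: "n - 1 \<le> a" "a \<le> n + 1" and b: "n - 1 \<le> b" "b \<le> n + 1"
        using z(1) y by (auto simp: triple_def defs abs_le_iff dest!: spec[of _ i])
      have bq: "m - 1 \<le> b div 2 ^ j" "b div 2 ^ j \<le> m + 1"
        using z(2) by (auto simp: triple_def defs abs_le_iff fq floor_coarser dest!: spec[of _ i])
      have "(2::int) ^ j > 0" by simp
      then have B: "2 ^ j * (m - 1) \<le> b" "b < 2 ^ j * (m + 2)"
        using div_ge_iff[of "2 ^ j" "m - 1" b] div_ge_iff[of "2 ^ j" "m + 2" b] bq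
        by (auto simp: mult.commute)
      have "(if even (fst p) then n - 1 else 1 - n) mod 3 = (if even (fst q) then m - 1 else 1 - m) mod 3"
        using arg_cong[OF assms(1), of "\<lambda>v. v $ i"]
        by (simp only: triple_class_def defs vec_lambda_beta)
      then have "(n - 1) mod 3 = (if even j then m - 1 else 1 - m) mod 3"
        unfolding fq by (auto split: if_splits; presburger)
      moreover have "(2 ^ j * (m - 1)) mod 3 = (if even j then m - 1 else 1 - m) mod 3"
        by (subst mod_mult_left_eq[symmetric], subst power2_mod3) (auto; presburger)
      ultimately have "((n - 1) - 2 ^ j * (m - 1)) mod 3 = 0"
        by (metis mod_eq_dvd_iff dvd_imp_mod_0)
      then have "3 dvd (n - 1) - 2 ^ j * (m - 1)" by (simp add: mod_eq_0_iff_dvd)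
      then obtain t where "(n - 1) - 2 ^ j * (m - 1) = 3 * t" by (elim dvdE)
      then have t: "n - 1 = 2 ^ j * (m - 1) + 3 * t" by linarith
      have "t \<ge> 0" using B(1) b t by linarith
      moreover have "t < 2 ^ j" using B(2) b t by (simp add: algebra_simps)
      ultimately have "2 ^ j * (m - 1) \<le> a" "a < 2 ^ j * (m + 2)"
        using a t by (auto simp: algebra_simps)
      then have "m - 1 \<le> a div 2 ^ j" "a div 2 ^ j < m + 2"
        using div_ge_iff[of "2 ^ j" "m - 1" a] div_ge_iff[of "2 ^ j" "m + 2" a]
        by (auto simp: mult.commute)
      then show ?thesis unfolding fq floor_coarser defs by linarith
    qed
    then show "y \<in> triple q" by (simp add: triple_def)
  qed
qed

lemma triples_laminar:
  assumes "triple_class p = triple_class q"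
  shows "triple p \<inter> triple q = {} \<or> triple p \<subseteq> triple q \<or> triple q \<subseteq> triple p"
  using triples_laminar_aux[of p q] triples_laminar_aux[of q p] assms by (metis inf_commute nle_le)

text \<open>The stopping cubes of a collection. They are disjoint, and when the levels in the collection are bounded from below
they cover all its cubes.\<close>

definition maximal :: "(int \<times> (int ^ 'n)) set \<Rightarrow> (int \<times> (int ^ 'n)) set" where
  "maximal B = {p \<in> B. \<forall>j>0. anc j p \<notin> B}"

lemma maximal_disjoint: "p \<in> maximal B \<Longrightarrow> q \<in> maximal B \<Longrightarrow> p \<noteq> q \<Longrightarrow> cube p \<inter> cube q = {}"
  using cubes_laminar[of p q] by (auto simp: maximal_def) (metis anc_0 gr0I)+

lemma exists_maximal:
  assumes "p \<in> B" "\<And>q. q \<in> B \<Longrightarrow> k \<le> fst q"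
  shows "\<exists>j. anc j p \<in> maximal B"
proof -
  let ?P = "\<lambda>j. anc j p \<in> B"
  have b: "\<forall>j. ?P j \<longrightarrow> j \<le> nat (fst p - k)"
    using assms(2)[of "anc j p" for j] by fastforce
  define j where "j = Greatest ?P"
  have "?P j" unfolding j_def using assms(1) b by (intro GreatestI_nat[of ?P 0]) auto
  moreover have "i \<le> j" if "?P i" for i unfolding j_def using b by (intro Greatest_le_nat[where b="nat (fst p - k)"] that) auto
  ultimately have "anc j p \<in> maximal B"
    by (force simp: maximal_def anc_anc)
  then show ?thesis ..
qed

section \<open>Laminar families, density points and the dyadic maximal function\<close>

text \<open>Dropping a set that is contained in another one does not change the union; once no such pair is left the sets are
disjoint and the inequality is additive.\<close>

lemma laminar_weak_type_finite:
  assumes "finite I" "\<And>i. i \<in> I \<Longrightarrow> A i \<in> sets M" "A ` I \<subseteq> sets N"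
    and "\<And>i j. i \<in> I \<Longrightarrow> j \<in> I \<Longrightarrow> A i \<inter> A j = {} \<or> A i \<subseteq> A j \<or> A j \<subseteq> A i"
    and "\<And>i. i \<in> I \<Longrightarrow> c * emeasure M (A i) \<le> emeasure N (A i)"
  shows "c * emeasure M (\<Union>i\<in>I. A i) \<le> emeasure N (\<Union>i\<in>I. A i)"
  using assms
proof (induction I rule: finite_psubset_induct)
  case (psubset I)
  show ?case
  proof (cases "disjoint_family_on A I")
    case True
    have "c * emeasure M (\<Union>i\<in>I. A i) = (\<Sum>i\<in>I. c * emeasure M (A i))"
      using psubset True by (subst sum_emeasure[symmetric]) (auto simp: sum_distrib_left)
    also have "\<dots> \<le> (\<Sum>i\<in>I. emeasure N (A i))"
      using psubset by (intro sum_mono) auto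
    also have "\<dots> = emeasure N (\<Union>i\<in>I. A i)"
      using psubset True by (intro sum_emeasure) auto
    finally show ?thesis .
  next
    case False
    then obtain i j where ij: "i \<in> I" "j \<in> I" "i \<noteq> j" "A i \<inter> A j \<noteq> {}"
      by (auto simp: disjoint_family_on_def)
    then obtain i j where ij: "i \<in> I" "j \<in> I" "i \<noteq> j" "A i \<subseteq> A j"
      using psubset.prems(3) by metis
    then have "(\<Union>k\<in>I. A k) = (\<Union>k\<in>I - {i}. A k)" by auto
    moreover have "c * emeasure M (\<Union>k\<in>I - {i}. A k) \<le> emeasure N (\<Union>k\<in>I - {i}. A k)"
      using ij psubset.prems by (intro psubset.IH) blast+
    ultimately show ?thesis by simp
  qed
qed

lemma laminar_weak_type:
  fixes A :: "'i::countable \<Rightarrow> 'a set"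
  assumes M: "\<And>i. i \<in> I \<Longrightarrow> A i \<in> sets M" and f [measurable]: "f \<in> borel_measurable M"
    and lam: "\<And>i j. i \<in> I \<Longrightarrow> j \<in> I \<Longrightarrow> A i \<inter> A j = {} \<or> A i \<subseteq> A j \<or> A j \<subseteq> A i"
    and c: "\<And>i. i \<in> I \<Longrightarrow> c * emeasure M (A i) \<le> (\<integral>\<^sup>+x\<in>A i. f x \<partial>M)"
  shows "c * emeasure M (\<Union>i\<in>I. A i) \<le> (\<integral>\<^sup>+x\<in>(\<Union>i\<in>I. A i). f x \<partial>M)"
proof -
  define N where "N = density M f"
  define U where "U n = (\<Union>i\<in>{i\<in>I. to_nat i < n}. A i)" for n
  have fin: "finite {i\<in>I. to_nat i < n}" for n
    by (rule finite_subset[OF _ finite_vimageI[of "{..<n}" to_nat]]) auto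
  have sU [measurable]: "U n \<in> sets M" for n unfolding U_def using M fin by auto
  have UU: "(\<Union>n. U n) = (\<Union>i\<in>I. A i)" unfolding U_def by auto
  have sV [measurable]: "(\<Union>i\<in>I. A i) \<in> sets M" by (subst UU[symmetric]) auto
  have le: "c * emeasure M (U n) \<le> (\<integral>\<^sup>+x\<in>(\<Union>i\<in>I. A i). f x \<partial>M)" for n
  proof -
    have "c * emeasure M (U n) \<le> emeasure N (U n)" unfolding U_def
    proof (rule laminar_weak_type_finite[OF fin])
      fix i assume "i \<in> {i\<in>I. to_nat i < n}"
      then show "c * emeasure M (A i) \<le> emeasure N (A i)"
        using c[of i] M[of i] by (simp add: N_def emeasure_density)
    qed (use M lam in \<open>auto simp: N_def\<close>)
    also have "\<dots> \<le> emeasure N (\<Union>i\<in>I. A i)"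
      by (intro emeasure_mono) (auto simp: N_def UU[symmetric])
    finally show ?thesis by (simp add: N_def emeasure_density)
  qed
  have "incseq U" unfolding U_def by (fastforce intro!: incseq_SucI)
  then have "c * emeasure M (\<Union>i\<in>I. A i) = (SUP n. c * emeasure M (U n))"
    by (simp add: SUP_mult_left_ennreal[symmetric] SUP_emeasure_incseq[of U] UU image_subset_iff)
  also have "\<dots> \<le> (\<integral>\<^sup>+x\<in>(\<Union>i\<in>I. A i). f x \<partial>M)" using le by (rule SUP_least)
  finally show ?thesis .
qed

text \<open>Restricting to levels \<open>\<ge> 0\<close> bounds the size of the cubes from above, so that maximal ones exist.\<close>

lemma open_eq_maximal_cubes:
  fixes U :: "(real ^ 'n) set"
  assumes "open U"
  shows "(\<Union>p\<in>maximal {p. 0 \<le> fst p \<and> cube p \<subseteq> U}. cube p) = U"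
proof -
  let ?B = "{p. 0 \<le> fst p \<and> cube p \<subseteq> U}"
  have "y \<in> (\<Union>p\<in>maximal ?B. cube p)" if "y \<in> U" for y
  proof -
    obtain e where e: "e > 0" "ball y e \<subseteq> U" using assms \<open>y \<in> U\<close> open_contains_ball by blast
    obtain n where n: "(1/2) ^ n < e / CARD('n)"
      using real_arch_pow_inv[of "e / CARD('n)" "1/2"] e(1) by (metis divide_pos_pos of_nat_0_less_iff
        zero_less_card_finite half_gt_zero less_numeral_extra(1) field_sum_of_halves less_add_same_cancel1)
    obtain p :: "int \<times> (int ^ 'n)" where p: "fst p = int n" "y \<in> cube p"
      using exists_cube[of "int n" y] by (elim exE conjE)
    have sp: "side p = (1/2) ^ n" unfolding side_def p(1)
      by (simp only: power_int_minus power_int_of_nat power_one_over inverse_eq_divide)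
    have "cube p \<subseteq> ball y e"
    proof
      fix z assume "z \<in> cube p"
      then have "norm (y - z) \<le> CARD('n) * side p" by (rule norm_cube_diff_le[OF p(2)])
      also have "\<dots> < e" using n by (simp add: sp field_simps)
      finally show "z \<in> ball y e" by (simp add: dist_norm)
    qed
    then have "p \<in> ?B" using p(1) e(2) by simp
    then have "\<exists>j. anc j p \<in> maximal ?B" by (rule exists_maximal[where k=0]) simp
    then obtain j where "anc j p \<in> maximal ?B" ..
    moreover have "y \<in> cube (anc j p)" using cube_subset_anc p(2) by (rule subsetD)
    ultimately show ?thesis by (rule UN_I)
  qed
  moreover have "cube p \<subseteq> U" if "p \<in> maximal ?B" for p using that by (simp add: maximal_def)
  ultimately show ?thesis by (intro equalityI subsetI) (blast)+
qed

text \<open>Cover the set by an open set of nearly the same measure and cut the latter into disjoint dyadic cubes: on each of them the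
set occupies at most the proportion \<open>\<theta>\<close>, which is impossible unless it is null. This replaces the
differentiation theorem in all later arguments.\<close>

lemma low_density_null:
  fixes E :: "(real ^ 'n) set"
  assumes E [measurable]: "E \<in> sets lebesgue" and fin: "emeasure lebesgue E < \<infinity>" and th: "0 \<le> \<theta>" "\<theta> < 1"
    and dens: "\<And>p. cube p \<inter> E \<noteq> {} \<Longrightarrow> emeasure lebesgue (cube p \<inter> E) \<le> ennreal \<theta> * ennreal (vol p)"
  shows "emeasure lebesgue E = 0"
proof (rule ccontr)
  assume "emeasure lebesgue E \<noteq> 0"
  then obtain r where r: "emeasure lebesgue E = ennreal r" "r > 0"
    using fin by (cases "emeasure lebesgue E") auto
  define \<delta> where "\<delta> = (1 - \<theta>) * r / 2"
  have d: "\<delta> > 0" using th r by (simp add: \<delta>_def)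
  obtain U where U: "open U" "E \<subseteq> U" "emeasure lebesgue (U - E) < ennreal \<delta>" "(U - E) \<in> lmeasurable"
    by (rule sets_lebesgue_outer_open[OF E d]) blast
  let ?C = "maximal {p. 0 \<le> fst p \<and> cube p \<subseteq> U}"
  have UC: "(\<Union>p\<in>?C. cube p) = U" by (rule open_eq_maximal_cubes[OF U(1)])
  have disj: "disjoint_family_on cube ?C" "disjoint_family_on (\<lambda>p. cube p \<inter> E) ?C"
    using maximal_disjoint by (fastforce simp: disjoint_family_on_def)+
  have cnt: "countable ?C" by (rule countableI_type)
  have Ueq: "emeasure lebesgue U = emeasure lebesgue (U - E) + emeasure lebesgue E"
  proof -
    have "U = (U - E) \<union> E" using U(2) by blast
    moreover have "emeasure lebesgue ((U - E) \<union> E) = emeasure lebesgue (U - E) + emeasure lebesgue E"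
      using U by (intro plus_emeasure[symmetric]) auto
    ultimately show ?thesis by simp
  qed
  have "emeasure lebesgue E = emeasure lebesgue (\<Union>p\<in>?C. cube p \<inter> E)"
    using UC U(2) by (intro arg_cong[where f="emeasure lebesgue"]) blast
  also have "\<dots> = (\<integral>\<^sup>+p. emeasure lebesgue (cube p \<inter> E) \<partial>count_space ?C)"
    using disj cnt by (intro emeasure_UN_countable) auto
  also have "\<dots> \<le> (\<integral>\<^sup>+p. ennreal \<theta> * emeasure lebesgue (cube p) \<partial>count_space ?C)"
  proof (rule nn_integral_mono)
    fix p show "emeasure lebesgue (cube p \<inter> E) \<le> ennreal \<theta> * emeasure lebesgue (cube p)"
      using dens[of p] by (cases "cube p \<inter> E = {}") (auto simp: emeasure_cube)
  qed
  also have "\<dots> = ennreal \<theta> * (\<integral>\<^sup>+p. emeasure lebesgue (cube p) \<partial>count_space ?C)"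
    by (rule nn_integral_cmult) auto
  also have "(\<integral>\<^sup>+p. emeasure lebesgue (cube p) \<partial>count_space ?C) = emeasure lebesgue U"
    using disj cnt by (subst UC[symmetric], intro emeasure_UN_countable[symmetric]) auto
  also have "ennreal \<theta> * emeasure lebesgue U \<le> ennreal \<theta> * (ennreal \<delta> + ennreal r)"
    using U(3) r unfolding Ueq by (intro mult_left_mono add_mono) auto
  also have "\<dots> = ennreal (\<theta> * (\<delta> + r))"
    using th d r by (simp add: ennreal_mult' ennreal_plus)
  finally have "r \<le> \<theta> * (\<delta> + r)" using r th d by (simp add: ennreal_le_iff)
  moreover have "\<theta> * \<delta> \<le> \<delta>" using th d by (simp add: mult_left_le_one_le)
  moreover have "(1 - \<theta>) * r > 0" using th r by simp
  moreover have "(1 - \<theta>) * r = r - \<theta> * r" "\<theta> * (\<delta> + r) = \<theta> * \<delta> + \<theta> * r" by (simp_all add: algebra_simps)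
  moreover have "2 * \<delta> = (1 - \<theta>) * r" by (simp add: \<delta>_def)
  ultimately show False by linarith
qed

text \<open>The points of \<open>H\<close> that violate the claim form a set to which \<open>low_density_null\<close> applies.\<close>

lemma AE_high_density_cube:
  fixes H :: "(real ^ 'n) set"
  assumes H [measurable]: "H \<in> sets lebesgue" and th: "0 \<le> \<theta>" "\<theta> < 1"
  shows "AE x in lebesgue. x \<in> H \<longrightarrow>
    (\<exists>p. x \<in> cube p \<and> ennreal (\<theta> * vol p) < emeasure lebesgue (cube p \<inter> H))"
proof -
  define L where "L = {p :: int \<times> (int ^ 'n). emeasure lebesgue (cube p \<inter> H) \<le> ennreal (\<theta> * vol p)}"
  define E where "E q = H \<inter> cube q - (\<Union>p\<in>- L. cube p)" for q
  have E_sets [measurable]: "E q \<in> sets lebesgue" for q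
  proof -
    have "(\<Union>p\<in>- L. cube p) \<in> sets lebesgue" by (intro sets.countable_UN') auto
    then show ?thesis unfolding E_def by auto
  qed
  have null: "emeasure lebesgue (E q) = 0" for q
  proof (rule low_density_null[OF E_sets _ th])
    have "emeasure lebesgue (E q) \<le> emeasure lebesgue (cube q)"
      by (rule emeasure_mono) (auto simp: E_def)
    then show "emeasure lebesgue (E q) < \<infinity>"
      using le_less_trans by (fastforce simp: emeasure_cube)
  next
    fix p assume "cube p \<inter> E q \<noteq> {}"
    then have "p \<in> L" by (auto simp: E_def)
    have "emeasure lebesgue (cube p \<inter> E q) \<le> emeasure lebesgue (cube p \<inter> H)"
      by (rule emeasure_mono) (auto simp: E_def)
    with \<open>p \<in> L\<close> show "emeasure lebesgue (cube p \<inter> E q) \<le> ennreal \<theta> * ennreal (vol p)"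
      using th by (simp add: L_def ennreal_mult')
  qed
  have "AE x in lebesgue. \<forall>q. x \<notin> E q"
    using null by (subst AE_all_countable) (auto intro!: AE_not_in null_setsI)
  then show ?thesis
  proof eventually_elim
    case (elim x)
    obtain q :: "int \<times> (int ^ 'n)" where q: "x \<in> cube q" using exists_cube by blast
    show ?case
    proof
      assume "x \<in> H"
      moreover have "x \<notin> E q" using elim by blast
      ultimately obtain p where "p \<notin> L" "x \<in> cube p" using q unfolding E_def by blast
      then show "\<exists>p. x \<in> cube p \<and> ennreal (\<theta> * vol p) < emeasure lebesgue (cube p \<inter> H)"
        unfolding L_def by (metis (mono_tags, lifting) mem_Collect_eq not_le)
    qed
  qed
qed

text \<open>Where \<open>u\<close> exceeds a number larger than \<open>c\<close> it does so on a large proportion of some cube, and then the average over this cube exceeds \<open>c\<close>.\<close>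

lemma AE_le_dyadic_averages:
  fixes u :: "real ^ 'n \<Rightarrow> real"
  assumes u [measurable]: "u \<in> borel_measurable lebesgue" and l: "0 \<le> c"
  shows "AE x in lebesgue. (\<forall>p. x \<in> cube p \<longrightarrow> (\<integral>\<^sup>+y\<in>cube p. ennreal (u y) \<partial>lebesgue) \<le> ennreal (c * vol p))
     \<longrightarrow> u x \<le> c"
proof -
  define t where "t n = c + 1 / Suc n" for n
  have t: "0 < t n" "c < t n" for n using l by (auto simp: t_def add_nonneg_pos)
  have "AE x in lebesgue. \<forall>n. x \<in> {y. t n < u y} \<longrightarrow>
    (\<exists>p. x \<in> cube p \<and> ennreal (c / t n * vol p) < emeasure lebesgue (cube p \<inter> {y. t n < u y}))"
  proof (subst AE_all_countable, intro allI AE_high_density_cube)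
    fix n
    have "{y \<in> space lebesgue. t n < u y} \<in> sets lebesgue" by measurable
    then show "{y. t n < u y} \<in> sets lebesgue" by simp
    show "0 \<le> c / t n" "c / t n < 1" using t[of n] l by (auto simp: field_simps)
  qed
  then show ?thesis
  proof eventually_elim
    case (elim x)
    show ?case
    proof (intro impI, rule ccontr)
      assume small: "\<forall>p. x \<in> cube p \<longrightarrow> (\<integral>\<^sup>+y\<in>cube p. ennreal (u y) \<partial>lebesgue) \<le> ennreal (c * vol p)"
        and "\<not> u x \<le> c"
      then have "0 < u x - c" by simp
      then obtain n where "1 / Suc n < u x - c" using nat_approx_posE by metis
      then have "t n < u x" by (simp add: t_def)
      then obtain p where p: "x \<in> cube p"
        "ennreal (c / t n * vol p) < emeasure lebesgue (cube p \<inter> {y. t n < u y})"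
        using elim by auto
      have [measurable]: "{y. t n < u y} \<in> sets lebesgue"
      proof -
        have "{y \<in> space lebesgue. t n < u y} \<in> sets lebesgue" by measurable
        then show ?thesis by simp
      qed
      have "ennreal (c * vol p) = ennreal (t n) * ennreal (c / t n * vol p)"
        using t[of n] l by (simp add: ennreal_mult'[symmetric])
      also have "\<dots> < ennreal (t n) * emeasure lebesgue (cube p \<inter> {y. t n < u y})"
        using p(2) t[of n] by (intro ennreal_mult_strict_left_mono) auto
      also have "\<dots> = (\<integral>\<^sup>+y. ennreal (t n) * indicator (cube p \<inter> {y. t n < u y}) y \<partial>lebesgue)"
        by (simp add: nn_integral_cmult_indicator)
      also have "\<dots> \<le> (\<integral>\<^sup>+y\<in>cube p. ennreal (u y) \<partial>lebesgue)"
        by (intro nn_integral_mono) (auto simp: indicator_def intro!: ennreal_leI)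
      also have "\<dots> \<le> ennreal (c * vol p)" using small p(1) by blast
      finally show False by simp
    qed
  qed
qed

text \<open>The layer cake formula, with the layer \<open>l\<close> running up to \<open>a / 2\<close> as needed for the truncation in
\<open>laminar_maximal_L2\<close>.\<close>

lemma square_eq_layer_integral:
  fixes a :: real
  assumes "0 \<le> a"
  shows "ennreal (a\<^sup>2) = (\<integral>\<^sup>+l. ennreal (8 * l) * indicator {l. 0 < l \<and> 2 * l < a} l \<partial>lborel)"
proof -
  have "(\<integral>\<^sup>+l. ennreal (8 * l) * indicator {l. 0 < l \<and> 2 * l < a} l \<partial>lborel)
      = (\<integral>\<^sup>+l. ennreal (8 * l) * indicator {0..a/2} l \<partial>lborel)"
  proof (rule nn_integral_cong_AE)
    show "AE l in lborel. ennreal (8 * l) * indicator {l. 0 < l \<and> 2 * l < a} l = ennreal (8 * l) * indicator {0..a/2} l"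
      using AE_lborel_singleton[of 0] AE_lborel_singleton[of "a/2"]
      by eventually_elim (auto simp: indicator_def)
  qed
  also have "\<dots> = ennreal (4 * (a/2)\<^sup>2 - 4 * 0\<^sup>2)"
    using assms by (intro nn_integral_FTC_Icc[where F="\<lambda>l. 4 * l\<^sup>2"])
      (auto intro!: derivative_eq_intros simp: has_real_derivative_iff_has_vector_derivative[symmetric])
  finally show ?thesis by (simp add: power2_eq_square)
qed

text \<open>The maximal theorem for a laminar family. The sets \<open>E i\<close> linearize the maximal function: on \<open>E i\<close> it is at least the average \<open>a i\<close>.
If \<open>a i > 2 l\<close>, then the part of \<open>\<phi>\<close> above \<open>l\<close> still has average at least \<open>l\<close> over \<open>A i\<close>; the weak type inequality for this part is
integrated over \<open>l\<close>. No property of the measure enters the constant.\<close>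

lemma laminar_maximal_L2:
  fixes A E :: "'i::countable \<Rightarrow> 'a set" and \<phi> :: "'a \<Rightarrow> real" and a :: "'i \<Rightarrow> real"
  assumes "sigma_finite_measure M"
    and A: "\<And>i. i \<in> I \<Longrightarrow> A i \<in> sets M" "\<And>i. i \<in> I \<Longrightarrow> emeasure M (A i) < \<infinity>"
    and E: "\<And>i. i \<in> I \<Longrightarrow> E i \<in> sets M" "\<And>i. i \<in> I \<Longrightarrow> E i \<subseteq> A i" "disjoint_family_on E I"
    and phi [measurable]: "\<phi> \<in> borel_measurable M" "\<And>x. 0 \<le> \<phi> x"
    and lam: "\<And>i j. i \<in> I \<Longrightarrow> j \<in> I \<Longrightarrow> A i \<inter> A j = {} \<or> A i \<subseteq> A j \<or> A j \<subseteq> A i"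
    and a: "\<And>i. i \<in> I \<Longrightarrow> 0 \<le> a i"
      "\<And>i. i \<in> I \<Longrightarrow> ennreal (a i) * emeasure M (A i) \<le> (\<integral>\<^sup>+x\<in>A i. ennreal (\<phi> x) \<partial>M)"
  shows "(\<integral>\<^sup>+i. ennreal ((a i)\<^sup>2) * emeasure M (E i) \<partial>count_space I) \<le> 8 * (\<integral>\<^sup>+x. ennreal ((\<phi> x)\<^sup>2) \<partial>M)"
proof -
  interpret sigma_finite_measure M by fact
  interpret pair_sigma_finite M "lborel :: real measure" ..
  have cnt: "countable I" by (rule countableI_type)
  define S where "S l = {i\<in>I. 2 * l < a i}" for l
  have cntS: "countable (S l)" for l by (rule countableI_type)
  have weak: "ennreal l * (\<integral>\<^sup>+i. emeasure M (E i) \<partial>count_space (S l))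
      \<le> (\<integral>\<^sup>+x. ennreal (\<phi> x) * indicator {x. l < \<phi> x} x \<partial>M)" if "0 < l" for l
  proof -
    have [measurable]: "\<And>i. i \<in> S l \<Longrightarrow> A i \<in> sets M" "\<And>i. i \<in> S l \<Longrightarrow> E i \<in> sets M"
      using A E by (auto simp: S_def)
    have [measurable]: "(\<Union>i\<in>S l. A i) \<in> sets M" using cntS by (intro sets.countable_UN') auto
    have "(\<integral>\<^sup>+i. emeasure M (E i) \<partial>count_space (S l)) = emeasure M (\<Union>i\<in>S l. E i)"
      using cntS E(3) by (intro emeasure_UN_countable[symmetric]) (auto simp: S_def disjoint_family_on_def)
    also have "\<dots> \<le> emeasure M (\<Union>i\<in>S l. A i)"
      using E by (intro emeasure_mono) (auto simp: S_def)
    finally have "ennreal l * (\<integral>\<^sup>+i. emeasure M (E i) \<partial>count_space (S l)) \<le> ennreal l * emeasure M (\<Union>i\<in>S l. A i)"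
      by (rule mult_left_mono) simp
    also have "\<dots> \<le> (\<integral>\<^sup>+x\<in>(\<Union>i\<in>S l. A i). ennreal (\<phi> x) * indicator {x. l < \<phi> x} x \<partial>M)"
    proof (rule laminar_weak_type)
      fix i assume i: "i \<in> S l"
      then have [measurable]: "A i \<in> sets M" by simp
      let ?h = "\<integral>\<^sup>+x\<in>A i. ennreal (\<phi> x) * indicator {x. l < \<phi> x} x \<partial>M"
      have "ennreal l * emeasure M (A i) + ennreal l * emeasure M (A i) = ennreal (2 * l) * emeasure M (A i)"
        using that by (simp add: distrib_right[symmetric] ennreal_plus[symmetric] del: ennreal_plus)
      also have "\<dots> \<le> ennreal (a i) * emeasure M (A i)"
        using i by (intro mult_right_mono ennreal_leI) (auto simp: S_def)
      also have "\<dots> \<le> (\<integral>\<^sup>+x\<in>A i. ennreal (\<phi> x) \<partial>M)" using a(2)[of i] i by (auto simp: S_def)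
      also have "\<dots> \<le> (\<integral>\<^sup>+x. ennreal (\<phi> x) * indicator {x. l < \<phi> x} x * indicator (A i) x + ennreal l * indicator (A i) x \<partial>M)"
        by (intro nn_integral_mono) (auto simp: indicator_def intro!: ennreal_leI)
      also have "\<dots> = ?h + ennreal l * emeasure M (A i)"
        by (subst nn_integral_add) (auto simp: nn_integral_cmult_indicator)
      finally have "ennreal l * emeasure M (A i) + ennreal l * emeasure M (A i) \<le> ?h + ennreal l * emeasure M (A i)" .
      moreover have "ennreal l * emeasure M (A i) < \<infinity>"
        using A(2)[of i] i by (auto simp: S_def ennreal_mult_less_top)
      ultimately show "ennreal l * emeasure M (A i) \<le> ?h"
        by (auto simp: ennreal_add_left_cancel_le add.commute)
    qed (use lam in \<open>auto simp: S_def\<close>)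
    also have "\<dots> \<le> (\<integral>\<^sup>+x. ennreal (\<phi> x) * indicator {x. l < \<phi> x} x \<partial>M)"
      by (intro nn_integral_mono) (auto simp: indicator_def)
    finally show ?thesis .
  qed
  have "(\<integral>\<^sup>+i. ennreal ((a i)\<^sup>2) * emeasure M (E i) \<partial>count_space I)
      = (\<integral>\<^sup>+i. \<integral>\<^sup>+l. ennreal (8 * l) * indicator {l. 0 < l \<and> 2 * l < a i} l * emeasure M (E i) \<partial>lborel \<partial>count_space I)"
    using a(1) by (intro nn_integral_cong) (auto simp: square_eq_layer_integral nn_integral_multc)
  also have "\<dots> = (\<integral>\<^sup>+l. \<integral>\<^sup>+i. ennreal (8 * l) * indicator {l. 0 < l \<and> 2 * l < a i} l * emeasure M (E i) \<partial>count_space I \<partial>lborel)"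
    by (rule nn_integral_count_space_nn_integral[OF cnt, symmetric]) measurable
  also have "\<dots> \<le> (\<integral>\<^sup>+l. \<integral>\<^sup>+x. 8 * ennreal (\<phi> x) * indicator {l. 0 < l \<and> l < \<phi> x} l \<partial>M \<partial>lborel)"
  proof (rule nn_integral_mono)
    fix l :: real
    show "(\<integral>\<^sup>+i. ennreal (8 * l) * indicator {l. 0 < l \<and> 2 * l < a i} l * emeasure M (E i) \<partial>count_space I)
        \<le> (\<integral>\<^sup>+x. 8 * ennreal (\<phi> x) * indicator {l. 0 < l \<and> l < \<phi> x} l \<partial>M)"
    proof (cases "0 < l")
      case True
      have "(\<integral>\<^sup>+i. ennreal (8 * l) * indicator {l. 0 < l \<and> 2 * l < a i} l * emeasure M (E i) \<partial>count_space I)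
          = (\<integral>\<^sup>+i. ennreal (8 * l) * (emeasure M (E i) * indicator (S l) i) \<partial>count_space I)"
        using True by (intro nn_integral_cong) (auto simp: indicator_def S_def)
      also have "\<dots> = ennreal (8 * l) * (\<integral>\<^sup>+i. emeasure M (E i) * indicator (S l) i \<partial>count_space I)"
        by (rule nn_integral_cmult) auto
      also have "(\<integral>\<^sup>+i. emeasure M (E i) * indicator (S l) i \<partial>count_space I) = (\<integral>\<^sup>+i. emeasure M (E i) \<partial>count_space (S l))"
      proof -
        have "(\<integral>\<^sup>+i. emeasure M (E i) * indicator (S l) i \<partial>count_space I)
            = (\<integral>\<^sup>+i. emeasure M (E i) * indicator (S l) i * indicator I i \<partial>count_space UNIV)"
          by (rule nn_integral_count_space_indicator) simp
        also have "\<dots> = (\<integral>\<^sup>+i. emeasure M (E i) * indicator (S l) i \<partial>count_space UNIV)"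
          by (intro nn_integral_cong) (auto simp: S_def indicator_def)
        also have "\<dots> = (\<integral>\<^sup>+i. emeasure M (E i) \<partial>count_space (S l))"
          by (rule nn_integral_count_space_indicator[symmetric]) simp
        finally show ?thesis .
      qed
      also have "ennreal (8 * l) * \<dots> = 8 * (ennreal l * (\<integral>\<^sup>+i. emeasure M (E i) \<partial>count_space (S l)))"
        using True by (simp add: ennreal_mult' mult.assoc)
      also have "\<dots> \<le> 8 * (\<integral>\<^sup>+x. ennreal (\<phi> x) * indicator {x. l < \<phi> x} x \<partial>M)"
        using weak[OF True] by (rule mult_left_mono) simp
      also have "\<dots> = (\<integral>\<^sup>+x. 8 * (ennreal (\<phi> x) * indicator {x. l < \<phi> x} x) \<partial>M)"
        by (rule nn_integral_cmult[symmetric]) measurable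
      also have "\<dots> = (\<integral>\<^sup>+x. 8 * ennreal (\<phi> x) * indicator {l. 0 < l \<and> l < \<phi> x} l \<partial>M)"
        using True by (intro nn_integral_cong) (auto simp: indicator_def)
      finally show ?thesis .
    qed (simp add: indicator_def)
  qed
  also have "\<dots> = (\<integral>\<^sup>+x. \<integral>\<^sup>+l. 8 * ennreal (\<phi> x) * indicator {l. 0 < l \<and> l < \<phi> x} l \<partial>lborel \<partial>M)"
    by (rule Fubini') (simp add: indicator_def split_beta')
  also have "\<dots> = (\<integral>\<^sup>+x. 8 * ennreal ((\<phi> x)\<^sup>2) \<partial>M)"
  proof (rule nn_integral_cong)
    fix x
    have "{l. 0 < l \<and> l < \<phi> x} = {0<..<\<phi> x}" by auto
    then have "(\<integral>\<^sup>+l. 8 * ennreal (\<phi> x) * indicator {l. 0 < l \<and> l < \<phi> x} l \<partial>lborel) = 8 * ennreal (\<phi> x) * ennreal (\<phi> x)"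
      using phi(2)[of x] by (simp add: nn_integral_cmult_indicator)
    also have "\<dots> = 8 * ennreal ((\<phi> x)\<^sup>2)"
      using phi(2)[of x] by (simp add: power2_eq_square ennreal_mult' mult.assoc)
    finally show "(\<integral>\<^sup>+l. 8 * ennreal (\<phi> x) * indicator {l. 0 < l \<and> l < \<phi> x} l \<partial>lborel) = 8 * ennreal ((\<phi> x)\<^sup>2)" .
  qed
  also have "\<dots> = 8 * (\<integral>\<^sup>+x. ennreal ((\<phi> x)\<^sup>2) \<partial>M)"
    by (rule nn_integral_cmult) measurable
  finally show ?thesis .
qed

section \<open>Square integrable functions and density of test functions\<close>

declare emeasure_completion [simp del]

abbreviation L2 :: "(real ^ 'n \<Rightarrow> complex) set" where
  "L2 \<equiv> L2_space lebesgue"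

text \<open>The square of the norm; the real-valued form is convenient because all functions below are square integrable.\<close>

definition energy :: "(real ^ 'n \<Rightarrow> complex) \<Rightarrow> real" where
  "energy f = (LINT x|lebesgue. (cmod (f x))\<^sup>2)"

definition cutoff :: "(real ^ 'n) set \<Rightarrow> (real ^ 'n \<Rightarrow> complex) \<Rightarrow> real ^ 'n \<Rightarrow> complex" where
  "cutoff S f = (\<lambda>x. if x \<in> S then f x else 0)"

lemma L2_space_iff_nn: "f \<in> L2_space M \<longleftrightarrow> f \<in> borel_measurable M \<and> (\<integral>\<^sup>+x. ennreal ((cmod (f x))\<^sup>2) \<partial>M) < \<infinity>"
  by (auto simp: L2_space_def L2_norm_def ennreal_sqrt_def less_top split: if_splits)

lemma L2_space_iff: "f \<in> L2_space M \<longleftrightarrow> f \<in> borel_measurable M \<and> integrable M (\<lambda>x. (cmod (f x))\<^sup>2)"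
proof (cases "f \<in> borel_measurable M")
  case True
  then have [measurable]: "f \<in> borel_measurable M" .
  show ?thesis unfolding L2_space_iff_nn integrable_iff_bounded by simp
qed (simp add: L2_space_iff_nn)

lemma L2_measurable [measurable_dest]: "f \<in> L2 \<Longrightarrow> f \<in> borel_measurable lebesgue"
  by (simp add: L2_space_iff)

lemma L2_square_integrable: "f \<in> L2 \<Longrightarrow> integrable lebesgue (\<lambda>x. (cmod (f x))\<^sup>2)"
  by (simp add: L2_space_iff)

lemma energy_nonneg [simp]: "0 \<le> energy f" by (simp add: energy_def)

lemma nn_energy: "f \<in> L2 \<Longrightarrow> (\<integral>\<^sup>+x. ennreal ((cmod (f x))\<^sup>2) \<partial>lebesgue) = ennreal (energy f)"
  unfolding energy_def by (intro nn_integral_eq_integral L2_square_integrable) auto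

lemma L2_dominated:
  assumes "f \<in> L2" "g \<in> borel_measurable lebesgue" "\<And>x. cmod (g x) \<le> cmod (f x)"
  shows "g \<in> L2" "energy g \<le> energy f"
proof -
  have i: "integrable lebesgue (\<lambda>x. (cmod (g x))\<^sup>2)"
    by (rule Bochner_Integration.integrable_bound[OF L2_square_integrable[OF assms(1)]])
      (use assms(2,3) in \<open>auto intro!: power_mono\<close>)
  then show "g \<in> L2" using assms(2) by (simp add: L2_space_iff)
  show "energy g \<le> energy f" unfolding energy_def
    using assms by (intro integral_mono i L2_square_integrable power_mono) auto
qed

lemma cutoff_measurable [measurable]:
  "S \<in> sets lebesgue \<Longrightarrow> f \<in> borel_measurable lebesgue \<Longrightarrow> cutoff S f \<in> borel_measurable lebesgue"
  unfolding cutoff_def by (rule measurable_If_set) auto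

lemma L2_cutoff: "f \<in> L2 \<Longrightarrow> S \<in> sets lebesgue \<Longrightarrow> cutoff S f \<in> L2"
  by (rule L2_dominated(1)[of f]) (auto simp: cutoff_def[of S f] intro: cutoff_measurable[unfolded cutoff_def])

lemma L2_scale: "f \<in> L2 \<Longrightarrow> (\<lambda>x. c * f x) \<in> L2"
  by (auto simp: L2_space_iff norm_mult power_mult_distrib intro!: borel_measurable_times)

lemma L2_zero [simp]: "(\<lambda>x. 0) \<in> L2"
  by (simp add: L2_space_iff)

lemma square_norm_add_le: "(cmod (a + b))\<^sup>2 \<le> 2 * (cmod a)\<^sup>2 + 2 * (cmod b)\<^sup>2"
proof -
  have "(cmod (a + b))\<^sup>2 \<le> (cmod a + cmod b)\<^sup>2" by (intro power_mono norm_triangle_ineq) auto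
  also have "\<dots> \<le> 2 * (cmod a)\<^sup>2 + 2 * (cmod b)\<^sup>2"
    using zero_le_power2[of "cmod a - cmod b"] by (simp add: power2_eq_square algebra_simps)
  finally show ?thesis .
qed

lemma L2_add:
  assumes "f \<in> L2" "g \<in> L2"
  shows "(\<lambda>x. f x + g x) \<in> L2" "energy (\<lambda>x. f x + g x) \<le> 2 * energy f + 2 * energy g"
proof -
  have [measurable]: "f \<in> borel_measurable lebesgue" "g \<in> borel_measurable lebesgue" using assms by auto
  note i = L2_square_integrable[OF assms(1)] L2_square_integrable[OF assms(2)]
  have i2: "integrable lebesgue (\<lambda>x. 2 * (cmod (f x))\<^sup>2 + 2 * (cmod (g x))\<^sup>2)" using i by auto
  have i3: "integrable lebesgue (\<lambda>x. (cmod (f x + g x))\<^sup>2)"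
    by (rule Bochner_Integration.integrable_bound[OF i2]) (auto simp: square_norm_add_le)
  then show "(\<lambda>x. f x + g x) \<in> L2" by (simp add: L2_space_iff)
  have "energy (\<lambda>x. f x + g x) \<le> (LINT x|lebesgue. 2 * (cmod (f x))\<^sup>2 + 2 * (cmod (g x))\<^sup>2)"
    unfolding energy_def by (intro integral_mono i2 i3 square_norm_add_le)
  also have "\<dots> = 2 * energy f + 2 * energy g" using i by (simp add: energy_def)
  finally show "energy (\<lambda>x. f x + g x) \<le> 2 * energy f + 2 * energy g" .
qed

lemma L2_diff: "f \<in> L2 \<Longrightarrow> g \<in> L2 \<Longrightarrow> (\<lambda>x. f x - g x) \<in> L2"
  using L2_add(1)[of f "\<lambda>x. -1 * g x"] L2_scale[of g "-1"] by simp

lemma energy_triangle: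
  assumes "f \<in> L2" "g \<in> L2" "h \<in> L2"
  shows "energy (\<lambda>x. f x - h x) \<le> 2 * energy (\<lambda>x. f x - g x) + 2 * energy (\<lambda>x. g x - h x)"
  using L2_add(2)[OF L2_diff[OF assms(1,2)] L2_diff[OF assms(2,3)]] by simp

lemma energy_eq_0_iff: "f \<in> L2 \<Longrightarrow> energy f = 0 \<longleftrightarrow> (AE x in lebesgue. f x = 0)"
  using integral_nonneg_eq_0_iff_AE[OF L2_square_integrable[of f]] by (simp add: energy_def)

lemma L2_product_integrable:
  assumes "u \<in> L2" "v \<in> L2"
  shows "integrable lebesgue (\<lambda>x. u x * v x)"
proof -
  have [measurable]: "u \<in> borel_measurable lebesgue" "v \<in> borel_measurable lebesgue" using assms by auto
  have i: "integrable lebesgue (\<lambda>x. (cmod (u x))\<^sup>2 + (cmod (v x))\<^sup>2)"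
    using assms by (intro Bochner_Integration.integrable_add L2_square_integrable)
  show ?thesis
  proof (rule Bochner_Integration.integrable_bound[OF i])
    have "cmod a * cmod b \<le> (cmod a)\<^sup>2 + (cmod b)\<^sup>2" for a b
    proof -
      have "2 * (cmod a * cmod b) \<le> (cmod a)\<^sup>2 + (cmod b)\<^sup>2"
        using sum_squares_bound[of "cmod a" "cmod b"] by (simp only: mult.assoc)
      moreover have "0 \<le> cmod a * cmod b" by simp
      ultimately show ?thesis by linarith
    qed
    then show "AE x in lebesgue. norm (u x * v x) \<le> norm ((cmod (u x))\<^sup>2 + (cmod (v x))\<^sup>2)"
      by (simp add: norm_mult)
  qed auto
qed

lemma L2_Cauchy_Schwarz:
  assumes "u \<in> L2" "v \<in> L2"
  shows "(LINT x|lebesgue. cmod (u x) * cmod (v x))\<^sup>2 \<le> energy u * energy v"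
proof -
  define c where "c = (LINT x|lebesgue. cmod (u x) * cmod (v x))"
  have ic: "integrable lebesgue (\<lambda>x. cmod (u x) * cmod (v x))"
    using integrable_norm[OF L2_product_integrable[OF assms]] by (simp add: norm_mult)
  note i = L2_square_integrable[OF assms(1)] L2_square_integrable[OF assms(2)] ic
  have *: "0 \<le> t\<^sup>2 * energy u - 2 * t * c + energy v" for t
  proof -
    have "0 \<le> (LINT x|lebesgue. (t * cmod (u x) - cmod (v x))\<^sup>2)" by simp
    also have "(\<lambda>x. (t * cmod (u x) - cmod (v x))\<^sup>2)
        = (\<lambda>x. t\<^sup>2 * (cmod (u x))\<^sup>2 - 2 * t * (cmod (u x) * cmod (v x)) + (cmod (v x))\<^sup>2)"
      by (simp add: power2_diff power_mult_distrib algebra_simps)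
    also have "(LINT x|lebesgue. t\<^sup>2 * (cmod (u x))\<^sup>2 - 2 * t * (cmod (u x) * cmod (v x)) + (cmod (v x))\<^sup>2)
        = t\<^sup>2 * energy u - 2 * t * c + energy v"
      using i by (simp add: energy_def c_def)
    finally show ?thesis .
  qed
  show ?thesis
  proof (cases "energy u = 0")
    case True
    then have "AE x in lebesgue. u x = 0" using energy_eq_0_iff[OF assms(1)] by simp
    then have "AE x in lebesgue. cmod (u x) * cmod (v x) = 0" by eventually_elim simp
    then have "c = 0" unfolding c_def by (rule integral_eq_zero_AE)
    then show ?thesis by (simp add: c_def[symmetric] True)
  next
    case False
    then have "0 < energy u" using energy_nonneg[of u] by linarith
    moreover have "(c / energy u)\<^sup>2 * energy u - 2 * (c / energy u) * c + energy v = energy v - c\<^sup>2 / energy u"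
      using False by (simp add: power2_eq_square field_simps)
    ultimately have "c\<^sup>2 / energy u \<le> energy v" using *[of "c / energy u"] by linarith
    then show ?thesis using \<open>0 < energy u\<close> by (simp add: c_def[symmetric] divide_le_eq mult.commute)
  qed
qed

lemma L2_pairing_tendsto:
  assumes u: "u \<in> L2" and v: "\<And>n. v n \<in> L2" "w \<in> L2"
    and lim: "(\<lambda>n. energy (\<lambda>x. v n x - w x)) \<longlonglongrightarrow> 0"
  shows "(\<lambda>n. LINT x|lebesgue. u x * v n x) \<longlonglongrightarrow> (LINT x|lebesgue. u x * w x)"
proof (rule LIM_zero_cancel)
  have le: "cmod ((LINT x|lebesgue. u x * v n x) - (LINT x|lebesgue. u x * w x))
      \<le> sqrt (energy u * energy (\<lambda>x. v n x - w x))" for n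
  proof -
    have d: "(\<lambda>x. v n x - w x) \<in> L2" using v by (intro L2_diff)
    have "(LINT x|lebesgue. u x * v n x) - (LINT x|lebesgue. u x * w x) = (LINT x|lebesgue. u x * (v n x - w x))"
      by (subst Bochner_Integration.integral_diff[symmetric])
        (simp_all only: L2_product_integrable[OF u] v right_diff_distrib)
    also have "cmod \<dots> \<le> (LINT x|lebesgue. cmod (u x * (v n x - w x)))" by (rule integral_norm_bound)
    also have "\<dots> \<le> sqrt (energy u * energy (\<lambda>x. v n x - w x))"
      using L2_Cauchy_Schwarz[OF u d] by (intro real_le_rsqrt) (simp add: norm_mult)
    finally show ?thesis .
  qed
  have "(\<lambda>n. sqrt (energy u * energy (\<lambda>x. v n x - w x))) \<longlonglongrightarrow> sqrt (energy u * 0)"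
    by (intro tendsto_intros lim)
  then have "(\<lambda>n. sqrt (energy u * energy (\<lambda>x. v n x - w x))) \<longlonglongrightarrow> 0" by simp
  then show "(\<lambda>n. (LINT x|lebesgue. u x * v n x) - (LINT x|lebesgue. u x * w x)) \<longlonglongrightarrow> 0"
    by (rule Lim_null_comparison[rotated]) (simp add: le)
qed

lemma L2_bounded_on:
  assumes "f \<in> borel_measurable lebesgue" "S \<in> sets lebesgue" "emeasure lebesgue S < \<infinity>"
    "\<And>x. x \<in> S \<Longrightarrow> cmod (f x) \<le> M" "\<And>x. x \<notin> S \<Longrightarrow> f x = 0"
  shows "f \<in> L2"
  unfolding L2_space_iff
proof
  show "integrable lebesgue (\<lambda>x. (cmod (f x))\<^sup>2)"
    by (rule integrableI_bounded_set[where A=S and B="M\<^sup>2"]) (use assms in \<open>auto intro!: AE_I2 power_mono\<close>)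
qed fact

lemma L2_integrable_on:
  assumes "f \<in> L2" "S \<in> sets lebesgue" "emeasure lebesgue S < \<infinity>" "\<And>x. x \<notin> S \<Longrightarrow> f x = 0"
  shows "integrable lebesgue f"
    "(LINT x|lebesgue. cmod (f x))\<^sup>2 \<le> measure lebesgue S * energy f"
proof -
  let ?u = "\<lambda>x. if x \<in> S then 1 else 0 :: complex"
  have u: "?u \<in> L2"
    by (rule L2_bounded_on[of _ S 1]) (use assms in \<open>auto intro!: measurable_If_set\<close>)
  have eq: "(\<lambda>x. ?u x * f x) = f" using assms(4) by auto
  show "integrable lebesgue f" using L2_product_integrable[OF u assms(1)] unfolding eq .
  have "(\<lambda>x. (cmod (?u x))\<^sup>2) = indicator S" by (auto simp: indicator_def)
  then have "energy ?u = measure lebesgue S" using assms by (simp add: energy_def)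
  moreover have "(\<lambda>x. cmod (?u x) * cmod (f x)) = (\<lambda>x. cmod (f x))" using assms(4) by auto
  ultimately show "(LINT x|lebesgue. cmod (f x))\<^sup>2 \<le> measure lebesgue S * energy f"
    using L2_Cauchy_Schwarz[OF u assms(1)] by simp
qed

lemma energy_dominated_convergence:
  fixes g' :: "real ^ 'n \<Rightarrow> complex"
  assumes g: "\<And>n. g n \<in> borel_measurable lebesgue" "g' \<in> borel_measurable lebesgue"
    and lim: "AE x in lebesgue. (\<lambda>n. g n x) \<longlonglongrightarrow> g' x"
    and b: "\<And>n x. (cmod (g n x - g' x))\<^sup>2 \<le> b x" "integrable lebesgue b"
  shows "(\<lambda>n. energy (\<lambda>x. g n x - g' x)) \<longlonglongrightarrow> 0"
proof -
  note [measurable] = g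
  have lim2: "AE x in lebesgue. (\<lambda>n. (cmod (g n x - g' x))\<^sup>2) \<longlonglongrightarrow> 0"
    using lim
  proof eventually_elim
    case (elim x)
    then have "(\<lambda>n. (cmod (g n x - g' x))\<^sup>2) \<longlonglongrightarrow> (cmod (g' x - g' x))\<^sup>2"
      by (intro tendsto_intros)
    then show ?case by simp
  qed
  have "(\<lambda>n. LINT x|lebesgue. (cmod (g n x - g' x))\<^sup>2) \<longlonglongrightarrow> (LINT x|(lebesgue :: (real ^ 'n) measure). 0)"
    by (rule integral_dominated_convergence[OF _ _ b(2) lim2]) (use b(1) in auto)
  then show ?thesis by (simp add: energy_def)
qed

definition test_function :: "(real ^ 'n \<Rightarrow> complex) \<Rightarrow> bool" where
  "test_function h \<longleftrightarrow> continuous_on UNIV h \<and> compact (support h)"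

lemma test_functionI:
  assumes "continuous_on UNIV h" "\<And>x. x \<notin> S \<Longrightarrow> h x = 0" "compact S"
  shows "test_function h" "support h \<subseteq> S"
proof -
  have "{x. h x \<noteq> 0} \<subseteq> S" using assms(2) by auto
  then show s: "support h \<subseteq> S" unfolding support_def by (intro closure_minimal compact_imp_closed assms)
  then have "compact (support h)"
    using compact_imp_bounded[OF assms(3)] bounded_subset
    by (auto simp: compact_eq_bounded_closed support_def)
  then show "test_function h" using assms(1) by (simp add: test_function_def)
qed

lemma continuous_measurable_lebesgue:
  fixes h :: "real ^ 'n \<Rightarrow> 'a::topological_space"
  assumes "continuous_on UNIV h" shows "h \<in> borel_measurable lebesgue"
  using borel_measurable_continuous_onI[OF assms] by (simp add: measurable_completion)

lemma compact_lebesgue: "compact (S :: (real ^ 'n) set) \<Longrightarrow> S \<in> sets lebesgue"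
  "compact (S :: (real ^ 'n) set) \<Longrightarrow> emeasure lebesgue S < \<infinity>"
  using fmeasurable_compact[of S] lmeasurable_compact[of S] by (auto simp: fmeasurable_def)

lemma continuous_compact_L2:
  assumes "continuous_on UNIV h" "\<And>x. x \<notin> S \<Longrightarrow> h x = 0" "compact S"
  shows "h \<in> L2"
proof -
  have "compact (h ` S)" by (rule compact_continuous_image[OF continuous_on_subset[OF assms(1) subset_UNIV] assms(3)])
  then obtain M where "\<And>x. x \<in> S \<Longrightarrow> cmod (h x) \<le> M"
    using compact_imp_bounded by (force simp: bounded_iff)
  then show ?thesis
    using assms by (intro L2_bounded_on[of h S M] continuous_measurable_lebesgue compact_lebesgue) auto
qed

lemma test_function_L2: assumes "test_function h" shows "h \<in> L2"
proof (rule continuous_compact_L2[of h "support h"])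
  show "h x = 0" if "x \<notin> support h" for x
    using that closure_subset[of "{x. h x \<noteq> 0}"] by (auto simp: support_def)
qed (use assms in \<open>auto simp: test_function_def\<close>)

text \<open>A measurable function is an almost everywhere limit of continuous functions. Clamping their values and multiplying by a
cutoff makes dominated convergence applicable.\<close>

lemma test_functions_dense_bounded:
  fixes f :: "real ^ 'n \<Rightarrow> complex"
  assumes f: "f \<in> borel_measurable lebesgue" and b: "\<And>x. cmod (f x) \<le> M" "0 < M"
    and s: "\<And>x. r < norm x \<Longrightarrow> f x = 0" and e: "0 < e"
  shows "\<exists>h. test_function h \<and> energy (\<lambda>x. h x - f x) < e"
proof -
  have "f measurable_on UNIV"
    using f by (subst measurable_on_iff_borel_measurable) (auto simp: lebesgue_on_UNIV_eq)
  then obtain N g where N: "negligible N" and g: "\<And>n. continuous_on UNIV (g n)"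
    "\<And>x. x \<notin> N \<Longrightarrow> (\<lambda>n. g n x) \<longlonglongrightarrow> f x" by (auto simp: measurable_on_def)
  \<comment> \<open>The retraction of the plane onto the disc of radius \<open>M\<close>.\<close>
  define cl where "cl z = z / complex_of_real (max 1 (cmod z / M))" for z
  define \<eta> where "\<eta> x = complex_of_real (max 0 (min 1 (r + 1 - norm x)))" for x :: "real ^ 'n"
  define h where "h n x = \<eta> x * cl (g n x)" for n x
  have cont: "continuous_on UNIV (h n)" for n
    unfolding h_def \<eta>_def cl_def using b(2) by (intro continuous_intros g) auto
  have cl_le: "cmod (cl z) \<le> M" for z
  proof -
    have "0 < max 1 (cmod z / M)" by (rule less_le_trans[of _ 1]) auto
    moreover have "cmod z \<le> M * max 1 (cmod z / M)"
      using b(2) mult_left_mono[of "cmod z / M" "max 1 (cmod z / M)" M] by simp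
    ultimately show ?thesis by (simp add: cl_def norm_divide divide_le_eq abs_of_pos)
  qed
  have cl_id: "cl z = z" if "cmod z \<le> M" for z
    using that b(2) by (simp add: cl_def max_def)
  have cl0: "cl 0 = 0" by (simp add: cl_def)
  have eta_le: "cmod (\<eta> x) \<le> 1" for x by (simp add: \<eta>_def)
  have out: "h n x = 0" if "x \<notin> cball 0 (\<bar>r\<bar> + 1)" for n x using that by (auto simp: h_def \<eta>_def)
  have le: "cmod (h n x) \<le> M" for n x
    using mult_mono[OF eta_le[of x] cl_le[of "g n x"]] by (simp add: h_def norm_mult)
  have "(\<lambda>n. energy (\<lambda>x. h n x - f x)) \<longlonglongrightarrow> 0"
  proof (rule energy_dominated_convergence)
    show "AE x in lebesgue. (\<lambda>n. h n x) \<longlonglongrightarrow> f x"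
    proof (rule AE_I')
      show "N \<in> null_sets lebesgue" using N by (simp add: negligible_iff_null_sets)
      have "(\<lambda>n. h n x) \<longlonglongrightarrow> f x" if x: "x \<notin> N" for x
      proof -
        have "isCont cl (f x)" unfolding cl_def using b(2)
          by (intro continuous_intros) auto
        then have "(\<lambda>n. h n x) \<longlonglongrightarrow> \<eta> x * cl (f x)"
          unfolding h_def by (intro tendsto_intros isCont_tendsto_compose[of _ cl] g x)
        moreover have "\<eta> x * cl (f x) = f x"
        proof (cases "r < norm x")
          case True
          then show ?thesis by (simp only: s cl0 mult_zero_right)
        next
          case False
          then have "\<eta> x = 1" by (simp add: \<eta>_def)
          then show ?thesis by (simp only: cl_id[OF b(1)] mult_1)
        qed
        ultimately show ?thesis by simp
      qed
      then show "{x \<in> space lebesgue. \<not> (\<lambda>n. h n x) \<longlonglongrightarrow> f x} \<subseteq> N" by auto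
    qed
    fix n x
    show "(cmod (h n x - f x))\<^sup>2 \<le> (2 * M)\<^sup>2 * indicator (cball 0 (\<bar>r\<bar> + 1)) x"
    proof (cases "x \<in> cball 0 (\<bar>r\<bar> + 1)")
      case True
      have "cmod (h n x - f x) \<le> 2 * M" using norm_triangle_ineq4[of "h n x" "f x"] le[of n x] b(1)[of x] by linarith
      then have "(cmod (h n x - f x))\<^sup>2 \<le> (2 * M)\<^sup>2" by (rule power_mono) simp
      then show ?thesis using True by simp
    next
      case False
      then show ?thesis using out[OF False] s[of x] by auto
    qed
  qed (use cont f in \<open>auto intro!: continuous_measurable_lebesgue compact_lebesgue\<close>)
  then have "\<forall>\<^sub>F n in sequentially. energy (\<lambda>x. h n x - f x) < e"
    by (rule order_tendstoD(2)[OF _ e])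
  then obtain n where "energy (\<lambda>x. h n x - f x) < e"
    by (auto simp: eventually_sequentially)
  moreover have "test_function (h n)" by (rule test_functionI(1)[OF cont out compact_cball])
  ultimately show ?thesis by blast
qed

lemma test_functions_dense:
  fixes f :: "real ^ 'n \<Rightarrow> complex"
  assumes f: "f \<in> L2" and e: "0 < e"
  shows "\<exists>h. test_function h \<and> energy (\<lambda>x. h x - f x) < e"
proof -
  have [measurable]: "f \<in> borel_measurable lebesgue" using f by auto
  define S where "S k = {x \<in> space lebesgue. cmod (f x) \<le> real k} \<inter> cball 0 (real k)" for k
  have S [measurable]: "S k \<in> sets lebesgue" for k
  proof -
    have "{x \<in> space lebesgue. cmod (f x) \<le> real k} \<in> sets lebesgue" by measurable
    then show ?thesis unfolding S_def by (rule sets.Int[OF _ compact_lebesgue(1)[OF compact_cball]])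
  qed
  have "(\<lambda>k. energy (\<lambda>x. cutoff (S k) f x - f x)) \<longlonglongrightarrow> 0"
  proof (rule energy_dominated_convergence[OF _ _ _ _ L2_square_integrable[OF f]])
    show "AE x in lebesgue. (\<lambda>k. cutoff (S k) f x) \<longlonglongrightarrow> f x"
    proof (rule AE_I2, rule tendsto_eventually)
      fix x
      obtain K where "max (cmod (f x)) (norm x) \<le> real K" using real_arch_simple by blast
      then show "\<forall>\<^sub>F k in sequentially. cutoff (S k) f x = f x"
        by (intro eventually_sequentiallyI[of K]) (auto simp: cutoff_def S_def)
    qed
    show "(cmod (cutoff (S n) f x - f x))\<^sup>2 \<le> (cmod (f x))\<^sup>2" for n x by (simp add: cutoff_def)
  qed auto
  then have "\<forall>\<^sub>F k in sequentially. energy (\<lambda>x. cutoff (S k) f x - f x) < e / 4"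
    by (rule order_tendstoD(2)) (use e in simp)
  then obtain k where k: "energy (\<lambda>x. cutoff (S k) f x - f x) < e / 4"
    by (auto simp: eventually_sequentially)
  have b: "cmod (cutoff (S k) f x) \<le> real k + 1" for x by (auto simp: cutoff_def S_def)
  have s: "cutoff (S k) f x = 0" if "real k < norm x" for x using that by (auto simp: cutoff_def S_def)
  have "\<exists>h. test_function h \<and> energy (\<lambda>x. h x - cutoff (S k) f x) < e / 4"
    by (rule test_functions_dense_bounded[OF _ b _ s]) (use e in auto)
  then obtain h where h: "test_function h" "energy (\<lambda>x. h x - cutoff (S k) f x) < e / 4" by blast
  have "energy (\<lambda>x. h x - f x) \<le> 2 * energy (\<lambda>x. h x - cutoff (S k) f x) + 2 * energy (\<lambda>x. cutoff (S k) f x - f x)"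
    by (rule energy_triangle[OF test_function_L2[OF h(1)] L2_cutoff[OF f S] f])
  then show ?thesis using h k by auto
qed

lemma test_functions_approximate:
  fixes f :: "real ^ 'n \<Rightarrow> complex"
  assumes f: "f \<in> L2"
  obtains h where "\<And>n. test_function (h n)" "(\<lambda>n. energy (\<lambda>x. h n x - f x)) \<longlonglongrightarrow> 0"
proof -
  have "\<exists>h. test_function h \<and> energy (\<lambda>x. h x - f x) < 1 / Suc n" for n
    by (rule test_functions_dense[OF f]) simp
  then obtain h where h: "\<And>n. test_function (h n)" "\<And>n. energy (\<lambda>x. h n x - f x) < 1 / Suc n" by metis
  have "(\<lambda>n. energy (\<lambda>x. h n x - f x)) \<longlonglongrightarrow> 0"
  proof (rule Lim_null_comparison[OF always_eventually])
    show "\<forall>n. norm (energy (\<lambda>x. h n x - f x)) \<le> inverse (real (Suc n))"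
      using h(2) by (auto simp: less_imp_le inverse_eq_divide)
  qed (rule LIMSEQ_inverse_real_of_nat)
  then show ?thesis using that h(1) by blast
qed

section \<open>Calderon-Zygmund operators and their kernels\<close>

text \<open>The hypotheses on a Calderon-Zygmund operator in the form in which they are used. The kernel is normalized to vanish on the
diagonal, where the kernel bounds say nothing.\<close>

locale cz =
  fixes T :: "(real ^ 'n \<Rightarrow> complex) \<Rightarrow> (real ^ 'n \<Rightarrow> complex)"
    and K :: "real ^ 'n \<Rightarrow> real ^ 'n \<Rightarrow> complex" and \<epsilon> B :: real
  assumes eps_pos: "0 < \<epsilon>" and B_nonneg: "0 \<le> B"
    and T_L2: "f \<in> L2 \<Longrightarrow> T f \<in> L2"
    and T_linear: "f \<in> L2 \<Longrightarrow> g \<in> L2 \<Longrightarrow>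
      AE x in lebesgue. T (\<lambda>x. a * f x + b * g x) x = a * T f x + b * T g x"
    and T_energy: "f \<in> L2 \<Longrightarrow> energy (T f) \<le> B\<^sup>2 * energy f"
    and K_diag: "K x x = 0"
    and K_kernel: "cz_kernel \<epsilon> K" and T_kernel: "has_kernel T K"
begin

lemma T_measurable [measurable]: "f \<in> L2 \<Longrightarrow> T f \<in> borel_measurable lebesgue"
  using T_L2 by (rule L2_measurable)

lemma T_add: "f \<in> L2 \<Longrightarrow> g \<in> L2 \<Longrightarrow> AE x in lebesgue. T (\<lambda>x. f x + g x) x = T f x + T g x"
  using T_linear[of f g 1 1] by simp

lemma T_diff: "f \<in> L2 \<Longrightarrow> g \<in> L2 \<Longrightarrow> AE x in lebesgue. T (\<lambda>x. f x - g x) x = T f x - T g x"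
  using T_linear[of f g 1 "-1"] by simp

lemma energy_cong_AE:
  assumes "f \<in> L2" "g \<in> L2" "AE x in lebesgue. f x = g x"
  shows "energy f = energy g"
proof -
  have [measurable]: "f \<in> borel_measurable lebesgue" "g \<in> borel_measurable lebesgue" using assms by auto
  show ?thesis unfolding energy_def by (rule integral_cong_AE) (use assms(3) in auto)
qed

lemma energy_T_diff_le:
  assumes "f \<in> L2" "g \<in> L2"
  shows "energy (\<lambda>x. T f x - T g x) \<le> B\<^sup>2 * energy (\<lambda>x. f x - g x)"
proof -
  have "energy (\<lambda>x. T f x - T g x) = energy (T (\<lambda>x. f x - g x))"
  proof (rule energy_cong_AE)
    show "AE x in lebesgue. T f x - T g x = T (\<lambda>x. f x - g x) x"
      using T_diff[OF assms] by eventually_elim simp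
  qed (intro L2_diff T_L2 assms)+
  also have "\<dots> \<le> B\<^sup>2 * energy (\<lambda>x. f x - g x)" by (intro T_energy L2_diff assms)
  finally show ?thesis .
qed

lemma T_null: "f \<in> L2 \<Longrightarrow> AE x in lebesgue. f x = 0 \<Longrightarrow> AE x in lebesgue. T f x = 0"
proof -
  assume f: "f \<in> L2" "AE x in lebesgue. f x = 0"
  have "energy (T f) \<le> B\<^sup>2 * energy f" by (rule T_energy) fact
  also have "energy f = 0" using energy_eq_0_iff[OF f(1)] f(2) by simp
  finally have "energy (T f) = 0" using energy_nonneg[of "T f"] by simp
  then show ?thesis using energy_eq_0_iff[OF T_L2[OF f(1)]] by simp
qed

lemma L2_sum: "finite F \<Longrightarrow> (\<And>i. i \<in> F \<Longrightarrow> f i \<in> L2) \<Longrightarrow> (\<lambda>x. \<Sum>i\<in>F. f i x) \<in> L2"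
  by (induction F rule: finite_induct) (auto intro!: L2_add(1))

lemma T_sum:
  assumes "finite F" "\<And>i. i \<in> F \<Longrightarrow> f i \<in> L2"
  shows "AE x in lebesgue. T (\<lambda>x. \<Sum>i\<in>F. f i x) x = (\<Sum>i\<in>F. T (f i) x)"
  using assms
proof (induction F rule: finite_induct)
  case empty
  then show ?case using T_null[of "\<lambda>x. 0"] by simp
next
  case (insert i F)
  have "AE x in lebesgue. T (\<lambda>x. f i x + (\<Sum>i\<in>F. f i x)) x = T (f i) x + T (\<lambda>x. \<Sum>i\<in>F. f i x) x"
    using insert by (intro T_add L2_sum) auto
  moreover have "AE x in lebesgue. T (\<lambda>x. \<Sum>i\<in>F. f i x) x = (\<Sum>i\<in>F. T (f i) x)"
    using insert by simp
  ultimately show ?case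
  proof eventually_elim
    case (elim x) then show ?case using insert(1,2) by simp
  qed
qed

lemma K_le:
  assumes "0 < r" "r \<le> norm (x - y)"
  shows "cmod (K x y) \<le> 1 / r ^ CARD('n)"
proof -
  have "x \<noteq> y" using assms by auto
  then have "cmod (K x y) \<le> 1 / norm (x - y) powr real CARD('n)" using K_kernel by (simp add: cz_kernel_def)
  also have "\<dots> = 1 / norm (x - y) ^ CARD('n)" using \<open>x \<noteq> y\<close> by (simp add: powr_realpow)
  also have "\<dots> \<le> 1 / r ^ CARD('n)" using assms \<open>x \<noteq> y\<close> by (intro divide_left_mono power_mono mult_pos_pos) auto
  finally show ?thesis .
qed

lemma K_smooth:
  assumes "0 < r" "r \<le> norm (x - y)" "norm (x - x') \<le> norm (x - y) / 2"
  shows "cmod (K x y - K x' y) \<le> (norm (x - x') / r) powr \<epsilon> / r ^ CARD('n)"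
    "cmod (K y x - K y x') \<le> (norm (x - x') / r) powr \<epsilon> / r ^ CARD('n)"
proof -
  have xy: "x \<noteq> y" using assms by auto
  have le: "cmod (K x y - K x' y) + cmod (K y x - K y x')
      \<le> norm (x - x') powr \<epsilon> / norm (x - y) powr (real CARD('n) + \<epsilon>)"
    using K_kernel xy assms(3) by (simp add: cz_kernel_def)
  also have "\<dots> \<le> norm (x - x') powr \<epsilon> / r powr (real CARD('n) + \<epsilon>)"
    using assms(1,2) eps_pos xy by (intro divide_left_mono powr_mono2 mult_pos_pos) auto
  also have "\<dots> = (norm (x - x') / r) powr \<epsilon> / r ^ CARD('n)"
    using assms by (simp add: powr_add powr_realpow powr_divide mult.commute)
  finally have "cmod (K x y - K x' y) + cmod (K y x - K y x') \<le> (norm (x - x') / r) powr \<epsilon> / r ^ CARD('n)" .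
  moreover have "0 \<le> cmod (K x y - K x' y)" "0 \<le> cmod (K y x - K y x')" by simp_all
  ultimately show "cmod (K x y - K x' y) \<le> (norm (x - x') / r) powr \<epsilon> / r ^ CARD('n)"
    "cmod (K y x - K y x') \<le> (norm (x - x') / r) powr \<epsilon> / r ^ CARD('n)" by linarith+
qed

text \<open>If \<open>x\<close> and \<open>x'\<close> are too far apart for the smoothness hypothesis, then \<open>2 * c / r \<ge> 1\<close> and the size of the kernel
suffices. In this form the bound holds for any two points of a cube, whatever the dimension.\<close>

lemma K_oscillation:
  assumes r: "0 < r" "r \<le> norm (x - y)" "r \<le> norm (x' - y)" and c: "norm (x - x') \<le> c"
  shows "cmod (K x y - K x' y) \<le> 2 * (2 * c / r) powr \<epsilon> / r ^ CARD('n)"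
    "cmod (K y x - K y x') \<le> 2 * (2 * c / r) powr \<epsilon> / r ^ CARD('n)"
proof -
  have c0: "0 \<le> c" using c norm_ge_zero[of "x - x'"] by linarith
  have rp: "0 < r ^ CARD('n)" using r by simp
  have "cmod (K x y - K x' y) \<le> 2 * (2 * c / r) powr \<epsilon> / r ^ CARD('n) \<and>
    cmod (K y x - K y x') \<le> 2 * (2 * c / r) powr \<epsilon> / r ^ CARD('n)"
  proof (cases "norm (x - x') \<le> norm (x - y) / 2")
    case True
    have "(norm (x - x') / r) powr \<epsilon> \<le> (2 * c / r) powr \<epsilon>"
      using c c0 r eps_pos by (intro powr_mono2 divide_right_mono) auto
    also have "\<dots> \<le> 2 * (2 * c / r) powr \<epsilon>" by simp
    finally have "(norm (x - x') / r) powr \<epsilon> / r ^ CARD('n) \<le> 2 * (2 * c / r) powr \<epsilon> / r ^ CARD('n)"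
      using rp by (intro divide_right_mono) auto
    then show ?thesis using K_smooth[OF r(1,2) True] by linarith
  next
    case False
    then have "1 \<le> 2 * c / r" using r c by simp
    then have "1 \<le> (2 * c / r) powr \<epsilon>" using eps_pos by (intro ge_one_powr_ge_zero) auto
    then have "1 / r ^ CARD('n) + 1 / r ^ CARD('n) \<le> 2 * (2 * c / r) powr \<epsilon> / r ^ CARD('n)"
      using rp by (simp add: divide_right_mono add_divide_distrib[symmetric])
    moreover have "cmod (K x y - K x' y) \<le> cmod (K x y) + cmod (K x' y)"
      "cmod (K y x - K y x') \<le> cmod (K y x) + cmod (K y x')" by (rule norm_triangle_ineq4)+
    moreover have "cmod (K x y) \<le> 1 / r ^ CARD('n)" "cmod (K x' y) \<le> 1 / r ^ CARD('n)"
      "cmod (K y x) \<le> 1 / r ^ CARD('n)" "cmod (K y x') \<le> 1 / r ^ CARD('n)"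
      using r by (auto intro!: K_le simp: norm_minus_commute)
    ultimately show ?thesis by linarith
  qed
  then show "cmod (K x y - K x' y) \<le> 2 * (2 * c / r) powr \<epsilon> / r ^ CARD('n)"
    "cmod (K y x - K y x') \<le> 2 * (2 * c / r) powr \<epsilon> / r ^ CARD('n)" by auto
qed

text \<open>Smoothness in the second variable gives continuity off the diagonal.\<close>

lemma K_measurable: "K x \<in> borel_measurable lebesgue"
proof -
  have "continuous_on (- {x}) (K x)"
    unfolding continuous_on_def
  proof (intro ballI)
    fix y assume "y \<in> - {x}"
    then have r: "0 < norm (y - x)" by simp
    let ?r = "norm (y - x)"
    have "((\<lambda>z. K x z - K x y) \<longlongrightarrow> 0) (at y)"
    proof (rule Lim_null_comparison)
      have "\<forall>\<^sub>F z in at y. z \<in> ball y (?r / 2)" 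
        unfolding eventually_at by (rule exI[of _ "?r / 2"]) (use r in \<open>auto simp: dist_commute\<close>)
      then show "\<forall>\<^sub>F z in at y. norm (K x z - K x y) \<le> (norm (y - z) / ?r) powr \<epsilon> / ?r ^ CARD('n)"
      proof eventually_elim
        case (elim z)
        then have "norm (y - z) \<le> ?r / 2" by (simp add: dist_norm)
        from K_smooth(2)[OF r order_refl this] show ?case by (simp add: norm_minus_commute)
      qed
      have "((\<lambda>z. norm (y - z) / ?r) \<longlongrightarrow> norm (y - y) / ?r) (at y)" using r by (intro tendsto_intros) auto
      then have "((\<lambda>z. (norm (y - z) / ?r) powr \<epsilon>) \<longlongrightarrow> 0) (at y)"
        using eps_pos by (intro tendsto_zero_powrI[where b=\<epsilon>] tendsto_const) auto
      then have "((\<lambda>z. (norm (y - z) / ?r) powr \<epsilon> / ?r ^ CARD('n)) \<longlongrightarrow> 0 / ?r ^ CARD('n)) (at y)"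
        using r by (intro tendsto_divide tendsto_const) auto
      then show "((\<lambda>z. (norm (y - z) / ?r) powr \<epsilon> / ?r ^ CARD('n)) \<longlongrightarrow> 0) (at y)" by simp
    qed
    then have "(K x \<longlongrightarrow> K x y) (at y)" by (rule LIM_zero_cancel)
    then show "(K x \<longlongrightarrow> K x y) (at y within - {x})" by (rule tendsto_within_subset) simp
  qed
  then have "(\<lambda>y. indicator (- {x}) y *\<^sub>R K x y) \<in> borel_measurable borel"
    by (intro borel_measurable_continuous_on_indicator) auto
  also have "(\<lambda>y. indicator (- {x}) y *\<^sub>R K x y) = K x" by (auto simp: indicator_def K_diag)
  finally show ?thesis by (simp add: measurable_completion)
qed

definition Kop :: "(real ^ 'n \<Rightarrow> complex) \<Rightarrow> real ^ 'n \<Rightarrow> complex" where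
  "Kop f x = (LINT y|lebesgue. K x y * f y)"

lemma Kop_integrable:
  assumes "integrable lebesgue f" "0 < r" "\<And>y. f y \<noteq> 0 \<Longrightarrow> r \<le> norm (x - y)"
  shows "integrable lebesgue (\<lambda>y. K x y * f y)"
proof -
  have [measurable]: "f \<in> borel_measurable lebesgue" "K x \<in> borel_measurable lebesgue"
    using assms K_measurable by auto
  have i: "integrable lebesgue (\<lambda>y. 1 / r ^ CARD('n) * cmod (f y))" using assms by auto
  show ?thesis
  proof (rule Bochner_Integration.integrable_bound[OF i])
    show "AE y in lebesgue. norm (K x y * f y) \<le> norm (1 / r ^ CARD('n) * cmod (f y))"
    proof (rule AE_I2)
      fix y
      show "norm (K x y * f y) \<le> norm (1 / r ^ CARD('n) * cmod (f y))"
      proof (cases "f y = 0")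
        case False
        then have "cmod (K x y) \<le> 1 / r ^ CARD('n)" using assms by (intro K_le) auto
        then have "cmod (K x y) * cmod (f y) \<le> 1 / r ^ CARD('n) * cmod (f y)" by (rule mult_right_mono) simp
        then show ?thesis using assms(2) by (simp add: norm_mult)
      qed simp
    qed
  qed auto
qed

lemma Kop_le:
  assumes "integrable lebesgue f" "0 < r" "\<And>y. f y \<noteq> 0 \<Longrightarrow> r \<le> norm (x - y)"
  shows "cmod (Kop f x) \<le> 1 / r ^ CARD('n) * (LINT y|lebesgue. cmod (f y))"
proof -
  have "cmod (Kop f x) \<le> (LINT y|lebesgue. cmod (K x y * f y))" unfolding Kop_def by (rule integral_norm_bound)
  also have "\<dots> \<le> (LINT y|lebesgue. 1 / r ^ CARD('n) * cmod (f y))"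
  proof (rule integral_mono)
    show "integrable lebesgue (\<lambda>y. cmod (K x y * f y))" by (rule integrable_norm[OF Kop_integrable[OF assms]])
    show "integrable lebesgue (\<lambda>y. 1 / r ^ CARD('n) * cmod (f y))" using assms by auto
    fix y
    show "cmod (K x y * f y) \<le> 1 / r ^ CARD('n) * cmod (f y)"
    proof (cases "f y = 0")
      case False
      then have "cmod (K x y) \<le> 1 / r ^ CARD('n)" using assms by (intro K_le) auto
      then have "cmod (K x y) * cmod (f y) \<le> 1 / r ^ CARD('n) * cmod (f y)" by (rule mult_right_mono) simp
      then show ?thesis by (simp add: norm_mult)
    qed simp
  qed
  finally show ?thesis by simp
qed

lemma Kop_diff:
  assumes "integrable lebesgue f" "integrable lebesgue g" "0 < r"
    "\<And>y. f y \<noteq> 0 \<Longrightarrow> r \<le> norm (x - y)" "\<And>y. g y \<noteq> 0 \<Longrightarrow> r \<le> norm (x - y)"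
  shows "Kop (\<lambda>y. f y - g y) x = Kop f x - Kop g x"
  unfolding Kop_def
  by (subst Bochner_Integration.integral_diff[symmetric])
    (use Kop_integrable[OF assms(1,3,4)] Kop_integrable[OF assms(2,3,5)] in \<open>auto simp: right_diff_distrib\<close>)

lemma Kop_continuous_on:
  assumes f: "integrable lebesgue f" and r: "0 < r" and sep: "\<And>x y. x \<in> C \<Longrightarrow> f y \<noteq> 0 \<Longrightarrow> r \<le> norm (x - y)"
  shows "continuous_on C (Kop f)"
  unfolding continuous_on_def
proof
  fix x assume x: "x \<in> C"
  let ?I = "LINT y|lebesgue. cmod (f y)"
  have "((\<lambda>z. Kop f z - Kop f x) \<longlongrightarrow> 0) (at x within C)"
  proof (rule Lim_null_comparison)
    have "\<forall>\<^sub>F z in at x within C. dist z x < r / 2"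
      using r eventually_at by (metis half_gt_zero)
    moreover have "\<forall>\<^sub>F z in at x within C. z \<in> C" by (simp add: eventually_at_filter)
    ultimately show "\<forall>\<^sub>F z in at x within C. norm (Kop f z - Kop f x) \<le> (norm (x - z) / r) powr \<epsilon> / r ^ CARD('n) * ?I"
    proof eventually_elim
      case (elim z)
      have xz: "norm (x - z) \<le> r / 2" using elim(1) by (simp add: dist_norm norm_minus_commute)
      have ix: "integrable lebesgue (\<lambda>y. K x y * f y)" by (rule Kop_integrable[OF f r sep[OF x]])
      have iz: "integrable lebesgue (\<lambda>y. K z y * f y)" by (rule Kop_integrable[OF f r sep[OF elim(2)]])
      have "Kop f z - Kop f x = (LINT y|lebesgue. K z y * f y - K x y * f y)"
        unfolding Kop_def using ix iz by simp
      also have "cmod \<dots> \<le> (LINT y|lebesgue. cmod (K z y * f y - K x y * f y))" by (rule integral_norm_bound)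
      also have "\<dots> \<le> (LINT y|lebesgue. (norm (x - z) / r) powr \<epsilon> / r ^ CARD('n) * cmod (f y))"
      proof (rule integral_mono)
        fix y
        show "cmod (K z y * f y - K x y * f y) \<le> (norm (x - z) / r) powr \<epsilon> / r ^ CARD('n) * cmod (f y)"
        proof (cases "f y = 0")
          case False
          then have "r \<le> norm (x - y)" using sep[OF x] by blast
          then have "cmod (K x y - K z y) \<le> (norm (x - z) / r) powr \<epsilon> / r ^ CARD('n)"
            using xz by (intro K_smooth(1)[OF r]) auto
          then have "cmod (K z y - K x y) * cmod (f y) \<le> (norm (x - z) / r) powr \<epsilon> / r ^ CARD('n) * cmod (f y)"
            by (intro mult_right_mono) (auto simp: norm_minus_commute)
          then show ?thesis by (simp add: left_diff_distrib[symmetric] norm_mult)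
        qed simp
      qed (use ix iz f in auto)
      finally show ?case by simp
    qed
    have "((\<lambda>z. norm (x - z) / r) \<longlongrightarrow> norm (x - x) / r) (at x within C)" using r by (intro tendsto_intros) auto
    then have "((\<lambda>z. (norm (x - z) / r) powr \<epsilon>) \<longlongrightarrow> 0) (at x within C)"
      using eps_pos r by (intro tendsto_zero_powrI[where b=\<epsilon>] tendsto_const) auto
    then have "((\<lambda>z. (norm (x - z) / r) powr \<epsilon> / r ^ CARD('n) * ?I) \<longlongrightarrow> 0 / r ^ CARD('n) * ?I) (at x within C)"
      using r by (intro tendsto_divide tendsto_const tendsto_mult) auto
    then show "((\<lambda>z. (norm (x - z) / r) powr \<epsilon> / r ^ CARD('n) * ?I) \<longlongrightarrow> 0) (at x within C)" by simp
  qed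
  then show "(Kop f \<longlongrightarrow> Kop f x) (at x within C)" by (rule LIM_zero_cancel)
qed

text \<open>The kernel formula is assumed for continuous functions only. Multiplying by cutoffs \<open>\<eta>\<close> that separate the
supports, it extends by density first to \<open>f\<close> and then, in weak form, to all test functions on the other side; the
difference of the two sides is orthogonal to every test function and therefore zero.\<close>

lemma kernel_representation_on:
  assumes f: "f \<in> L2" and A: "compact A" "A \<noteq> {}" "\<And>x. x \<notin> A \<Longrightarrow> f x = 0"
    and C: "compact C" "C \<noteq> {}" and AC: "A \<inter> C = {}"
  shows "AE x in lebesgue. x \<in> C \<longrightarrow> T f x = Kop f x"
proof -
  \<comment> \<open>A quarter of the distance: neighbourhoods of radius \<open>r\<close> of \<open>A\<close> and \<open>C\<close> stay at distance more than \<open>r\<close>.\<close>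
  define r where "r = setdist A C / 4"
  have r: "0 < r" using setdist_gt_0_compact_closed[OF A(1) compact_imp_closed[OF C(1)]] A C AC
    by (simp add: r_def)
  define \<eta> where "\<eta> S x = complex_of_real (max 0 (1 - infdist x S / r))" for S and x :: "real ^ 'n"
  define N where "N S = {x. infdist x S \<le> r}" for S :: "(real ^ 'n) set"
  have compN: "compact (N A)" "compact (N C)" unfolding N_def using A C r by (auto intro!: compact_infdist_le)
  have eta_cont: "continuous_on UNIV (\<eta> S)" for S unfolding \<eta>_def using r by (intro continuous_intros) auto
  have eta_out: "\<eta> S x = 0" if "x \<notin> N S" for S x using that r by (simp add: \<eta>_def N_def)
  have eta_1: "\<eta> S x = 1" if "x \<in> S" for S x using that by (simp add: \<eta>_def)
  have eta_le: "cmod (\<eta> S x) \<le> 1" for S x using r infdist_nonneg[of x S] by (simp add: \<eta>_def)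
  have sub: "S \<subseteq> N S" for S using r by (auto simp: N_def)
  have sep: "r \<le> norm (x - y)" if xy: "x \<in> N C" "y \<in> N A" for x y
  proof -
    obtain a where a: "a \<in> A" "infdist y A = dist y a"
      using infdist_attains_inf[OF compact_imp_closed[OF A(1)] A(2)] by blast
    obtain c where c: "c \<in> C" "infdist x C = dist x c"
      using infdist_attains_inf[OF compact_imp_closed[OF C(1)] C(2)] by blast
    have "4 * r \<le> dist a c" using setdist_le_dist[OF a(1) c(1)] by (simp add: r_def)
    also have "dist a c \<le> dist y a + dist x y + dist x c"
      using dist_triangle[of a c y] dist_triangle[of y c x] by (simp add: dist_commute)
    also have "dist y a \<le> r" using xy(2) a(2) by (simp add: N_def)
    also have "dist x c \<le> r" using xy(1) c(2) by (simp add: N_def)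
    finally show ?thesis using r by (simp add: dist_norm)
  qed
  have mN: "N A \<in> sets lebesgue" "N C \<in> sets lebesgue" "emeasure lebesgue (N A) < \<infinity>" "emeasure lebesgue (N C) < \<infinity>"
    using compact_lebesgue compN by auto
  have Kop_L2: "cutoff (N C) (Kop u) \<in> L2" if u: "u \<in> L2" "\<And>y. y \<notin> N A \<Longrightarrow> u y = 0" for u
  proof -
    have i: "integrable lebesgue u" by (rule L2_integrable_on(1)[OF u(1) mN(1,3) u(2)])
    have s: "r \<le> norm (x - y)" if "x \<in> N C" "u y \<noteq> 0" for x y using sep u(2) that by blast
    have "continuous_on (N C) (Kop u)" by (rule Kop_continuous_on[OF i r s])
    then have "(\<lambda>x. indicator (N C) x *\<^sub>R Kop u x) \<in> borel_measurable borel"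
      using compN(2) by (intro borel_measurable_continuous_on_indicator borel_closed compact_imp_closed)
    also have "(\<lambda>x. indicator (N C) x *\<^sub>R Kop u x) = cutoff (N C) (Kop u)" by (auto simp: cutoff_def)
    finally have m: "cutoff (N C) (Kop u) \<in> borel_measurable lebesgue" by (simp add: measurable_completion)
    show ?thesis
    proof (rule L2_bounded_on[OF m mN(2,4)])
      fix x assume "x \<in> N C"
      then show "cmod (cutoff (N C) (Kop u) x) \<le> 1 / r ^ CARD('n) * (LINT y|lebesgue. cmod (u y))"
        using Kop_le[OF i r s] by (simp add: cutoff_def)
    qed (simp add: cutoff_def)
  qed
  obtain h where h: "\<And>n. test_function (h n)" "(\<lambda>n. energy (\<lambda>x. h n x - f x)) \<longlonglongrightarrow> 0"
    using test_functions_approximate[OF f] by blast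
  define F where "F n x = \<eta> A x * h n x" for n x
  have Fcont: "continuous_on UNIV (F n)" for n
    using h(1)[of n] eta_cont unfolding F_def test_function_def by (intro continuous_intros) auto
  have Fout: "F n x = 0" if "x \<notin> N A" for n x using eta_out[OF that] by (simp add: F_def)
  have FL2: "F n \<in> L2" for n by (rule test_function_L2[OF test_functionI(1)[OF Fcont Fout compN(1)]])
  have fout: "f x = 0" if "x \<notin> N A" for x using that sub A(3) by blast
  have dL2: "(\<lambda>x. F n x - f x) \<in> L2" for n by (intro L2_diff FL2 f)
  have Flim: "(\<lambda>n. energy (\<lambda>x. F n x - f x)) \<longlonglongrightarrow> 0"
  proof (rule Lim_null_comparison[OF always_eventually h(2)], rule allI)
    fix n
    have "energy (\<lambda>x. F n x - f x) \<le> energy (\<lambda>x. h n x - f x)"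
    proof (rule L2_dominated(2))
      show "(\<lambda>x. h n x - f x) \<in> L2" by (intro L2_diff test_function_L2 h f)
      show "(\<lambda>x. F n x - f x) \<in> borel_measurable lebesgue" by (rule L2_measurable[OF dL2])
      fix x
      have "F n x - f x = \<eta> A x * (h n x - f x)"
        using A(3)[of x] eta_1[of x A] by (cases "x \<in> A") (auto simp: F_def)
      then show "cmod (F n x - f x) \<le> cmod (h n x - f x)"
        using mult_right_mono[OF eta_le[of A x] norm_ge_zero[of "h n x - f x"]] by (simp add: norm_mult)
    qed
    then show "norm (energy (\<lambda>x. F n x - f x)) \<le> energy (\<lambda>x. h n x - f x)" by simp
  qed
  have pair: "(LINT x|lebesgue. (\<eta> C x * g x) * T f x) = (LINT x|lebesgue. (\<eta> C x * g x) * cutoff (N C) (Kop f) x)"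
    if g: "test_function g" for g
  proof -
    define G where "G x = \<eta> C x * g x" for x
    have Gcont: "continuous_on UNIV G"
      using g eta_cont unfolding G_def test_function_def by (intro continuous_intros) auto
    have Gout: "G x = 0" if "x \<notin> N C" for x using eta_out[OF that] by (simp add: G_def)
    note Gtest = test_functionI[OF Gcont Gout compN(2)]
    have GL2: "G \<in> L2" by (rule test_function_L2[OF Gtest(1)])
    have Gint: "integrable lebesgue G" by (rule L2_integrable_on(1)[OF GL2 mN(2,4) Gout])
    have cG: "Kop u x * G x = G x * cutoff (N C) (Kop u) x" for u x
      using Gout[of x] by (simp add: cutoff_def)
    have eq: "(LINT x|lebesgue. G x * T (F n) x) = (LINT x|lebesgue. G x * cutoff (N C) (Kop (F n)) x)" for n
    proof -
      note Ft = test_functionI[OF Fcont[of n] Fout compN(1)]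
      have "N A \<inter> N C = {}" using sep r by force
      then have "support (F n) \<inter> support G = {}" using Ft(2) Gtest(2) by blast
      then have "(LINT x|lebesgue. T (F n) x * G x) = (LINT x|lebesgue. LINT y|lebesgue. K x y * F n y * G x)"
        using T_kernel Ft(1) Gtest(1) unfolding has_kernel_def test_function_def by blast
      also have "\<dots> = (LINT x|lebesgue. Kop (F n) x * G x)" by (simp add: Kop_def)
      finally show ?thesis by (simp add: cG mult.commute[of "T _ _"])
    qed
    have "(\<lambda>n. energy (\<lambda>x. T (F n) x - T f x)) \<longlonglongrightarrow> 0"
    proof (rule Lim_null_comparison[OF always_eventually], rule allI)
      show "norm (energy (\<lambda>x. T (F n) x - T f x)) \<le> B\<^sup>2 * energy (\<lambda>x. F n x - f x)" for n
        using energy_T_diff_le[OF FL2 f] by simp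
      show "(\<lambda>n. B\<^sup>2 * energy (\<lambda>x. F n x - f x)) \<longlonglongrightarrow> 0"
        by (rule tendsto_mult_right_zero[OF Flim])
    qed
    then have l1: "(\<lambda>n. LINT x|lebesgue. G x * T (F n) x) \<longlonglongrightarrow> (LINT x|lebesgue. G x * T f x)"
      by (intro L2_pairing_tendsto GL2 T_L2 FL2 f)
    define c where "c = 1 / r ^ CARD('n)"
    have c: "0 \<le> c" using r by (simp add: c_def)
    define IG where "IG = (LINT x|lebesgue. cmod (G x))"
    have "(\<lambda>n. (LINT x|lebesgue. G x * cutoff (N C) (Kop (F n)) x) - (LINT x|lebesgue. G x * cutoff (N C) (Kop f) x)) \<longlonglongrightarrow> 0"
    proof (rule Lim_null_comparison[OF always_eventually], rule allI)
      fix n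
      define I where "I = (LINT y|lebesgue. cmod (F n y - f y))"
      have dout: "F n y - f y = 0" if "y \<notin> N A" for y using Fout[OF that] fout[OF that] by simp
      have dint: "integrable lebesgue (\<lambda>y. F n y - f y)" by (rule L2_integrable_on(1)[OF dL2 mN(1,3) dout])
      have iF: "integrable lebesgue (F n)" by (rule L2_integrable_on(1)[OF FL2 mN(1,3) Fout])
      have iif: "integrable lebesgue f" by (rule L2_integrable_on(1)[OF f mN(1,3) fout])
      have I_le: "I \<le> sqrt (measure lebesgue (N A) * energy (\<lambda>x. F n x - f x))"
        unfolding I_def by (rule real_le_rsqrt[OF L2_integrable_on(2)[OF dL2 mN(1,3) dout]])
      have pw: "cmod (G x * (cutoff (N C) (Kop (F n)) x - cutoff (N C) (Kop f) x)) \<le> c * I * cmod (G x)" for x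
      proof (cases "x \<in> N C")
        case True
        have s1: "r \<le> norm (x - y)" if "F n y \<noteq> 0" for y using sep[OF True] Fout that by blast
        have s2: "r \<le> norm (x - y)" if "f y \<noteq> 0" for y using sep[OF True] fout that by blast
        have s3: "r \<le> norm (x - y)" if "F n y - f y \<noteq> 0" for y using sep[OF True] dout that by blast
        have "cmod (Kop (F n) x - Kop f x) \<le> c * I"
          using Kop_le[OF dint r s3] Kop_diff[OF iF iif r s1 s2] unfolding c_def I_def by simp
        then have "cmod (Kop (F n) x - Kop f x) * cmod (G x) \<le> c * I * cmod (G x)" by (rule mult_right_mono) simp
        then show ?thesis using True by (simp add: cutoff_def norm_mult mult.commute)
      next
        case False
        then show ?thesis using Gout by simp
      qed
      note p1 = L2_product_integrable[OF GL2 Kop_L2[OF FL2[of n] Fout]]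
      note p2 = L2_product_integrable[OF GL2 Kop_L2[OF f fout]]
      have "(LINT x|lebesgue. G x * cutoff (N C) (Kop (F n)) x) - (LINT x|lebesgue. G x * cutoff (N C) (Kop f) x)
          = (LINT x|lebesgue. G x * (cutoff (N C) (Kop (F n)) x - cutoff (N C) (Kop f) x))"
        unfolding right_diff_distrib by (rule Bochner_Integration.integral_diff[OF p1 p2, symmetric])
      also have "cmod \<dots> \<le> (LINT x|lebesgue. cmod (G x * (cutoff (N C) (Kop (F n)) x - cutoff (N C) (Kop f) x)))"
        by (rule integral_norm_bound)
      also have "\<dots> \<le> (LINT x|lebesgue. c * I * cmod (G x))"
      proof (rule integral_mono)
        show "integrable lebesgue (\<lambda>x. cmod (G x * (cutoff (N C) (Kop (F n)) x - cutoff (N C) (Kop f) x)))"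
          unfolding right_diff_distrib by (intro integrable_norm Bochner_Integration.integrable_diff p1 p2)
        show "integrable lebesgue (\<lambda>x. c * I * cmod (G x))" using Gint by auto
      qed (rule pw)
      also have "\<dots> = c * I * IG" by (simp add: IG_def)
      also have "\<dots> \<le> c * sqrt (measure lebesgue (N A) * energy (\<lambda>x. F n x - f x)) * IG"
        using c I_le by (intro mult_right_mono mult_left_mono) (auto simp: IG_def)
      finally show "norm ((LINT x|lebesgue. G x * cutoff (N C) (Kop (F n)) x) - (LINT x|lebesgue. G x * cutoff (N C) (Kop f) x))
          \<le> c * sqrt (measure lebesgue (N A) * energy (\<lambda>x. F n x - f x)) * IG" .
    next
      have "(\<lambda>n. c * sqrt (measure lebesgue (N A) * energy (\<lambda>x. F n x - f x)) * IG)
          \<longlonglongrightarrow> c * sqrt (measure lebesgue (N A) * 0) * IG"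
        by (intro tendsto_intros Flim)
      then show "(\<lambda>n. c * sqrt (measure lebesgue (N A) * energy (\<lambda>x. F n x - f x)) * IG) \<longlonglongrightarrow> 0" by simp
    qed
    then have l2: "(\<lambda>n. LINT x|lebesgue. G x * cutoff (N C) (Kop (F n)) x) \<longlonglongrightarrow> (LINT x|lebesgue. G x * cutoff (N C) (Kop f) x)"
      by (rule LIM_zero_cancel)
    have "(LINT x|lebesgue. G x * T f x) = (LINT x|lebesgue. G x * cutoff (N C) (Kop f) x)"
      by (rule LIMSEQ_unique[OF l1]) (unfold eq, rule l2)
    then show ?thesis by (simp add: G_def)
  qed
  define v where "v x = T f x - cutoff (N C) (Kop f) x" for x
  define u where "u x = \<eta> C x * v x" for x
  have vL2: "v \<in> L2" unfolding v_def by (intro L2_diff T_L2 f Kop_L2 fout)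
  have uL2: "u \<in> L2"
  proof (rule L2_dominated(1)[OF vL2])
    show "u \<in> borel_measurable lebesgue" unfolding u_def
      by (intro borel_measurable_times continuous_measurable_lebesgue[OF eta_cont] L2_measurable[OF vL2])
    show "cmod (u x) \<le> cmod (v x)" for x
      using mult_right_mono[OF eta_le[of C x] norm_ge_zero[of "v x"]] by (simp add: u_def norm_mult)
  qed
  have uL2': "(\<lambda>x. cnj (u x)) \<in> L2"
  proof (rule L2_dominated(1)[OF uL2])
    show "(\<lambda>x. cnj (u x)) \<in> borel_measurable lebesgue"
      by (rule measurable_compose[OF L2_measurable[OF uL2]]) (intro borel_measurable_continuous_onI continuous_intros)
  qed simp
  have orth: "(LINT x|lebesgue. u x * g x) = 0" if g: "test_function g" for g
  proof -
    define G where "G x = \<eta> C x * g x" for x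
    have GL2: "G \<in> L2"
    proof (rule L2_dominated(1)[OF test_function_L2[OF g]])
      show "G \<in> borel_measurable lebesgue" unfolding G_def
        by (intro borel_measurable_times continuous_measurable_lebesgue[OF eta_cont] L2_measurable[OF test_function_L2[OF g]])
      show "cmod (G x) \<le> cmod (g x)" for x
        using mult_right_mono[OF eta_le[of C x] norm_ge_zero[of "g x"]] by (simp add: G_def norm_mult)
    qed
    have "(\<lambda>x. u x * g x) = (\<lambda>x. G x * T f x - G x * cutoff (N C) (Kop f) x)"
      by (simp add: fun_eq_iff u_def v_def G_def algebra_simps)
    then have "(LINT x|lebesgue. u x * g x) = (LINT x|lebesgue. G x * T f x) - (LINT x|lebesgue. G x * cutoff (N C) (Kop f) x)"
      using Bochner_Integration.integral_diff[OF L2_product_integrable[OF GL2 T_L2[OF f]]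
        L2_product_integrable[OF GL2 Kop_L2[OF f fout]]] by simp
    then show ?thesis using pair[OF g] by (simp add: G_def)
  qed
  obtain g where g: "\<And>n. test_function (g n)" "(\<lambda>n. energy (\<lambda>x. g n x - cnj (u x))) \<longlonglongrightarrow> 0"
    using test_functions_approximate[OF uL2'] by blast
  have "(\<lambda>n. LINT x|lebesgue. u x * g n x) \<longlonglongrightarrow> (LINT x|lebesgue. u x * cnj (u x))"
    by (rule L2_pairing_tendsto[OF uL2 test_function_L2[OF g(1)] uL2' g(2)])
  then have "(LINT x|lebesgue. u x * cnj (u x)) = 0"
    using orth[OF g(1)] by (simp add: LIMSEQ_const_iff)
  moreover have "(LINT x|lebesgue. u x * cnj (u x)) = complex_of_real (energy u)"
    unfolding energy_def complex_norm_square[symmetric] by (rule integral_complex_of_real)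
  ultimately have "energy u = 0" by simp
  then have "AE x in lebesgue. u x = 0" using energy_eq_0_iff[OF uL2] by simp
  then show ?thesis
  proof eventually_elim
    case (elim x)
    show ?case
    proof
      assume "x \<in> C"
      then have "\<eta> C x = 1" "x \<in> N C" using eta_1 sub by auto
      then show "T f x = Kop f x" using elim by (simp add: u_def v_def cutoff_def)
    qed
  qed
qed

text \<open>The complement of \<open>A\<close> is exhausted by compact sets. Adding a point to \<open>A\<close> avoids the convention for the distance to the empty set.\<close>

lemma kernel_representation:
  assumes f: "f \<in> L2" and A: "compact A" "\<And>x. x \<notin> A \<Longrightarrow> f x = 0"
  shows "AE x in lebesgue. x \<notin> A \<longrightarrow> T f x = Kop f x"
proof -
  define A' where "A' = insert 0 A"
  have A': "compact A'" "A' \<noteq> {}" "\<And>x. x \<notin> A' \<Longrightarrow> f x = 0" using A by (auto simp: A'_def)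
  define C where "C n = cball 0 (real n) \<inter> {x. 1 / Suc n \<le> infdist x A'}" for n
  have "AE x in lebesgue. x \<in> C n \<longrightarrow> T f x = Kop f x" for n
  proof (cases "C n = {}")
    case False
    have "closed {x. 1 / Suc n \<le> infdist x A'}" by (intro closed_Collect_le continuous_intros)
    then have "compact (C n)" unfolding C_def by (intro compact_Int_closed compact_cball)
    moreover have "A' \<inter> C n = {}" by (auto simp: C_def)
    ultimately show ?thesis using False by (intro kernel_representation_on[OF f A'])
  qed simp
  then have "AE x in lebesgue. \<forall>n. x \<in> C n \<longrightarrow> T f x = Kop f x" unfolding AE_all_countable by blast
  moreover have "AE x in lebesgue. x \<noteq> (0 :: real ^ 'n)" 
    by (rule AE_completion[OF AE_lborel_singleton])
  ultimately show ?thesis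
  proof eventually_elim
    case (elim x)
    show ?case
    proof
      assume "x \<notin> A"
      then have "x \<notin> A'" using elim by (simp add: A'_def)
      then have "0 < infdist x A'" using A'(1,2) by (simp add: infdist_pos_not_in_closed compact_imp_closed)
      then obtain m where m: "1 / Suc m < infdist x A'" by (rule nat_approx_posE)
      obtain k where k: "norm x \<le> real k" using real_arch_simple by blast
      have "1 / Suc (max m k) \<le> 1 / Suc m" by (intro divide_left_mono) auto
      then have "x \<in> C (max m k)" using m k by (auto simp: C_def)
      then show "T f x = Kop f x" using elim by blast
    qed
  qed
qed

end

section \<open>The weak type (1,1) estimate\<close>

lemma side_neq_0 [simp]: "side p \<noteq> 0" using side_pos[of p] by linarith

lemma vol_neq_0 [simp]: "vol p \<noteq> 0" using vol_pos[of p] by linarith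

lemma vol_nonneg [simp]: "0 \<le> vol p" using vol_pos[of p] by linarith

definition mass :: "(real ^ 'n \<Rightarrow> complex) \<Rightarrow> (real ^ 'n) set \<Rightarrow> real" where
  "mass f S = (LINT y|lebesgue. cmod (cutoff S f y))"

lemma mass_nonneg [simp]: "0 \<le> mass f S" by (simp add: mass_def)

lemma nn_mass:
  assumes "integrable lebesgue (cutoff S f)"
  shows "(\<integral>\<^sup>+y\<in>S. ennreal (cmod (f y)) \<partial>lebesgue) = ennreal (mass f S)"
proof -
  have "ennreal (mass f S) = (\<integral>\<^sup>+y. ennreal (cmod (cutoff S f y)) \<partial>lebesgue)"
    unfolding mass_def by (rule nn_integral_eq_integral[symmetric]) (use assms in auto)
  also have "\<dots> = (\<integral>\<^sup>+y\<in>S. ennreal (cmod (f y)) \<partial>lebesgue)"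
    by (intro nn_integral_cong) (simp add: cutoff_def)
  finally show ?thesis ..
qed

lemma integrable_cutoff:
  assumes "integrable lebesgue f" "S \<in> sets lebesgue"
  shows "integrable lebesgue (cutoff S f)"
proof -
  have [measurable]: "f \<in> borel_measurable lebesgue" using assms(1) by auto
  show ?thesis
    by (rule Bochner_Integration.integrable_bound[OF assms(1)]) (use assms(2) in \<open>auto simp: cutoff_def[of S f]
      intro: cutoff_measurable[unfolded cutoff_def]\<close>)
qed

lemma cutoff_cutoff: "cutoff S (cutoff S' f) = cutoff (S \<inter> S') f"
  by (auto simp: cutoff_def)

lemma cutoff_UNIV [simp]: "cutoff UNIV f = f" by (simp add: cutoff_def)

lemma mass_mono:
  assumes "integrable lebesgue (cutoff S' f)" "S \<in> sets lebesgue" "S \<subseteq> S'"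
  shows "mass f S \<le> mass f S'"
  unfolding mass_def
proof (rule integral_mono)
  have "cutoff S f = cutoff S (cutoff S' f)" using assms(3) by (simp add: cutoff_cutoff Int_absorb2)
  then show "integrable lebesgue (\<lambda>y. cmod (cutoff S f y))"
    using integrable_cutoff[OF assms(1,2)] by simp
qed (use assms in \<open>auto simp: cutoff_def\<close>)

lemma L2_integrable_cutoff:
  assumes "f \<in> L2" "S \<in> sets lebesgue" "emeasure lebesgue S < \<infinity>"
  shows "integrable lebesgue (cutoff S f)"
  by (rule L2_integrable_on(1)[OF L2_cutoff[OF assms(1,2)] assms(2,3)]) (simp add: cutoff_def)

lemma emeasure_triple_finite: "emeasure lebesgue (triple p) < \<infinity>" "emeasure lebesgue (cube p) < \<infinity>"
  by (simp_all add: emeasure_triple emeasure_cube)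

lemma integrable_indicator_cube [simp]: "integrable lebesgue (indicator (cube p) :: _ \<Rightarrow> real)"
  using emeasure_triple_finite(2)[of p] by (intro integrable_real_indicator) auto

lemma triple_annulus:
  assumes "y \<in> triple (anc J p)" "y \<notin> triple p"
  shows "\<exists>j<J. y \<in> triple (anc (Suc j) p) \<and> y \<notin> triple (anc j p)"
  using assms
proof (induction J)
  case (Suc J)
  then show ?case by (cases "y \<in> triple (anc J p)") (auto simp: less_Suc_eq)
qed simp

text \<open>Cubes of bounded volume have levels bounded from below, so maximal ones exist.\<close>

lemma neg_level_le_vol: "real_of_int (- fst p) \<le> vol (p :: int \<times> (int ^ 'n))"
proof (cases "fst p \<le> 0")
  case True
  define m where "m = nat (- fst p)"
  have m: "- fst p = int m" using True by (simp add: m_def)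
  have s: "side p = 2 ^ m" unfolding side_def m by simp
  have "real m \<le> 2 ^ m" using of_nat_less_two_power[of m, where 'a=real] by simp
  also have "\<dots> \<le> (2 ^ m) ^ CARD('n)" by (rule self_le_power) (auto simp: one_le_power)
  finally show ?thesis using m by (simp add: vol_def s)
next
  case False
  then have "real_of_int (- fst p) \<le> 0" by simp
  also have "0 \<le> vol p" using vol_pos[of p] by linarith
  finally show ?thesis .
qed

context cz
begin

text \<open>The gain in the oscillation of the kernel for each doubling of the distance.\<close>

definition decay :: real where "decay = 2 powr (- \<epsilon>)"

definition osc_const :: real where "osc_const = 2 * (2 * real CARD('n)) powr \<epsilon>"

text \<open>The sum of the oscillations over all annuli \<open>3P_{j+1} - 3P_j\<close> around a cube, where \<open>P_j\<close> is its \<open>j\<close>-th ancestor; each annulus has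
at most \<open>6^d\<close> times the volume of \<open>P_j\<close>.\<close>

definition tail_const :: real where "tail_const = osc_const * 6 ^ CARD('n) / (1 - decay)"

text \<open>The three summands bound the exceptional set, the bad part and the good part in the Calderon-Zygmund decomposition.\<close>

definition weak_const :: real where
  "weak_const = 3 ^ CARD('n) + 4 * tail_const + 4 * B\<^sup>2 * (2 ^ CARD('n) + 1)"

lemma decay: "0 < decay" "decay < 1"
  using eps_pos by (auto simp: decay_def powr_less_one)

lemma osc_const_pos: "0 < osc_const" by (simp add: osc_const_def)

lemma tail_const_pos: "0 < tail_const"
  using osc_const_pos decay by (simp add: tail_const_def)

lemma weak_const_pos: "0 < weak_const"
proof -
  have "0 \<le> 4 * B\<^sup>2 * (2 ^ CARD('n) + 1)" by simp
  moreover have "(0::real) < 3 ^ CARD('n)" by simp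
  ultimately show ?thesis using tail_const_pos unfolding weak_const_def by linarith
qed

lemma K_oscillation_cube:
  assumes "x \<in> cube p" "x' \<in> cube p" "y \<notin> triple (anc j p)"
  shows "cmod (K x y - K x' y) \<le> osc_const * decay ^ j / vol (anc j p)"
    "cmod (K y x - K y x') \<le> osc_const * decay ^ j / vol (anc j p)"
proof -
  define c r where "c = real CARD('n) * side p" "r = side (anc j p)"
  have r: "0 < r" "r \<le> norm (x - y)" "r \<le> norm (x' - y)" and c: "norm (x - x') \<le> c"
    unfolding c_r_def using assms cube_subset_anc[of p j]
    by (auto simp del: split_paired_All intro!: norm_outside_triple_ge[of _ "anc j p"] norm_cube_diff_le)
  have d: "decay ^ j = (1 / 2 ^ j) powr \<epsilon>"
    unfolding decay_def by (simp add: powr_minus powr_divide powr_power powr_realpow[symmetric] powr_powr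
      inverse_eq_divide power_one_over mult.commute)
  have "2 * c / r = (2 * real CARD('n)) * (1 / 2 ^ j)" unfolding c_r_def using side_pos[of p] by (simp add: side_anc)
  then have "(2 * c / r) powr \<epsilon> = (2 * real CARD('n)) powr \<epsilon> * decay ^ j"
    unfolding d by (simp only: powr_mult[of "2 * real CARD('n)" "1 / 2 ^ j"])
  then have e: "2 * (2 * c / r) powr \<epsilon> / r ^ CARD('n) = osc_const * decay ^ j / vol (anc j p)"
    by (simp add: osc_const_def c_r_def vol_def)
  show "cmod (K x y - K x' y) \<le> osc_const * decay ^ j / vol (anc j p)"
    "cmod (K y x - K y x') \<le> osc_const * decay ^ j / vol (anc j p)"
    using K_oscillation[OF r c] unfolding e by auto
qed

lemma Kop_mean_zero_le:
  assumes b: "integrable lebesgue b" "\<And>y. y \<notin> cube p \<Longrightarrow> b y = 0" "(LINT y|lebesgue. b y) = 0"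
    and x: "x \<notin> triple (anc j p)"
  shows "cmod (Kop b x) \<le> osc_const * decay ^ j / vol (anc j p) * (LINT y|lebesgue. cmod (b y))"
proof -
  obtain z where z: "z \<in> cube p" using cube_nonempty by blast
  have s: "side p \<le> norm (x - y)" if "b y \<noteq> 0" for y
  proof -
    have "y \<in> cube p" using b(2) that by blast
    moreover have "x \<notin> triple p" using x triple_subset_anc by blast
    ultimately show ?thesis using norm_outside_triple_ge[of y p x] by (simp add: norm_minus_commute)
  qed
  have i: "integrable lebesgue (\<lambda>y. K x y * b y)" by (rule Kop_integrable[OF b(1) side_pos s])
  have "Kop b x = (LINT y|lebesgue. K x y * b y) - (LINT y|lebesgue. K x z * b y)"
    using b by (simp add: Kop_def)
  also have "\<dots> = (LINT y|lebesgue. K x y * b y - K x z * b y)"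
    using i b(1) by (intro Bochner_Integration.integral_diff[symmetric]) auto
  also have "cmod \<dots> \<le> (LINT y|lebesgue. cmod (K x y * b y - K x z * b y))" by (rule integral_norm_bound)
  also have "\<dots> \<le> (LINT y|lebesgue. osc_const * decay ^ j / vol (anc j p) * cmod (b y))"
  proof (rule integral_mono)
    show "integrable lebesgue (\<lambda>y. cmod (K x y * b y - K x z * b y))"
      using i b(1) by (intro integrable_norm Bochner_Integration.integrable_diff) auto
    show "integrable lebesgue (\<lambda>y. osc_const * decay ^ j / vol (anc j p) * cmod (b y))" using b(1) by auto
    fix y
    show "cmod (K x y * b y - K x z * b y) \<le> osc_const * decay ^ j / vol (anc j p) * cmod (b y)"
    proof (cases "b y = 0")
      case False
      then have "y \<in> cube p" using b(2) by blast
      then have "cmod (K x y - K x z) * cmod (b y) \<le> osc_const * decay ^ j / vol (anc j p) * cmod (b y)"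
        by (intro mult_right_mono K_oscillation_cube(2) x z) auto
      then show ?thesis by (simp add: left_diff_distrib[symmetric] norm_mult)
    qed simp
  qed
  also have "\<dots> = osc_const * decay ^ j / vol (anc j p) * (LINT y|lebesgue. cmod (b y))" by simp
  finally show ?thesis .
qed

lemma kernel_representation_outside_triple:
  assumes "b \<in> L2" "\<And>y. y \<notin> cube p \<Longrightarrow> b y = 0"
  shows "AE x in lebesgue. x \<notin> triple p \<longrightarrow> T b x = Kop b x"
proof -
  have "compact (closure (cube p))"
    using bounded_subset[OF bounded_triple cube_subset_triple] by (simp add: compact_closure)
  moreover have "b y = 0" if "y \<notin> closure (cube p)" for y using assms(2) that closure_subset by blast
  ultimately have "AE x in lebesgue. x \<notin> closure (cube p) \<longrightarrow> T b x = Kop b x"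
    by (intro kernel_representation assms(1))
  then show ?thesis
  proof eventually_elim
    case (elim x)
    show ?case
    proof
      assume x: "x \<notin> triple p"
      have "x \<notin> closure (cube p)"
      proof
        assume "x \<in> closure (cube p)"
        then obtain y where y: "y \<in> cube p" "dist y x < side p"
          using side_pos[of p] unfolding closure_approachable by blast
        then show False using norm_outside_triple_ge[OF y(1) x] by (simp add: dist_norm)
      qed
      then show "T b x = Kop b x" using elim by blast
    qed
  qed
qed

text \<open>The mean zero condition allows to subtract the value of the kernel at a fixed point of the cube, which gains a geometric
factor on each annulus.\<close>

lemma mean_zero_tail:
  assumes b: "b \<in> L2" "\<And>y. y \<notin> cube p \<Longrightarrow> b y = 0" "(LINT y|lebesgue. b y) = 0"
  shows "(\<integral>\<^sup>+x\<in>- triple p. ennreal (cmod (T b x)) \<partial>lebesgue) \<le> ennreal (tail_const * (LINT y|lebesgue. cmod (b y)))"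
proof -
  define I where "I = (LINT y|lebesgue. cmod (b y))"
  have I: "0 \<le> I" by (simp add: I_def)
  have bi: "integrable lebesgue b" by (rule L2_integrable_on(1)[OF b(1) cube_lebesgue emeasure_triple_finite(2) b(2)])
  define a where "a j = osc_const * decay ^ j / vol (anc j p) * I" for j
  have a: "0 \<le> a j" for j unfolding a_def using osc_const_pos decay I vol_pos[of "anc j p"]
    by (intro mult_nonneg_nonneg divide_nonneg_nonneg zero_le_power) (auto simp: less_imp_le)
  have rep: "AE x in lebesgue. x \<notin> triple p \<longrightarrow> T b x = Kop b x"
    by (rule kernel_representation_outside_triple[OF b(1,2)])
  have "(\<integral>\<^sup>+x\<in>- triple p. ennreal (cmod (T b x)) \<partial>lebesgue)
      \<le> (\<integral>\<^sup>+x. (\<Sum>j. ennreal (a j) * indicator (triple (anc (Suc j) p)) x) \<partial>lebesgue)"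
  proof (rule nn_integral_mono_AE)
    show "AE x in lebesgue. ennreal (cmod (T b x)) * indicator (- triple p) x
        \<le> (\<Sum>j. ennreal (a j) * indicator (triple (anc (Suc j) p)) x)"
      using rep
    proof eventually_elim
      case (elim x)
      show ?case
      proof (cases "x \<in> triple p")
        case False
        obtain J where "x \<in> triple (anc J p)" using exists_anc_triple by blast
        then obtain j where j: "x \<in> triple (anc (Suc j) p)" "x \<notin> triple (anc j p)"
          using triple_annulus False by blast
        have "ennreal (cmod (T b x)) \<le> ennreal (a j)"
          using elim False Kop_mean_zero_le[OF bi b(2,3) j(2)] by (simp add: a_def I_def ennreal_leI)
        also have "\<dots> = (\<Sum>i\<in>{j}. ennreal (a i) * indicator (triple (anc (Suc i) p)) x)" using j(1) by simp
        also have "\<dots> \<le> (\<Sum>j. ennreal (a j) * indicator (triple (anc (Suc j) p)) x)"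
          by (rule sum_le_suminf) auto
        finally show ?thesis using False by simp
      qed simp
    qed
  qed
  also have "\<dots> = (\<Sum>j. \<integral>\<^sup>+x. ennreal (a j) * indicator (triple (anc (Suc j) p)) x \<partial>lebesgue)"
    by (rule nn_integral_suminf) auto
  also have "\<dots> = (\<Sum>j. ennreal (osc_const * 6 ^ CARD('n) * I * decay ^ j))"
  proof (rule suminf_cong)
    fix j
    have v: "vol (anc (Suc j) p) = 2 ^ CARD('n) * vol (anc j p)"
      by (simp add: vol_anc power_mult_distrib)
    have "(\<integral>\<^sup>+x. ennreal (a j) * indicator (triple (anc (Suc j) p)) x \<partial>lebesgue)
        = ennreal (a j) * ennreal (3 ^ CARD('n) * vol (anc (Suc j) p))"
      by (simp add: nn_integral_cmult_indicator emeasure_triple)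
    also have "\<dots> = ennreal (a j * (3 ^ CARD('n) * vol (anc (Suc j) p)))" by (rule ennreal_mult'[symmetric]) (rule a)
    also have "a j * (3 ^ CARD('n) * vol (anc (Suc j) p)) = osc_const * ((3 * 2) ^ CARD('n)) * I * decay ^ j"
      unfolding a_def v power_mult_distrib using vol_pos[of "anc j p"] by simp
    finally show "(\<integral>\<^sup>+x. ennreal (a j) * indicator (triple (anc (Suc j) p)) x \<partial>lebesgue)
        = ennreal (osc_const * 6 ^ CARD('n) * I * decay ^ j)" by simp
  qed
  also have "\<dots> = ennreal (tail_const * I)"
  proof -
    have "(\<lambda>j. osc_const * 6 ^ CARD('n) * I * decay ^ j) sums (osc_const * 6 ^ CARD('n) * I * (1 / (1 - decay)))"
      using decay by (intro sums_mult geometric_sums) simp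
    then have "(\<Sum>j. ennreal (osc_const * 6 ^ CARD('n) * I * decay ^ j)) = ennreal (osc_const * 6 ^ CARD('n) * I * (1 / (1 - decay)))"
      using osc_const_pos I decay by (intro suminf_ennreal_eq) auto
    then show ?thesis by (simp add: tail_const_def)
  qed
  finally show ?thesis by (simp add: I_def)
qed

end

lemma markov_lebesgue:
  fixes u :: "real ^ 'n \<Rightarrow> ennreal"
  assumes [measurable]: "u \<in> borel_measurable lebesgue" and S: "S \<in> sets lebesgue" "\<And>x. x \<in> S \<Longrightarrow> c \<le> u x"
  shows "c * emeasure lebesgue S \<le> (\<integral>\<^sup>+x. u x \<partial>lebesgue)"
proof -
  have "c * emeasure lebesgue S = (\<integral>\<^sup>+x. c * indicator S x \<partial>lebesgue)"
    using S(1) by (simp add: nn_integral_cmult_indicator)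
  also have "\<dots> \<le> (\<integral>\<^sup>+x. u x \<partial>lebesgue)"
    using S(2) by (intro nn_integral_mono) (auto simp: indicator_def)
  finally show ?thesis .
qed

lemma superlevel_lebesgue:
  fixes u :: "real ^ 'n \<Rightarrow> complex"
  assumes [measurable]: "u \<in> borel_measurable lebesgue"
  shows "{x. c < cmod (u x)} \<in> sets lebesgue"
proof -
  have "{x \<in> space lebesgue. c < cmod (u x)} \<in> sets lebesgue" by measurable
  then show ?thesis by simp
qed

text \<open>The Calderon-Zygmund decomposition at height \<open>l\<close>, with the twist that the mean is subtracted only on finitely many of
the maximal cubes. The remaining cubes carry little of the square integral of \<open>f\<close>, which is all that the good part has to satisfy; so
no infinite sum has to be exchanged with \<open>T\<close>.\<close>

lemma (in cz) weak_type_1_1: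
  assumes f: "f \<in> L2" and fi: "integrable lebesgue f" and l: "0 < l"
  shows "ennreal l * emeasure lebesgue {x. l < cmod (T f x)} \<le> ennreal (weak_const * (LINT x|lebesgue. cmod (f x)))"
proof (cases "(LINT x|lebesgue. cmod (f x)) = 0")
  case True
  then have "AE x in lebesgue. cmod (f x) = 0"
    using integral_nonneg_eq_0_iff_AE[of lebesgue "\<lambda>x. cmod (f x)"] fi by auto
  then have "AE x in lebesgue. T f x = 0" by (intro T_null f) auto
  then have "AE x in lebesgue. x \<notin> {x. l < cmod (T f x)}" by eventually_elim (use l in auto)
  then have "emeasure lebesgue {x. l < cmod (T f x)} = 0"
    using AE_iff_measurable[OF superlevel_lebesgue[OF T_measurable[OF f]], where P="\<lambda>x. x \<notin> {x. l < cmod (T f x)}"] by auto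
  then show ?thesis by simp
next
  case False
  define I where "I = (LINT x|lebesgue. cmod (f x))"
  have I: "0 < I" using False unfolding I_def by (simp add: order_less_le)
  have fm [measurable]: "f \<in> borel_measurable lebesgue" using f by auto
  have ci: "integrable lebesgue (cutoff S f)" if "S \<in> sets lebesgue" for S using integrable_cutoff[OF fi that] .
  have mass_le: "mass f S \<le> I" if "S \<in> sets lebesgue" for S
    using mass_mono[of UNIV f S] that fi by (simp add: I_def mass_def)
  define Bs where "Bs = {p. l * vol p < mass f (cube p)}"
  define M where "M = maximal Bs"
  have level: "- \<lceil>I / l\<rceil> \<le> fst p" if "p \<in> Bs" for p
  proof -
    have "l * vol p < I" using that mass_le[OF cube_lebesgue, of p] unfolding Bs_def by auto
    then have "vol p < I / l" using l by (simp add: field_simps)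
    then have "real_of_int (- fst p) < I / l" using neg_level_le_vol[of p] by linarith
    then show ?thesis by linarith
  qed
  have MB: "p \<in> Bs" if "p \<in> M" for p using that by (simp add: M_def maximal_def)
  have disj: "p = q" if "p \<in> M" "q \<in> M" "x \<in> cube p" "x \<in> cube q" for p q x
    using maximal_disjoint[of p Bs q] that unfolding M_def by blast
  have parent: "mass f (cube p) \<le> 2 ^ CARD('n) * l * vol p" if "p \<in> M" for p
  proof -
    have "anc 1 p \<notin> Bs" using that unfolding M_def maximal_def by auto
    then have "mass f (cube (anc 1 p)) \<le> l * vol (anc 1 p)" by (simp add: Bs_def)
    moreover have "mass f (cube p) \<le> mass f (cube (anc 1 p))"
      by (intro mass_mono ci cube_subset_anc) auto
    ultimately show ?thesis by (simp add: vol_anc algebra_simps)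
  qed
  have off: "AE x in lebesgue. (\<forall>p\<in>M. x \<notin> cube p) \<longrightarrow> cmod (f x) \<le> l"
  proof -
    have "AE x in lebesgue. (\<forall>p. x \<in> cube p \<longrightarrow> (\<integral>\<^sup>+y\<in>cube p. ennreal (cmod (f y)) \<partial>lebesgue) \<le> ennreal (l * vol p))
      \<longrightarrow> cmod (f x) \<le> l"
      by (rule AE_le_dyadic_averages) (use l in auto)
    then show ?thesis
    proof eventually_elim
      case (elim x)
      show ?case
      proof
        assume a: "\<forall>p\<in>M. x \<notin> cube p"
        have "(\<integral>\<^sup>+y\<in>cube p. ennreal (cmod (f y)) \<partial>lebesgue) \<le> ennreal (l * vol p)" if x: "x \<in> cube p" for p
        proof -
          have "p \<notin> Bs"
          proof
            assume "p \<in> Bs"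
            then obtain j where "anc j p \<in> M" unfolding M_def using exists_maximal[OF _ level] by blast
            then show False using a x cube_subset_anc by blast
          qed
          then show ?thesis unfolding nn_mass[OF ci[OF cube_lebesgue]] by (auto simp: Bs_def intro!: ennreal_leI)
        qed
        then show "cmod (f x) \<le> l" using elim by blast
      qed
    qed
  qed
  define \<Omega> where "\<Omega> n = (\<Union>p\<in>{p\<in>M. n \<le> to_nat p}. cube p)" for n :: nat
  have \<Omega> [measurable]: "\<Omega> n \<in> sets lebesgue" for n
    unfolding \<Omega>_def by (intro sets.countable_UN' countableI_type) auto
  have "(\<lambda>n. energy (\<lambda>x. cutoff (\<Omega> n) f x - 0)) \<longlonglongrightarrow> 0"
  proof (rule energy_dominated_convergence[OF _ _ _ _ L2_square_integrable[OF f]])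
    show "AE x in lebesgue. (\<lambda>n. cutoff (\<Omega> n) f x) \<longlonglongrightarrow> 0"
    proof (rule AE_I2, rule tendsto_eventually)
      fix x
      show "\<forall>\<^sub>F n in sequentially. cutoff (\<Omega> n) f x = 0"
      proof (cases "\<exists>p\<in>M. x \<in> cube p")
        case True
        then obtain p where p: "p \<in> M" "x \<in> cube p" by blast
        have "x \<notin> \<Omega> n" if "Suc (to_nat p) \<le> n" for n
        proof
          assume "x \<in> \<Omega> n"
          then obtain q where q: "q \<in> M" "n \<le> to_nat q" "x \<in> cube q" by (auto simp: \<Omega>_def)
          then have "q = p" using disj p by blast
          then show False using q(2) that by simp
        qed
        then show ?thesis by (intro eventually_sequentiallyI[of "Suc (to_nat p)"]) (simp add: cutoff_def)
      next
        case False
        then have "x \<notin> \<Omega> n" for n by (auto simp: \<Omega>_def)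
        then show ?thesis by (simp add: cutoff_def)
      qed
    qed
    show "(cmod (cutoff (\<Omega> n) f x - 0))\<^sup>2 \<le> (cmod (f x))\<^sup>2" for n x by (simp add: cutoff_def)
  qed auto
  then have "\<forall>\<^sub>F n in sequentially. energy (\<lambda>x. cutoff (\<Omega> n) f x - 0) < l * I"
    by (rule order_tendstoD(2)) (use l I in simp)
  then obtain n where n: "energy (cutoff (\<Omega> n) f) < l * I" by (auto simp: eventually_sequentially)
  define F where "F = {p\<in>M. to_nat p < n}"
  have fin: "finite F" unfolding F_def by (rule finite_subset[OF _ finite_vimageI[of "{..<n}" to_nat]]) auto
  have FM: "p \<in> M" if "p \<in> F" for p using that by (simp add: F_def)
  define UF where "UF = (\<Union>p\<in>F. cube p)"
  have UF [measurable]: "UF \<in> sets lebesgue" unfolding UF_def using fin by auto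
  have nUF [measurable]: "- UF \<in> sets lebesgue" using sets.compl_sets[OF UF] by (simp add: Compl_eq_Diff_UNIV)
  have cin: "integrable lebesgue (\<lambda>x. cmod (cutoff S f x))" if "S \<in> sets lebesgue" for S
    by (rule integrable_norm[OF ci[OF that]])
  have sum_disj: "(\<Sum>p\<in>F. if x \<in> cube p then h p else 0) = h q" if "q \<in> F" "x \<in> cube q"
    for x q and h :: "_ \<Rightarrow> 'z::comm_monoid_add"
  proof -
    have "(\<Sum>p\<in>F. if x \<in> cube p then h p else 0) = (\<Sum>p\<in>F. if p = q then h p else 0)"
      by (rule sum.cong) (use that disj FM in auto)
    then show ?thesis using fin that by simp
  qed
  have sum_disj0: "(\<Sum>p\<in>F. if x \<in> cube p then h p else 0) = 0" if "x \<notin> UF"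
    for x and h :: "_ \<Rightarrow> 'z::comm_monoid_add"
    by (rule sum.neutral) (use that in \<open>auto simp: UF_def\<close>)
  have masses: "mass f (- UF) + (\<Sum>p\<in>F. mass f (cube p)) = I"
  proof -
    have "mass f (- UF) + (\<Sum>p\<in>F. mass f (cube p))
        = (LINT x|lebesgue. cmod (cutoff (- UF) f x) + (\<Sum>p\<in>F. cmod (cutoff (cube p) f x)))"
      unfolding mass_def using cin[OF nUF] cin[OF cube_lebesgue]
      by (subst Bochner_Integration.integral_add) (auto simp: Bochner_Integration.integral_sum)
    also have "\<dots> = I" unfolding I_def
    proof (rule Bochner_Integration.integral_cong[OF refl])
      fix x
      have e: "(\<Sum>p\<in>F. cmod (cutoff (cube p) f x)) = (\<Sum>p\<in>F. if x \<in> cube p then cmod (f x) else 0)"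
        by (rule sum.cong) (auto simp: cutoff_def)
      show "cmod (cutoff (- UF) f x) + (\<Sum>p\<in>F. cmod (cutoff (cube p) f x)) = cmod (f x)"
      proof (cases "x \<in> UF")
        case True
        then obtain q where "q \<in> F" "x \<in> cube q" by (auto simp: UF_def)
        then show ?thesis unfolding e using True sum_disj[of q x "\<lambda>_. cmod (f x)"] by (simp add: cutoff_def)
      next
        case False
        then show ?thesis unfolding e using sum_disj0[of x "\<lambda>_. cmod (f x)"] by (simp add: cutoff_def)
      qed
    qed
    finally show ?thesis .
  qed
  have massF: "(\<Sum>p\<in>F. mass f (cube p)) \<le> I" using masses mass_nonneg[of f "- UF"] by linarith
  \<comment> \<open>The mean of \<open>f\<close> over the cube; \<open>b p\<close> is the corresponding bad function and \<open>g\<close> the good part.\<close>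
  define m where "m p = (LINT y|lebesgue. cutoff (cube p) f y) / complex_of_real (vol p)" for p
  have m: "cmod (m p) * vol p \<le> mass f (cube p)" for p
  proof -
    have "cmod (m p) * vol p = cmod (LINT y|lebesgue. cutoff (cube p) f y)"
      using vol_pos[of p] by (simp add: m_def norm_divide)
    also have "\<dots> \<le> mass f (cube p)" unfolding mass_def by (rule integral_norm_bound)
    finally show ?thesis .
  qed
  have m_le: "cmod (m p) \<le> 2 ^ CARD('n) * l" if "p \<in> F" for p
  proof -
    have "cmod (m p) * vol p \<le> 2 ^ CARD('n) * l * vol p" using m[of p] parent[OF FM[OF that]] by linarith
    then show ?thesis using vol_pos[of p] by (rule mult_right_le_imp_le)
  qed
  have cL2: "cutoff (cube p) (\<lambda>_. c) \<in> L2" for p c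
    by (rule L2_bounded_on[of _ "cube p" "cmod c"]) (auto simp: emeasure_triple_finite[unfolded infinity_ennreal_def] cutoff_def[of "cube p" "\<lambda>_. c"]
      intro: cutoff_measurable[unfolded cutoff_def])
  define b where "b p x = cutoff (cube p) f x - cutoff (cube p) (\<lambda>_. m p) x" for p x
  have bL2: "b p \<in> L2" for p unfolding b_def by (intro L2_diff L2_cutoff f cL2) auto
  have bout: "b p y = 0" if "y \<notin> cube p" for p y using that by (simp add: b_def cutoff_def)
  have cint: "integrable lebesgue (cutoff (cube p) (\<lambda>_. c))" for p c
    by (rule L2_integrable_on(1)[OF cL2 cube_lebesgue[of p] emeasure_triple_finite(2)]) (simp add: cutoff_def)
  have measure_cube: "measure lebesgue (cube p) = vol p" for p :: "int \<times> (int ^ 'n)"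
    using vol_pos[of p] by (simp add: measure_def emeasure_cube)
  have cutind: "cutoff (cube p) (\<lambda>_. c) = (\<lambda>x. indicator (cube p) x *\<^sub>R c)" for p :: "int \<times> (int ^ 'n)" and c
    by (auto simp: cutoff_def)
  have cval: "(LINT x|lebesgue. cutoff (cube p) (\<lambda>_. c) x) = complex_of_real (vol p) * c"
    for p :: "int \<times> (int ^ 'n)" and c
  proof -
    have "integrable lebesgue (indicator (cube p) :: real ^ 'n \<Rightarrow> real)"
      using emeasure_triple_finite(2)[of p] by simp
    then show ?thesis unfolding cutind
      by (subst integral_scaleR_left) (auto simp: measure_cube scaleR_conv_of_real)
  qed
  have bmean: "(LINT y|lebesgue. b p y) = 0" for p
    unfolding b_def Bochner_Integration.integral_diff[OF ci[OF cube_lebesgue] cint] cval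
    by (simp add: m_def)
  have bint: "integrable lebesgue (b p)" for p
    unfolding b_def by (intro Bochner_Integration.integrable_diff ci cint) auto
  have babs: "(LINT y|lebesgue. cmod (b p y)) \<le> 2 * mass f (cube p)" for p
  proof -
    have "(LINT y|lebesgue. cmod (b p y)) \<le> (LINT y|lebesgue. cmod (cutoff (cube p) f y) + cmod (m p) * indicator (cube p) y)"
    proof (rule integral_mono)
      show "integrable lebesgue (\<lambda>y. cmod (cutoff (cube p) f y) + cmod (m p) * indicator (cube p) y)"
        using ci[OF cube_lebesgue, of p] emeasure_triple_finite(2)[of p] by auto
      fix y show "cmod (b p y) \<le> cmod (cutoff (cube p) f y) + cmod (m p) * indicator (cube p) y"
        using norm_triangle_ineq4[of "f y" "m p"] by (simp add: b_def cutoff_def)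
    qed (use bint in auto)
    also have "\<dots> = mass f (cube p) + cmod (m p) * vol p"
      unfolding mass_def using ci[OF cube_lebesgue, of p] emeasure_triple_finite(2)[of p]
      by (subst Bochner_Integration.integral_add) (auto simp: measure_cube)
    finally show ?thesis using m[of p] by linarith
  qed
  define g where "g x = f x - (\<Sum>p\<in>F. b p x)" for x
  have bsum: "(\<Sum>p\<in>F. b p x) = (\<Sum>p\<in>F. if x \<in> cube p then f x - m p else 0)" for x
    by (rule sum.cong) (auto simp: b_def cutoff_def)
  have g_in: "g x = m q" if "q \<in> F" "x \<in> cube q" for x q
    unfolding g_def bsum using sum_disj[OF that, of "\<lambda>p. f x - m p"] by simp
  have g_out: "g x = f x" if "x \<notin> UF" for x
    unfolding g_def bsum using sum_disj0[OF that, of "\<lambda>p. f x - m p"] by simp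
  have gL2: "g \<in> L2" unfolding g_def by (intro L2_diff f L2_sum fin bL2)
  have gint: "integrable lebesgue g" unfolding g_def using fi bint by auto
  have gabs: "(LINT x|lebesgue. cmod (g x)) \<le> I"
  proof -
    have "(LINT x|lebesgue. cmod (g x)) \<le> (LINT x|lebesgue. cmod (cutoff (- UF) f x) + (\<Sum>p\<in>F. cmod (m p) * indicator (cube p) x))"
    proof (rule integral_mono)
      show "integrable lebesgue (\<lambda>x. cmod (cutoff (- UF) f x) + (\<Sum>p\<in>F. cmod (m p) * indicator (cube p) x))"
        using emeasure_triple_finite(2)
        by (intro Bochner_Integration.integrable_add Bochner_Integration.integrable_sum cin nUF) auto
      fix x
      show "cmod (g x) \<le> cmod (cutoff (- UF) f x) + (\<Sum>p\<in>F. cmod (m p) * indicator (cube p) x)"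
      proof (cases "x \<in> UF")
        case True
        then obtain q where q: "q \<in> F" "x \<in> cube q" by (auto simp: UF_def)
        have "cmod (m q) * indicator (cube q) x \<le> (\<Sum>p\<in>F. cmod (m p) * indicator (cube p) x)"
          by (rule member_le_sum[OF q(1)]) (use fin in auto)
        then show ?thesis using q True by (simp add: g_in cutoff_def)
      next
        case False
        then show ?thesis by (simp add: g_out cutoff_def sum_nonneg)
      qed
    qed (use gint in auto)
    also have "\<dots> = mass f (- UF) + (\<Sum>p\<in>F. cmod (m p) * vol p)"
      unfolding mass_def using cin[OF nUF] emeasure_triple_finite(2)
      by (subst Bochner_Integration.integral_add) (auto simp: measure_cube Bochner_Integration.integral_sum)
    also have "\<dots> \<le> mass f (- UF) + (\<Sum>p\<in>F. mass f (cube p))"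
      using m by (intro add_left_mono sum_mono) auto
    also have "\<dots> = I" by (rule masses)
    finally show ?thesis .
  qed
  have genergy: "energy g \<le> (2 ^ CARD('n) + 1) * l * I"
  proof -
    let ?c = "2 ^ CARD('n) * l"
    have cl: "l \<le> ?c" using l by simp
    have o1: "integrable lebesgue (\<lambda>x. (cmod (cutoff (\<Omega> n) f x))\<^sup>2)" by (intro L2_square_integrable L2_cutoff f) auto
    have "energy g \<le> (LINT x|lebesgue. (cmod (cutoff (\<Omega> n) f x))\<^sup>2 + ?c * cmod (g x))"
      unfolding energy_def
    proof (rule integral_mono_AE)
      show "AE x in lebesgue. (cmod (g x))\<^sup>2 \<le> (cmod (cutoff (\<Omega> n) f x))\<^sup>2 + ?c * cmod (g x)"
        using off
      proof eventually_elim
        case (elim x)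
        consider q where "q \<in> F" "x \<in> cube q" | q where "x \<notin> UF" "q \<in> M" "x \<in> cube q" | "x \<notin> UF" "\<forall>p\<in>M. x \<notin> cube p"
          unfolding UF_def by blast
        then show ?case
        proof cases
          case 1
          have "cmod (m q) * cmod (m q) \<le> ?c * cmod (m q)" using m_le[OF 1(1)] by (rule mult_right_mono) simp
          then show ?thesis using g_in[OF 1] by (simp add: power2_eq_square add_increasing)
        next
          case 2
          then have "q \<notin> F" unfolding UF_def by blast
          then have "n \<le> to_nat q" using 2(2) by (simp add: F_def)
          then have "x \<in> \<Omega> n" using 2(2,3) unfolding \<Omega>_def by blast
          then show ?thesis using g_out[OF 2(1)] l by (simp add: cutoff_def)
        next
          case 3
          then have "cmod (f x) \<le> ?c" using elim cl by (meson order_trans)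
          then have "cmod (f x) * cmod (f x) \<le> ?c * cmod (f x)" by (rule mult_right_mono) simp
          then show ?thesis using g_out[OF 3(1)] by (simp add: power2_eq_square add_increasing)
        qed
      qed
    qed (use gL2 o1 gint L2_square_integrable in auto)
    also have "\<dots> = energy (cutoff (\<Omega> n) f) + ?c * (LINT x|lebesgue. cmod (g x))"
      unfolding energy_def using o1 gint by (subst Bochner_Integration.integral_add) auto
    also have "\<dots> \<le> l * I + ?c * I"
      using n gabs l by (intro add_mono mult_left_mono) auto
    finally show ?thesis by (simp add: algebra_simps)
  qed
  have split: "AE x in lebesgue. T f x = T g x + (\<Sum>p\<in>F. T (b p) x)"
  proof -
    have e: "(\<lambda>x. g x + (\<Sum>p\<in>F. b p x)) = f" by (simp add: g_def)
    have "AE x in lebesgue. T (\<lambda>x. g x + (\<Sum>p\<in>F. b p x)) x = T g x + T (\<lambda>x. \<Sum>p\<in>F. b p x) x"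
      by (intro T_add gL2 L2_sum fin bL2)
    moreover have "AE x in lebesgue. T (\<lambda>x. \<Sum>p\<in>F. b p x) x = (\<Sum>p\<in>F. T (b p) x)"
      by (intro T_sum fin bL2)
    ultimately show ?thesis unfolding e by eventually_elim simp
  qed
  \<comment> \<open>Up to a null set, \<open>T f\<close> exceeds \<open>l\<close> only near the bad cubes, where the good part exceeds \<open>l / 2\<close>, or away from the bad cubes
    where the bad part exceeds \<open>l / 2\<close>.\<close>
  define S1 where "S1 = (\<Union>p\<in>F. triple p)"
  define S2 where "S2 = {x. l / 2 < cmod (T g x)}"
  define S3 where "S3 = {x. l / 2 < cmod (\<Sum>p\<in>F. T (b p) x)} - S1"
  have bm [measurable]: "T (b p) \<in> borel_measurable lebesgue" for p by (rule T_measurable[OF bL2])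
  have [measurable]: "S1 \<in> sets lebesgue" unfolding S1_def using fin by auto
  have S2s [measurable]: "S2 \<in> sets lebesgue" unfolding S2_def by (intro superlevel_lebesgue T_measurable gL2)
  have [measurable]: "S3 \<in> sets lebesgue" unfolding S3_def by (intro sets.Diff superlevel_lebesgue) auto
  have le1: "ennreal l * emeasure lebesgue S1 \<le> ennreal (3 ^ CARD('n) * I)"
  proof -
    have "emeasure lebesgue S1 \<le> (\<Sum>p\<in>F. emeasure lebesgue (triple p))"
      unfolding S1_def by (rule emeasure_subadditive_finite) (use fin in auto)
    also have "\<dots> = ennreal (\<Sum>p\<in>F. 3 ^ CARD('n) * vol p)"
      unfolding emeasure_triple by (rule sum_ennreal) (simp add: less_imp_le)
    finally have "ennreal l * emeasure lebesgue S1 \<le> ennreal l * ennreal (\<Sum>p\<in>F. 3 ^ CARD('n) * vol p)"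
      by (rule mult_left_mono) simp
    also have "\<dots> = ennreal (3 ^ CARD('n) * (\<Sum>p\<in>F. l * vol p))"
      using l by (simp add: ennreal_mult'[symmetric] sum_distrib_left mult_ac)
    also have "\<dots> \<le> ennreal (3 ^ CARD('n) * I)"
    proof (intro ennreal_leI mult_left_mono)
      have "(\<Sum>p\<in>F. l * vol p) \<le> (\<Sum>p\<in>F. mass f (cube p))"
        by (rule sum_mono) (use MB FM in \<open>force simp: Bs_def\<close>)
      then show "(\<Sum>p\<in>F. l * vol p) \<le> I" using massF by linarith
    qed simp
    finally show ?thesis .
  qed
  have le2: "ennreal l * emeasure lebesgue S2 \<le> ennreal (4 * B\<^sup>2 * (2 ^ CARD('n) + 1) * I)"
  proof -
    have [measurable]: "T g \<in> borel_measurable lebesgue" by (rule T_measurable[OF gL2])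
    have "ennreal ((l/2)\<^sup>2) * emeasure lebesgue S2 \<le> (\<integral>\<^sup>+x. ennreal ((cmod (T g x))\<^sup>2) \<partial>lebesgue)"
      by (rule markov_lebesgue[OF _ S2s]) (use l in \<open>auto simp: S2_def intro!: ennreal_leI power_mono\<close>)
    also have "\<dots> = ennreal (energy (T g))" by (rule nn_energy[OF T_L2[OF gL2]])
    also have "\<dots> \<le> ennreal (B\<^sup>2 * ((2 ^ CARD('n) + 1) * l * I))"
      using T_energy[OF gL2] mult_left_mono[OF genergy zero_le_power2[of B]] by (intro ennreal_leI) linarith
    finally have "ennreal (4 / l) * (ennreal ((l/2)\<^sup>2) * emeasure lebesgue S2) \<le> ennreal (4 / l) * ennreal (B\<^sup>2 * ((2 ^ CARD('n) + 1) * l * I))"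
      by (rule mult_left_mono) simp
    moreover have "ennreal (4 / l) * (ennreal ((l/2)\<^sup>2) * emeasure lebesgue S2) = ennreal l * emeasure lebesgue S2"
      using l by (simp add: mult.assoc[symmetric] ennreal_mult'[symmetric] power2_eq_square)
    moreover have "ennreal (4 / l) * ennreal (B\<^sup>2 * ((2 ^ CARD('n) + 1) * l * I)) = ennreal (4 * B\<^sup>2 * (2 ^ CARD('n) + 1) * I)"
      using l by (simp add: ennreal_mult'[symmetric] mult.assoc)
    ultimately show ?thesis by simp
  qed
  have le3: "ennreal l * emeasure lebesgue S3 \<le> ennreal (4 * tail_const * I)"
  proof -
    have "ennreal (l/2) * emeasure lebesgue S3 \<le> (\<integral>\<^sup>+x. (\<Sum>p\<in>F. ennreal (cmod (T (b p) x)) * indicator (- triple p) x) \<partial>lebesgue)"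
    proof (rule markov_lebesgue)
      fix x assume x: "x \<in> S3"
      have "ennreal (l/2) \<le> ennreal (\<Sum>p\<in>F. cmod (T (b p) x))"
        using x norm_sum[of "\<lambda>p. T (b p) x" F] by (intro ennreal_leI) (auto simp: S3_def)
      also have "\<dots> = (\<Sum>p\<in>F. ennreal (cmod (T (b p) x)))" by (rule sum_ennreal[symmetric]) simp
      also have "\<dots> = (\<Sum>p\<in>F. ennreal (cmod (T (b p) x)) * indicator (- triple p) x)"
        by (rule sum.cong) (use x in \<open>auto simp: S3_def S1_def\<close>)
      finally show "ennreal (l/2) \<le> (\<Sum>p\<in>F. ennreal (cmod (T (b p) x)) * indicator (- triple p) x)" .
    qed auto
    also have "\<dots> = (\<Sum>p\<in>F. \<integral>\<^sup>+x\<in>- triple p. ennreal (cmod (T (b p) x)) \<partial>lebesgue)"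
      by (rule nn_integral_sum) auto
    also have "\<dots> \<le> (\<Sum>p\<in>F. ennreal (tail_const * (2 * mass f (cube p))))"
    proof (rule sum_mono)
      fix p assume "p \<in> F"
      have "(\<integral>\<^sup>+x\<in>- triple p. ennreal (cmod (T (b p) x)) \<partial>lebesgue) \<le> ennreal (tail_const * (LINT y|lebesgue. cmod (b p y)))"
        by (rule mean_zero_tail[OF bL2 bout bmean])
      also have "\<dots> \<le> ennreal (tail_const * (2 * mass f (cube p)))"
        using babs tail_const_pos by (intro ennreal_leI mult_left_mono) auto
      finally show "(\<integral>\<^sup>+x\<in>- triple p. ennreal (cmod (T (b p) x)) \<partial>lebesgue) \<le> ennreal (tail_const * (2 * mass f (cube p)))" .
    qed
    also have "\<dots> = ennreal (tail_const * 2 * (\<Sum>p\<in>F. mass f (cube p)))"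
      using tail_const_pos by (subst sum_ennreal) (auto simp: sum_distrib_left mult.assoc)
    also have "\<dots> \<le> ennreal (tail_const * 2 * I)"
      using massF tail_const_pos by (intro ennreal_leI mult_left_mono) auto
    finally have "2 * (ennreal (l/2) * emeasure lebesgue S3) \<le> 2 * ennreal (tail_const * 2 * I)"
      by (rule mult_left_mono) simp
    moreover have "2 * (ennreal (l/2) * emeasure lebesgue S3) = ennreal l * emeasure lebesgue S3"
    proof -
      have "2 * ennreal (l/2) = ennreal l"
        using l ennreal_mult'[of 2 "l/2"] by simp
      then show ?thesis by (simp add: mult.assoc[symmetric])
    qed
    moreover have "2 * ennreal (tail_const * 2 * I) = ennreal (4 * tail_const * I)"
      using ennreal_mult'[of 2 "tail_const * 2 * I"] by (simp add: mult_ac)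
    ultimately show ?thesis by simp
  qed
  have "emeasure lebesgue {x. l < cmod (T f x)} \<le> emeasure lebesgue (S1 \<union> S2 \<union> S3)"
  proof (rule emeasure_mono_AE)
    show "AE x in lebesgue. x \<in> {x. l < cmod (T f x)} \<longrightarrow> x \<in> S1 \<union> S2 \<union> S3"
      using split
    proof eventually_elim
      case (elim x)
      then show ?case using norm_triangle_ineq[of "T g x" "\<Sum>p\<in>F. T (b p) x"]
        by (auto simp: S2_def S3_def)
    qed
  qed auto
  also have "\<dots> \<le> emeasure lebesgue S1 + emeasure lebesgue S2 + emeasure lebesgue S3"
    by (rule order_trans[OF emeasure_subadditive add_right_mono[OF emeasure_subadditive]]) auto
  finally have "ennreal l * emeasure lebesgue {x. l < cmod (T f x)}
      \<le> ennreal l * (emeasure lebesgue S1 + emeasure lebesgue S2 + emeasure lebesgue S3)"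
    by (rule mult_left_mono) simp
  also have "\<dots> = ennreal l * emeasure lebesgue S1 + ennreal l * emeasure lebesgue S2 + ennreal l * emeasure lebesgue S3"
    by (simp add: distrib_left)
  also have "\<dots> \<le> ennreal (3 ^ CARD('n) * I) + ennreal (4 * B\<^sup>2 * (2 ^ CARD('n) + 1) * I) + ennreal (4 * tail_const * I)"
    by (intro add_mono le1 le2 le3)
  also have "\<dots> = ennreal (weak_const * I)"
    using I tail_const_pos by (simp add: ennreal_plus[symmetric] weak_const_def algebra_simps del: ennreal_plus)
  finally show ?thesis by (simp add: I_def)
qed

section \<open>Stopping cubes\<close>

definition triple_average :: "(real ^ 'n \<Rightarrow> complex) \<Rightarrow> int \<times> (int ^ 'n) \<Rightarrow> real" where
  "triple_average f p = mass f (triple p) / (3 ^ CARD('n) * vol p)"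

lemma triple_average_nonneg [simp]: "0 \<le> triple_average f p" by (simp add: triple_average_def)

lemma mass_triple_eq: "mass f (triple (p :: int \<times> (int ^ 'n))) = triple_average f p * (3 ^ CARD('n) * vol p)"
  by (simp add: triple_average_def)

definition descendants :: "int \<times> (int ^ 'n) \<Rightarrow> (int \<times> (int ^ 'n)) set" where
  "descendants p = {q. \<exists>j. anc j q = p}"

lemma descendants_subset: "q \<in> descendants p \<Longrightarrow> cube q \<subseteq> cube p"
  "q \<in> descendants p \<Longrightarrow> triple q \<subseteq> triple p" "q \<in> descendants p \<Longrightarrow> fst p \<le> fst q"
  using cube_subset_anc[of q] triple_subset_anc[of q] by (auto simp: descendants_def)

lemma ennreal_divide_bound:
  assumes "0 < l" "ennreal l * m \<le> ennreal X"
  shows "m \<le> ennreal (X / l)"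
proof -
  have "m = ennreal (1 / l) * (ennreal l * m)"
    using assms(1) by (simp add: mult.assoc[symmetric] ennreal_mult'[symmetric])
  also have "\<dots> \<le> ennreal (1 / l) * ennreal X" using assms(2) by (rule mult_left_mono) simp
  also have "\<dots> = ennreal (X / l)" using assms(1) by (simp add: ennreal_mult'[symmetric])
  finally show ?thesis .
qed

lemma L2_local: "f \<in> L2 \<Longrightarrow> cutoff (triple p) f \<in> L2" "f \<in> L2 \<Longrightarrow> integrable lebesgue (cutoff (triple p) f)"
  by (auto intro!: L2_cutoff L2_integrable_cutoff emeasure_triple_finite)

lemma exists_AE_in_set:
  assumes "S \<in> sets M" "0 < emeasure M S" "AE x in M. P x"
  shows "\<exists>x\<in>S. P x"
proof (rule ccontr)
  assume "\<not> (\<exists>x\<in>S. P x)"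
  with assms(3) have "AE x in M. x \<notin> S" by (auto elim: eventually_mono)
  then have "S \<in> null_sets M" using assms(1) by (simp add: AE_iff_null_sets)
  then show False using assms(2) by auto
qed

context cz
begin

text \<open>The second summand makes the children with a large average, the third those with a large value of the operator, occupy at most a
quarter of the cube each.\<close>

definition stop_const :: real where
  "stop_const = 1 + 4 * 9 ^ CARD('n) + 16 * 6 ^ CARD('n) * weak_const"

text \<open>The bound for one step of the iteration, as it comes out of \<open>child_step\<close>.\<close>

definition step_const :: real where
  "step_const = stop_const * (1 + 4 * 6 ^ CARD('n) * weak_const + tail_const)"

lemma stop_const: "1 \<le> stop_const" "4 * 9 ^ CARD('n) \<le> stop_const" "16 * 6 ^ CARD('n) * weak_const \<le> stop_const"
proof -
  have "0 \<le> 16 * 6 ^ CARD('n) * weak_const" using weak_const_pos by simp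
  moreover have "(0::real) \<le> 4 * 9 ^ CARD('n)" by simp
  ultimately show "1 \<le> stop_const" "4 * 9 ^ CARD('n) \<le> stop_const" "16 * 6 ^ CARD('n) * weak_const \<le> stop_const"
    unfolding stop_const_def by linarith+
qed

lemma stop_const_le_step_const: "stop_const \<le> step_const"
proof -
  have "stop_const * 1 \<le> stop_const * (1 + 4 * 6 ^ CARD('n) * weak_const + tail_const)"
    using stop_const(1) weak_const_pos tail_const_pos by (intro mult_left_mono) auto
  then show ?thesis by (simp add: step_const_def)
qed

text \<open>The case of vanishing average is separate: there the function vanishes on the triple.\<close>

lemma weak_type_local:
  assumes f: "f \<in> L2" and c: "0 < c"
  shows "emeasure lebesgue {x. c * triple_average f p < cmod (T (cutoff (triple p) f) x)} \<le> ennreal (weak_const * 3 ^ CARD('n) / c * vol p)"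
proof (cases "triple_average f p = 0")
  case True
  then have "(LINT x|lebesgue. cmod (cutoff (triple p) f x)) = 0" by (simp add: triple_average_def mass_def)
  then have "AE x in lebesgue. cmod (cutoff (triple p) f x) = 0"
    using integral_nonneg_eq_0_iff_AE[OF integrable_norm[OF L2_local(2)[OF f, of p]]] by auto
  then have "AE x in lebesgue. T (cutoff (triple p) f) x = 0" by (intro T_null L2_local f) auto
  then have "AE x in lebesgue. x \<notin> {x. c * triple_average f p < cmod (T (cutoff (triple p) f) x)}"
    by eventually_elim (simp add: True)
  then have "{x. c * triple_average f p < cmod (T (cutoff (triple p) f) x)} \<in> null_sets lebesgue"
    using superlevel_lebesgue[OF T_measurable[OF L2_local(1)[OF f]]] by (simp add: AE_iff_null_sets)
  then show ?thesis by auto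
next
  case False
  then have a: "0 < triple_average f p" using triple_average_nonneg[of f p] by linarith
  have "ennreal (c * triple_average f p) * emeasure lebesgue {x. c * triple_average f p < cmod (T (cutoff (triple p) f) x)}
      \<le> ennreal (weak_const * mass f (triple p))"
    unfolding mass_def by (rule weak_type_1_1) (use L2_local[OF f] a c in auto)
  then have "emeasure lebesgue {x. c * triple_average f p < cmod (T (cutoff (triple p) f) x)}
      \<le> ennreal (weak_const * mass f (triple p) / (c * triple_average f p))"
    using a c by (intro ennreal_divide_bound) auto
  also have "weak_const * mass f (triple p) / (c * triple_average f p) = weak_const * 3 ^ CARD('n) / c * vol p"
    using a c by (simp add: mass_triple_eq)
  finally show ?thesis .
qed

definition high :: "(real ^ 'n \<Rightarrow> complex) \<Rightarrow> int \<times> (int ^ 'n) \<Rightarrow> (real ^ 'n) set" where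
  "high f p = cube p \<inter> {x. stop_const * triple_average f p < cmod (T (cutoff (triple p) f) x)}"

text \<open>The proportion \<open>1 / 2 ^ (d + 2)\<close> is such that the high set fills at most a quarter of every child: the
parent of a child is not bad, and it has \<open>2 ^ d\<close> times the volume.\<close>

definition bad :: "(real ^ 'n \<Rightarrow> complex) \<Rightarrow> int \<times> (int ^ 'n) \<Rightarrow> (int \<times> (int ^ 'n)) set" where
  "bad f p = {q \<in> descendants p. stop_const * triple_average f p < triple_average f q \<or>
     ennreal (1 / 2 ^ (CARD('n) + 2) * vol q) < emeasure lebesgue (cube q \<inter> high f p)}"

definition children :: "(real ^ 'n \<Rightarrow> complex) \<Rightarrow> int \<times> (int ^ 'n) \<Rightarrow> (int \<times> (int ^ 'n)) set" where
  "children f p = maximal (bad f p)"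

lemma high_lebesgue [measurable]: "f \<in> L2 \<Longrightarrow> high f p \<in> sets lebesgue"
  unfolding high_def by (intro sets.Int cube_lebesgue superlevel_lebesgue T_measurable L2_local)

lemma emeasure_high_le:
  assumes f: "f \<in> L2"
  shows "emeasure lebesgue (high f p) \<le> ennreal (1 / 2 ^ (CARD('n) + 2) / 4 * vol p)"
proof -
  have "emeasure lebesgue (high f p) \<le> emeasure lebesgue {x. stop_const * triple_average f p < cmod (T (cutoff (triple p) f) x)}"
    unfolding high_def by (intro emeasure_mono superlevel_lebesgue T_measurable L2_local f) auto
  also have "\<dots> \<le> ennreal (weak_const * 3 ^ CARD('n) / stop_const * vol p)"
    using stop_const(1) by (intro weak_type_local f) auto
  also have "\<dots> \<le> ennreal (1 / 2 ^ (CARD('n) + 2) / 4 * vol p)"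
  proof (intro ennreal_leI mult_right_mono)
    have "16 * (2 ^ CARD('n) * 3 ^ CARD('n)) * weak_const \<le> stop_const"
      using stop_const(3) by (simp add: power_mult_distrib[symmetric])
    then show "weak_const * 3 ^ CARD('n) / stop_const \<le> 1 / 2 ^ (CARD('n) + 2) / 4"
      using stop_const(1) by (simp add: field_simps power_add)
  qed simp
  finally show ?thesis .
qed

lemma not_self_bad:
  assumes f: "f \<in> L2"
  shows "p \<notin> bad f p"
proof
  assume "p \<in> bad f p"
  moreover have "triple_average f p \<le> stop_const * triple_average f p"
    using stop_const(1) mult_right_mono[of 1 stop_const "triple_average f p"] by simp
  ultimately have "ennreal (1 / 2 ^ (CARD('n) + 2) * vol p) < emeasure lebesgue (cube p \<inter> high f p)"
    by (auto simp: bad_def)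
  also have "cube p \<inter> high f p = high f p" by (auto simp: high_def)
  also have "emeasure lebesgue (high f p) \<le> ennreal (1 / 2 ^ (CARD('n) + 2) / 4 * vol p)"
    by (rule emeasure_high_le[OF f])
  also have "\<dots> \<le> ennreal (1 / 2 ^ (CARD('n) + 2) * vol p)"
    by (intro ennreal_leI mult_right_mono) (auto simp: field_simps)
  finally show False by simp
qed

lemma children_bad: "q \<in> children f p \<Longrightarrow> q \<in> bad f p"
  by (simp add: children_def maximal_def)

lemma children_descendants: "q \<in> children f p \<Longrightarrow> q \<in> descendants p"
  using children_bad unfolding bad_def by blast

lemma children_disjoint: "q \<in> children f p \<Longrightarrow> q' \<in> children f p \<Longrightarrow> q \<noteq> q' \<Longrightarrow> cube q \<inter> cube q' = {}"
  unfolding children_def by (rule maximal_disjoint)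

text \<open>A child is a proper descendant because the cube itself is not bad, and by maximality none of the cubes in between is bad.\<close>

lemma child_anc:
  assumes f: "f \<in> L2" and q: "q \<in> children f p"
  obtains J where "0 < J" "anc J q = p"
    "\<And>j. 0 < j \<Longrightarrow> j \<le> J \<Longrightarrow> triple_average f (anc j q) \<le> stop_const * triple_average f p"
    "\<And>j. 0 < j \<Longrightarrow> j \<le> J \<Longrightarrow> emeasure lebesgue (cube (anc j q) \<inter> high f p) \<le> ennreal (1 / 2 ^ (CARD('n) + 2) * vol (anc j q))"
proof -
  obtain J where J: "anc J q = p" using children_descendants[OF q] by (auto simp: descendants_def)
  have "J \<noteq> 0"
  proof
    assume "J = 0"
    then show False using J not_self_bad[OF f] children_bad[OF q] by auto
  qed
  moreover have "anc j q \<in> descendants p - bad f p" if "0 < j" "j \<le> J" for j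
  proof -
    have "anc (J - j) (anc j q) = p" using J that by (simp add: anc_anc)
    moreover have "anc j q \<notin> bad f p" using q that unfolding children_def maximal_def by blast
    ultimately show ?thesis unfolding descendants_def by blast
  qed
  ultimately show ?thesis
    using that[of J] J unfolding bad_def by (force simp: not_less)
qed

lemma child_level_less:
  assumes "f \<in> L2" "q \<in> children f p" shows "fst p < fst q"
  using child_anc[OF assms] by (metis fst_anc diff_add_cancel of_nat_0_less_iff less_add_same_cancel1)

lemma bad_covered_by_child:
  assumes "q \<in> bad f p" "x \<in> cube q"
  shows "x \<in> (\<Union>r\<in>children f p. cube r)"
proof -
  have "\<And>r. r \<in> bad f p \<Longrightarrow> fst p \<le> fst r" unfolding bad_def using descendants_subset(3) by blast
  then obtain j where "anc j q \<in> children f p"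
    unfolding children_def using exists_maximal[OF assms(1)] by blast
  then show ?thesis using assms(2) cube_subset_anc by blast
qed

lemma countable_cube_indices [simp]: "countable (S :: (int \<times> (int ^ 'n)) set)" by (rule countableI_type)

text \<open>The weak type bound for the maximal function over triples. Triples are laminar within each of the at most \<open>3 ^ d\<close> classes,
and in each class \<open>laminar_weak_type\<close> applies to \<open>f\<close> restricted to the triple of \<open>p\<close>.\<close>

lemma large_average_measure:
  fixes f :: "real ^ 'n \<Rightarrow> complex"
  assumes f: "f \<in> L2"
  shows "emeasure lebesgue (\<Union>q\<in>{q\<in>descendants p. stop_const * triple_average f p < triple_average f q}. cube q) \<le> ennreal (vol p / 4)"
proof (cases "triple_average f p = 0")
  case True
  have "{q\<in>descendants p. stop_const * triple_average f p < triple_average f q} = {}"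
  proof -
    have "triple_average f q = 0" if "q \<in> descendants p" for q
    proof -
      have "mass f (triple q) \<le> mass f (triple p)"
        by (intro mass_mono L2_local f descendants_subset(2) that) auto
      then have "mass f (triple q) = 0" using True mass_nonneg[of f "triple q"] by (simp add: mass_triple_eq[of f p])
      then show ?thesis by (simp add: triple_average_def)
    qed
    then show ?thesis using True by auto
  qed
  then show ?thesis by (simp only: UN_empty emeasure_empty zero_le)
next
  case False
  then have a: "0 < triple_average f p" using triple_average_nonneg[of f p] by linarith
  let ?D = "{q\<in>descendants p. stop_const * triple_average f p < triple_average f q}"
  define G where "G c = (\<Union>q\<in>{q\<in>?D. triple_class q = c}. triple q)" for c
  have G [measurable]: "G c \<in> sets lebesgue" for c unfolding G_def by (intro sets.countable_UN') auto
  let ?R = "range (triple_class :: int \<times> (int ^ 'n) \<Rightarrow> _)"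
  have each: "emeasure lebesgue (G c) \<le> ennreal (3 ^ CARD('n) * vol p / stop_const)" for c
  proof -
    have [measurable]: "cutoff (triple p) f \<in> borel_measurable lebesgue" using L2_local(1)[OF f] by auto
    have "ennreal (stop_const * triple_average f p) * emeasure lebesgue (G c)
        \<le> (\<integral>\<^sup>+x\<in>G c. ennreal (cmod (cutoff (triple p) f x)) \<partial>lebesgue)"
      unfolding G_def
    proof (rule laminar_weak_type)
      fix q assume q: "q \<in> {q\<in>?D. triple_class q = c}"
      have "ennreal (stop_const * triple_average f p) * emeasure lebesgue (triple q) = ennreal (stop_const * triple_average f p * (3 ^ CARD('n) * vol q))"
        using stop_const(1) by (simp add: emeasure_triple ennreal_mult'[symmetric])
      also have "\<dots> \<le> ennreal (mass f (triple q))"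
        unfolding mass_triple_eq by (intro ennreal_leI mult_right_mono) (use q in auto)
      also have "\<dots> = (\<integral>\<^sup>+x\<in>triple q. ennreal (cmod (f x)) \<partial>lebesgue)" by (rule nn_mass[OF L2_local(2)[OF f], symmetric])
      also have "\<dots> = (\<integral>\<^sup>+x\<in>triple q. ennreal (cmod (cutoff (triple p) f x)) \<partial>lebesgue)"
        using q descendants_subset(2)[of q p] by (intro nn_integral_cong) (auto simp: indicator_def cutoff_def)
      finally show "ennreal (stop_const * triple_average f p) * emeasure lebesgue (triple q)
          \<le> (\<integral>\<^sup>+x\<in>triple q. ennreal (cmod (cutoff (triple p) f x)) \<partial>lebesgue)" .
    next
      fix q r assume "q \<in> {q\<in>?D. triple_class q = c}" "r \<in> {q\<in>?D. triple_class q = c}"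
      then show "triple q \<inter> triple r = {} \<or> triple q \<subseteq> triple r \<or> triple r \<subseteq> triple q"
        by (intro triples_laminar) auto
    qed auto
    also have "\<dots> \<le> (\<integral>\<^sup>+x. ennreal (cmod (cutoff (triple p) f x)) \<partial>lebesgue)"
      by (intro nn_integral_mono) (auto simp: indicator_def)
    also have "\<dots> = ennreal (mass f (triple p))"
      unfolding mass_def by (rule nn_integral_eq_integral) (use L2_local(2)[OF f] in auto)
    finally have "emeasure lebesgue (G c) \<le> ennreal (mass f (triple p) / (stop_const * triple_average f p))"
      using a stop_const(1) by (intro ennreal_divide_bound) auto
    also have "mass f (triple p) / (stop_const * triple_average f p) = 3 ^ CARD('n) * vol p / stop_const"
      using a by (simp add: mass_triple_eq)
    finally show ?thesis .
  qed
  have "emeasure lebesgue (\<Union>q\<in>?D. cube q) \<le> emeasure lebesgue (\<Union>c\<in>?R. G c)"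
  proof (rule emeasure_mono)
    show "(\<Union>q\<in>?D. cube q) \<subseteq> (\<Union>c\<in>?R. G c)" unfolding G_def using cube_subset_triple by blast
    show "(\<Union>c\<in>?R. G c) \<in> sets lebesgue" using finite_range_triple_class(1) by (intro sets.finite_UN) auto
  qed
  also have "\<dots> \<le> (\<Sum>c\<in>?R. emeasure lebesgue (G c))"
    by (rule emeasure_subadditive_finite[OF finite_range_triple_class(1)]) auto
  also have "\<dots> \<le> (\<Sum>c\<in>?R. ennreal (3 ^ CARD('n) * vol p / stop_const))"
    by (intro sum_mono each)
  also have "\<dots> = of_nat (card ?R) * ennreal (3 ^ CARD('n) * vol p / stop_const)" by simp
  also have "\<dots> \<le> of_nat (3 ^ CARD('n)) * ennreal (3 ^ CARD('n) * vol p / stop_const)"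
    by (intro mult_right_mono of_nat_mono finite_range_triple_class(2)) auto
  also have "\<dots> = ennreal (3 ^ CARD('n) * (3 ^ CARD('n) * vol p / stop_const))"
    by (simp add: ennreal_of_nat_eq_real_of_nat ennreal_mult'[symmetric] del: of_nat_power) simp
  also have "\<dots> \<le> ennreal (vol p / 4)"
  proof (rule ennreal_leI)
    have "4 * ((3 ^ CARD('n) * 3 ^ CARD('n)) * vol p) \<le> stop_const * vol p"
      using mult_right_mono[OF stop_const(2) vol_nonneg[of p]] by (simp add: power_mult_distrib[symmetric] mult.assoc)
    then show "3 ^ CARD('n) * (3 ^ CARD('n) * vol p / stop_const) \<le> vol p / 4"
      using stop_const(1) by (simp add: field_simps)
  qed
  finally show ?thesis .
qed

lemma children_measure:
  assumes f: "f \<in> L2"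
  shows "emeasure lebesgue (\<Union>q\<in>children f p. cube q) \<le> ennreal (vol p / 2)"
proof -
  let ?D1 = "{q\<in>descendants p. stop_const * triple_average f p < triple_average f q}"
  let ?D2 = "{q\<in>children f p. ennreal (1 / 2 ^ (CARD('n) + 2) * vol q) < emeasure lebesgue (cube q \<inter> high f p)}"
  have disj: "disjoint_family_on cube ?D2" "disjoint_family_on (\<lambda>q. cube q \<inter> high f p) ?D2"
    using children_disjoint[of _ f p] unfolding disjoint_family_on_def by blast+
  have hm: "high f p \<in> sets lebesgue" by (rule high_lebesgue[OF f])
  let ?C = "2 ^ (CARD('n) + 2) :: real"
  have "emeasure lebesgue (\<Union>q\<in>?D2. cube q) = (\<integral>\<^sup>+q. emeasure lebesgue (cube q) \<partial>count_space ?D2)"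
    using disj by (intro emeasure_UN_countable) auto
  also have "\<dots> \<le> (\<integral>\<^sup>+q. ennreal ?C * emeasure lebesgue (cube q \<inter> high f p) \<partial>count_space ?D2)"
  proof (rule nn_integral_mono)
    fix q assume "q \<in> space (count_space ?D2)"
    then have "ennreal (1 / ?C * vol q) \<le> emeasure lebesgue (cube q \<inter> high f p)"
      unfolding space_count_space mem_Collect_eq by (elim conjE) (rule less_imp_le)
    then have "ennreal ?C * ennreal (1 / ?C * vol q) \<le> ennreal ?C * emeasure lebesgue (cube q \<inter> high f p)"
      by (rule mult_left_mono) simp
    then show "emeasure lebesgue (cube q) \<le> ennreal ?C * emeasure lebesgue (cube q \<inter> high f p)"
      by (simp add: emeasure_cube ennreal_mult'[symmetric])
  qed
  also have "\<dots> = ennreal ?C * (\<integral>\<^sup>+q. emeasure lebesgue (cube q \<inter> high f p) \<partial>count_space ?D2)"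
    by (rule nn_integral_cmult) auto
  also have "(\<integral>\<^sup>+q. emeasure lebesgue (cube q \<inter> high f p) \<partial>count_space ?D2) = emeasure lebesgue (\<Union>q\<in>?D2. cube q \<inter> high f p)"
    using disj hm by (intro emeasure_UN_countable[symmetric]) auto
  also have "\<dots> \<le> emeasure lebesgue (high f p)" using hm by (intro emeasure_mono) auto
  also have "\<dots> \<le> ennreal (1 / ?C / 4 * vol p)" by (rule emeasure_high_le[OF f])
  finally have D2: "emeasure lebesgue (\<Union>q\<in>?D2. cube q) \<le> ennreal ?C * ennreal (1 / ?C / 4 * vol p)"
    by (simp add: mult_left_mono)
  have sets: "(\<Union>q\<in>?D1. cube q) \<in> sets lebesgue" "(\<Union>q\<in>?D2. cube q) \<in> sets lebesgue"
    by (auto intro!: sets.countable_UN')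
  have "children f p \<subseteq> ?D1 \<union> ?D2"
    using children_bad[of _ f p] unfolding bad_def by blast
  then have "emeasure lebesgue (\<Union>q\<in>children f p. cube q) \<le> emeasure lebesgue ((\<Union>q\<in>?D1. cube q) \<union> (\<Union>q\<in>?D2. cube q))"
    using sets by (intro emeasure_mono) blast+
  also have "\<dots> \<le> emeasure lebesgue (\<Union>q\<in>?D1. cube q) + emeasure lebesgue (\<Union>q\<in>?D2. cube q)"
    using sets by (rule emeasure_subadditive)
  also have "\<dots> \<le> ennreal (vol p / 4) + ennreal ?C * ennreal (1 / ?C / 4 * vol p)"
    by (intro add_mono large_average_measure f D2)
  also have "\<dots> = ennreal (vol p / 2)"
    by (simp add: ennreal_mult'[symmetric] ennreal_plus[symmetric] del: ennreal_plus)
  finally show ?thesis .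
qed

text \<open>Almost every point of the high set lies in a cube in which the high set is dense, and such a cube is bad.\<close>

lemma outside_children_bound:
  assumes f: "f \<in> L2"
  shows "AE x in lebesgue. x \<in> cube p - (\<Union>q\<in>children f p. cube q) \<longrightarrow>
    cmod (T (cutoff (triple p) f) x) \<le> stop_const * triple_average f p"
proof -
  have "AE x in lebesgue. x \<in> high f p \<longrightarrow>
    (\<exists>q. x \<in> cube q \<and> ennreal (1 / 2 ^ (CARD('n) + 2) * vol q) < emeasure lebesgue (cube q \<inter> high f p))"
  proof (rule AE_high_density_cube[OF high_lebesgue[OF f]])
    have "(1::real) < 2 ^ (CARD('n) + 2)" by (rule one_less_power) auto
    then show "1 / 2 ^ (CARD('n) + 2) < (1::real)" by simp
  qed simp
  then show ?thesis
  proof eventually_elim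
    case (elim x)
    show ?case
    proof (intro impI, rule ccontr)
      assume x: "x \<in> cube p - (\<Union>q\<in>children f p. cube q)" and "\<not> cmod (T (cutoff (triple p) f) x) \<le> stop_const * triple_average f p"
      then have "x \<in> high f p" by (simp add: high_def)
      then obtain q where q: "x \<in> cube q" "ennreal (1 / 2 ^ (CARD('n) + 2) * vol q) < emeasure lebesgue (cube q \<inter> high f p)"
        using elim by blast
      have "q \<in> descendants p"
      proof (rule ccontr)
        assume nd: "q \<notin> descendants p"
        have "cube q \<inter> cube p \<noteq> {}" using q(1) x by blast
        then obtain j where j: "q = anc j p" using cubes_laminar[of q p] nd unfolding descendants_def by blast
        have "vol p \<le> vol q" unfolding j vol_anc
          using mult_right_mono[of 1 "(2 ^ j) ^ CARD('n)" "vol p"] by (simp add: one_le_power)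
        then have "ennreal (1 / 2 ^ (CARD('n) + 2) * vol p) \<le> ennreal (1 / 2 ^ (CARD('n) + 2) * vol q)"
          by (intro ennreal_leI mult_left_mono) auto
        also note q(2)
        also have "cube q \<inter> high f p = cube p \<inter> high f p" unfolding j high_def using cube_subset_anc by blast
        finally have "p \<in> bad f p" unfolding bad_def descendants_def by (auto intro: exI[of _ 0])
        then show False using not_self_bad[OF f] by blast
      qed
      then have "q \<in> bad f p" using q(2) unfolding bad_def by blast
      then show False using bad_covered_by_child q(1) x by blast
    qed
  qed
qed

end

section \<open>Sparse domination\<close>

context cz
begin

text \<open>All averages over the triples between \<open>q\<close> and its \<open>J\<close>-th ancestor are at most \<open>a\<close>, so each annulus contributes at most \<open>a\<close> times a
geometric factor.\<close>

lemma Kop_oscillation: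
  assumes f: "f \<in> L2" and a: "\<And>j. 0 < j \<Longrightarrow> j \<le> J \<Longrightarrow> triple_average f (anc j q) \<le> a" "0 \<le> a"
    and x: "x \<in> cube q" "x' \<in> cube q"
  defines "h \<equiv> cutoff (triple (anc J q) - triple q) f"
  shows "cmod (Kop h x - Kop h x') \<le> tail_const * a"
proof -
  have hm: "triple (anc J q) - triple q \<in> sets lebesgue" by auto
  have "emeasure lebesgue (triple (anc J q) - triple q) \<le> emeasure lebesgue (triple (anc J q))"
    by (intro emeasure_mono) auto
  then have "emeasure lebesgue (triple (anc J q) - triple q) < \<infinity>"
    using emeasure_triple_finite(1) by (rule le_less_trans)
  then have hi: "integrable lebesgue h" unfolding h_def by (intro L2_integrable_cutoff f hm)
  have s: "side q \<le> norm (z - y)" if "z \<in> cube q" "h y \<noteq> 0" for y z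
  proof -
    have "y \<notin> triple q" using that(2) by (auto simp: h_def cutoff_def split: if_splits)
    then show ?thesis using norm_outside_triple_ge that(1) by blast
  qed
  have i: "integrable lebesgue (\<lambda>y. K x y * h y)" "integrable lebesgue (\<lambda>y. K x' y * h y)"
    using Kop_integrable[OF hi side_pos s[OF x(1)]] Kop_integrable[OF hi side_pos s[OF x(2)]] by auto
  define c where "c j = osc_const * decay ^ j / vol (anc j q)" for j
  have c: "0 \<le> c j" for j unfolding c_def using osc_const_pos decay
    by (intro divide_nonneg_nonneg mult_nonneg_nonneg zero_le_power) (auto simp: less_imp_le)
  have im: "integrable lebesgue (\<lambda>y. cmod (cutoff (triple r) f y))" for r
    by (rule integrable_norm[OF L2_local(2)[OF f]])
  have "Kop h x - Kop h x' = (LINT y|lebesgue. K x y * h y - K x' y * h y)"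
    unfolding Kop_def using i by (rule Bochner_Integration.integral_diff[symmetric])
  also have "cmod \<dots> \<le> (LINT y|lebesgue. cmod (K x y * h y - K x' y * h y))" by (rule integral_norm_bound)
  also have "\<dots> \<le> (LINT y|lebesgue. (\<Sum>j<J. c j * cmod (cutoff (triple (anc (Suc j) q)) f y)))"
  proof (rule integral_mono)
    show "integrable lebesgue (\<lambda>y. cmod (K x y * h y - K x' y * h y))"
      by (intro integrable_norm Bochner_Integration.integrable_diff i)
    show "integrable lebesgue (\<lambda>y. \<Sum>j<J. c j * cmod (cutoff (triple (anc (Suc j) q)) f y))"
      by (intro Bochner_Integration.integrable_sum integrable_mult_right im)
    fix y
    have nn: "0 \<le> c j * cmod (cutoff (triple (anc (Suc j) q)) f y)" for j using c[of j] by simp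
    show "cmod (K x y * h y - K x' y * h y) \<le> (\<Sum>j<J. c j * cmod (cutoff (triple (anc (Suc j) q)) f y))"
    proof (cases "y \<in> triple (anc J q) - triple q")
      case True
      then obtain j where j: "j < J" "y \<in> triple (anc (Suc j) q)" "y \<notin> triple (anc j q)"
        using triple_annulus[of y J q] by blast
      have "cmod (K x y * h y - K x' y * h y) = cmod (K x y - K x' y) * cmod (h y)"
        by (simp add: left_diff_distrib[symmetric] norm_mult)
      also have "\<dots> \<le> c j * cmod (h y)"
        unfolding c_def by (intro mult_right_mono K_oscillation_cube(1) x j) auto
      also have "\<dots> = c j * cmod (cutoff (triple (anc (Suc j) q)) f y)"
        using True j(2) by (simp add: h_def cutoff_def)
      also have "\<dots> \<le> (\<Sum>j<J. c j * cmod (cutoff (triple (anc (Suc j) q)) f y))"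
        by (rule member_le_sum[of j "{..<J}"]) (use j(1) nn in auto)
      finally show ?thesis .
    next
      case False
      then have "h y = 0" unfolding h_def cutoff_def by (rule if_not_P)
      then show ?thesis using nn by (simp add: sum_nonneg)
    qed
  qed
  also have "\<dots> = (\<Sum>j<J. c j * mass f (triple (anc (Suc j) q)))"
    unfolding mass_def using im by (subst Bochner_Integration.integral_sum) auto
  also have "\<dots> \<le> (\<Sum>j<J. osc_const * 6 ^ CARD('n) * a * decay ^ j)"
  proof (rule sum_mono)
    fix j assume "j \<in> {..<J}"
    then have aj: "triple_average f (anc (Suc j) q) \<le> a" by (intro a) auto
    have v: "vol (anc (Suc j) q) = 2 ^ CARD('n) * vol (anc j q)" by (simp add: vol_anc power_mult_distrib)
    have "c j * mass f (triple (anc (Suc j) q)) = osc_const * decay ^ j * (3 * 2) ^ CARD('n) * triple_average f (anc (Suc j) q)"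
      unfolding mass_triple_eq v c_def power_mult_distrib by simp
    also have "\<dots> \<le> osc_const * decay ^ j * (3 * 2) ^ CARD('n) * a"
      using osc_const_pos decay by (intro mult_left_mono aj) auto
    finally show "c j * mass f (triple (anc (Suc j) q)) \<le> osc_const * 6 ^ CARD('n) * a * decay ^ j"
      by (simp add: mult_ac)
  qed
  also have "\<dots> = osc_const * 6 ^ CARD('n) * a * (\<Sum>j<J. decay ^ j)" by (simp add: sum_distrib_left)
  also have "\<dots> \<le> osc_const * 6 ^ CARD('n) * a * (1 / (1 - decay))"
  proof (rule mult_left_mono)
    have "(\<Sum>j<J. decay ^ j) \<le> (\<Sum>j. decay ^ j)"
      using decay by (intro sum_le_suminf summable_geometric) auto
    then show "(\<Sum>j<J. decay ^ j) \<le> 1 / (1 - decay)" using decay by (simp add: suminf_geometric)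
  qed (use osc_const_pos a(2) in auto)
  also have "\<dots> = tail_const * a" by (simp add: tail_const_def)
  finally show ?thesis .
qed

lemma kernel_representation_inside_cube:
  assumes h: "h \<in> L2" "\<And>y. h y \<noteq> 0 \<Longrightarrow> y \<in> triple p - triple q"
  shows "AE x in lebesgue. x \<in> cube q \<longrightarrow> T h x = Kop h x"
proof -
  let ?A = "closure (triple p - triple q)"
  have "compact ?A" using bounded_subset[OF bounded_triple[of p], of "triple p - triple q"] by (auto simp: compact_closure)
  moreover have "h y = 0" if "y \<notin> ?A" for y using h(2) that closure_subset by blast
  ultimately have "AE x in lebesgue. x \<notin> ?A \<longrightarrow> T h x = Kop h x" by (intro kernel_representation h(1))
  then show ?thesis
  proof eventually_elim
    case (elim x)
    show ?case
    proof
      assume x: "x \<in> cube q"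
      have "x \<notin> ?A"
      proof
        assume "x \<in> ?A"
        then obtain y where y: "y \<in> triple p - triple q" "dist y x < side q"
          using side_pos[of q] unfolding closure_approachable by blast
        then show False using norm_outside_triple_ge[OF x, of y] by (simp add: dist_norm norm_minus_commute)
      qed
      then show "T h x = Kop h x" using elim by blast
    qed
  qed
qed

text \<open>Let \<open>h = f 1_{3p - 3q}\<close>, so that \<open>T h\<close> is the difference of the two functions. At some point \<open>z\<close> of \<open>q\<close> both functions are
controlled, because the exceptional sets fill at most a quarter of \<open>q\<close> each; the oscillation bound carries the resulting
bound for \<open>T h\<close> from \<open>z\<close> to all of \<open>q\<close>.\<close>

lemma child_step:
  assumes f: "f \<in> L2" and q: "q \<in> children f p"
  shows "AE x in lebesgue. x \<in> cube q \<longrightarrow>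
    cmod (T (cutoff (triple p) f) x) \<le> step_const * triple_average f p + cmod (T (cutoff (triple q) f) x)"
proof -
  obtain J where J: "0 < J" "anc J q = p"
    "\<And>j. 0 < j \<Longrightarrow> j \<le> J \<Longrightarrow> triple_average f (anc j q) \<le> stop_const * triple_average f p"
    "\<And>j. 0 < j \<Longrightarrow> j \<le> J \<Longrightarrow> emeasure lebesgue (cube (anc j q) \<inter> high f p) \<le> ennreal (1 / 2 ^ (CARD('n) + 2) * vol (anc j q))"
    using child_anc[OF f q] by blast
  define h where "h = cutoff (triple (anc J q) - triple q) f"
  define a where "a = stop_const * triple_average f p"
  have a0: "0 \<le> a" using stop_const(1) by (simp add: a_def)
  have sub: "triple q \<subseteq> triple p" using J(2) triple_subset_anc by blast
  have subc: "cube q \<subseteq> cube p" using J(2) cube_subset_anc by blast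
  note L = L2_local(1)[OF f]
  have h_eq: "h = (\<lambda>x. cutoff (triple p) f x - cutoff (triple q) f x)"
    unfolding h_def J(2) using sub by (auto simp: cutoff_def fun_eq_iff)
  have hL2: "h \<in> L2" unfolding h_eq by (intro L2_diff L)
  have Th: "AE x in lebesgue. T h x = T (cutoff (triple p) f) x - T (cutoff (triple q) f) x"
    unfolding h_eq by (intro T_diff L)
  have rep: "AE x in lebesgue. x \<in> cube q \<longrightarrow> T h x = Kop h x"
    by (rule kernel_representation_inside_cube[OF hL2, of "anc J q"]) (auto simp: h_def cutoff_def split: if_splits)
  \<comment> \<open>With this constant the weak type bound leaves an exceptional set of measure at most \<open>vol q / 4\<close>.\<close>
  define c where "c = 4 * 3 ^ CARD('n) * weak_const"
  have c: "0 < c" using weak_const_pos by (simp add: c_def)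
  define Z where "Z = {x. c * triple_average f q < cmod (T (cutoff (triple q) f) x)}"
  have Z [measurable]: "Z \<in> sets lebesgue" unfolding Z_def by (intro superlevel_lebesgue T_measurable L)
  have H [measurable]: "high f p \<in> sets lebesgue" by (rule high_lebesgue[OF f])
  have Zle: "emeasure lebesgue (cube q \<inter> Z) \<le> ennreal (vol q / 4)"
  proof -
    have "emeasure lebesgue (cube q \<inter> Z) \<le> emeasure lebesgue Z" by (intro emeasure_mono) auto
    also have "\<dots> \<le> ennreal (weak_const * 3 ^ CARD('n) / c * vol q)"
      unfolding Z_def by (rule weak_type_local[OF f c])
    also have "weak_const * 3 ^ CARD('n) / c * vol q = vol q / 4"
      using weak_const_pos by (simp add: c_def)
    finally show ?thesis .
  qed
  have Hle: "emeasure lebesgue (cube q \<inter> high f p) \<le> ennreal (vol q / 4)"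
  proof -
    have "emeasure lebesgue (cube q \<inter> high f p) \<le> emeasure lebesgue (cube (anc 1 q) \<inter> high f p)"
      using cube_subset_anc[of q 1] by (intro emeasure_mono) auto
    also have "\<dots> \<le> ennreal (1 / 2 ^ (CARD('n) + 2) * vol (anc 1 q))" using J(1) by (intro J(4)) auto
    also have "1 / 2 ^ (CARD('n) + 2) * vol (anc 1 q) = vol q / 4" by (simp add: vol_anc)
    finally show ?thesis .
  qed
  let ?S = "cube q - (cube q \<inter> Z \<union> cube q \<inter> high f p)"
  have "0 < emeasure lebesgue ?S"
  proof (rule ccontr)
    assume "\<not> 0 < emeasure lebesgue ?S"
    then have z: "emeasure lebesgue ?S = 0" by simp
    have "ennreal (vol q) = emeasure lebesgue (cube q)" by (simp add: emeasure_cube)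
    also have "\<dots> \<le> emeasure lebesgue (?S \<union> (cube q \<inter> Z \<union> cube q \<inter> high f p))" by (intro emeasure_mono) auto
    also have "\<dots> \<le> emeasure lebesgue ?S + emeasure lebesgue (cube q \<inter> Z \<union> cube q \<inter> high f p)"
      by (intro emeasure_subadditive) auto
    also have "\<dots> \<le> 0 + (emeasure lebesgue (cube q \<inter> Z) + emeasure lebesgue (cube q \<inter> high f p))"
      unfolding z by (intro add_left_mono emeasure_subadditive) auto
    also have "\<dots> \<le> 0 + (ennreal (vol q / 4) + ennreal (vol q / 4))" by (intro add_left_mono add_mono Zle Hle)
    also have "\<dots> = ennreal (vol q / 2)" by (simp add: ennreal_plus[symmetric] del: ennreal_plus)
    finally show False using vol_pos[of q] by (simp add: ennreal_le_iff)
  qed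
  moreover have "?S \<in> sets lebesgue" by auto
  moreover have "AE x in lebesgue. (x \<in> cube q \<longrightarrow> T h x = Kop h x) \<and> T h x = T (cutoff (triple p) f) x - T (cutoff (triple q) f) x"
    using rep Th by eventually_elim simp
  ultimately obtain z where z: "z \<in> ?S" "T h z = Kop h z" "T h z = T (cutoff (triple p) f) z - T (cutoff (triple q) f) z"
    using exists_AE_in_set[of ?S lebesgue "\<lambda>x. (x \<in> cube q \<longrightarrow> T h x = Kop h x) \<and> T h x = T (cutoff (triple p) f) x - T (cutoff (triple q) f) x"]
    by blast
  have z1: "cmod (T (cutoff (triple p) f) z) \<le> a" using z(1) subc by (auto simp: high_def a_def)
  have z2: "cmod (T (cutoff (triple q) f) z) \<le> c * triple_average f q" using z(1) by (auto simp: Z_def)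
  have avq: "triple_average f q \<le> 2 ^ CARD('n) * a"
  proof -
    have "mass f (triple q) \<le> mass f (triple (anc 1 q))"
      by (intro mass_mono L2_local f triple_subset_anc) auto
    then have "triple_average f q * (3 ^ CARD('n) * vol q) \<le> triple_average f (anc 1 q) * 2 ^ CARD('n) * (3 ^ CARD('n) * vol q)"
      unfolding mass_triple_eq by (simp add: vol_anc mult_ac)
    then have "triple_average f q \<le> triple_average f (anc 1 q) * 2 ^ CARD('n)" by (rule mult_right_le_imp_le) simp
    also have "\<dots> \<le> a * 2 ^ CARD('n)"
      unfolding a_def using J(1) by (intro mult_right_mono J(3)) auto
    finally show ?thesis by (simp add: mult.commute)
  qed
  have Kz: "cmod (Kop h z) \<le> a + c * (2 ^ CARD('n) * a)"
  proof -
    have "cmod (Kop h z) \<le> cmod (T (cutoff (triple p) f) z) + cmod (T (cutoff (triple q) f) z)"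
      unfolding z(2)[symmetric] z(3) by (rule norm_triangle_ineq4)
    also have "\<dots> \<le> a + c * (2 ^ CARD('n) * a)"
      using z1 z2 mult_left_mono[OF avq less_imp_le[OF c]] by linarith
    finally show ?thesis .
  qed
  have const: "(a + c * (2 ^ CARD('n) * a)) + tail_const * a = step_const * triple_average f p"
  proof -
    have "c * 2 ^ CARD('n) = 4 * (3 * 2) ^ CARD('n) * weak_const"
      unfolding c_def power_mult_distrib by simp
    then have "(a + c * (2 ^ CARD('n) * a)) + tail_const * a = a + (4 * 6 ^ CARD('n) * weak_const) * a + tail_const * a"
      by (simp add: mult.assoc[symmetric])
    then show ?thesis by (simp add: step_const_def a_def algebra_simps)
  qed
  show ?thesis using rep Th
  proof eventually_elim
    case (elim x)
    show ?case
    proof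
      assume x: "x \<in> cube q"
      have "cmod (Kop h x - Kop h z) \<le> tail_const * a"
        unfolding h_def by (rule Kop_oscillation[OF f _ a0 x]) (use J(3) z(1) in \<open>auto simp: a_def\<close>)
      then have "cmod (Kop h x) \<le> step_const * triple_average f p"
        using Kz norm_triangle_sub[of "Kop h x" "Kop h z"] unfolding const[symmetric] by linarith
      moreover have "T (cutoff (triple p) f) x = Kop h x + T (cutoff (triple q) f) x"
        using elim x by (simp add: diff_eq_eq)
      ultimately show "cmod (T (cutoff (triple p) f) x) \<le> step_const * triple_average f p + cmod (T (cutoff (triple q) f) x)"
        using norm_triangle_ineq[of "Kop h x" "T (cutoff (triple q) f) x"] by simp
    qed
  qed
qed

primrec generation :: "(real ^ 'n \<Rightarrow> complex) \<Rightarrow> int \<times> (int ^ 'n) \<Rightarrow> nat \<Rightarrow> (int \<times> (int ^ 'n)) set" where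
  "generation f p 0 = {p}"
| "generation f p (Suc n) = (\<Union>q\<in>generation f p n. children f q)"

definition sparse_family :: "(real ^ 'n \<Rightarrow> complex) \<Rightarrow> int \<times> (int ^ 'n) \<Rightarrow> (int \<times> (int ^ 'n)) set" where
  "sparse_family f p = (\<Union>n. generation f p n)"

text \<open>These sets are disjoint over a sparse family and fill at least half of each cube.\<close>

definition major :: "(real ^ 'n \<Rightarrow> complex) \<Rightarrow> int \<times> (int ^ 'n) \<Rightarrow> (real ^ 'n) set" where
  "major f q = cube q - (\<Union>r\<in>children f q. cube r)"

lemma children_cover_sets [measurable]: "(\<Union>r\<in>children f q. cube r) \<in> sets lebesgue"
  by (intro sets.countable_UN') auto

lemma major_sets [measurable]: "major f q \<in> sets lebesgue" unfolding major_def by (intro sets.Diff) auto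

lemma child_subset: "r \<in> children f q \<Longrightarrow> cube r \<subseteq> cube q"
  using children_descendants descendants_subset(1) by blast

lemma generation_disjoint:
  "q \<in> generation f p n \<Longrightarrow> r \<in> generation f p n \<Longrightarrow> x \<in> cube q \<Longrightarrow> x \<in> cube r \<Longrightarrow> q = r"
proof (induction n arbitrary: q r)
  case (Suc n)
  obtain q' r' where *: "q' \<in> generation f p n" "q \<in> children f q'" "r' \<in> generation f p n" "r \<in> children f r'"
    using Suc.prems by auto
  then have "x \<in> cube q'" "x \<in> cube r'" using child_subset Suc.prems by blast+
  then have "q' = r'" using Suc.IH * by blast
  then show ?case using children_disjoint[of q f q' r] * Suc.prems by blast
qed simp

lemma generation_cover_decreasing:
  assumes "n \<le> m" shows "(\<Union>q\<in>generation f p m. cube q) \<subseteq> (\<Union>q\<in>generation f p n. cube q)"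
  using assms
proof (induction m rule: dec_induct)
  case (step m)
  have "(\<Union>q\<in>generation f p (Suc m). cube q) \<subseteq> (\<Union>q\<in>generation f p m. cube q)"
    using child_subset by fastforce
  then show ?case using step by blast
qed simp

text \<open>A cube of a later generation lies in a child of some cube of the given generation, and cubes of one generation are disjoint.\<close>

lemma major_disjoint:
  assumes "q \<in> sparse_family f p" "r \<in> sparse_family f p" "q \<noteq> r"
  shows "major f q \<inter> major f r = {}"
proof -
  have *: "major f q \<inter> major f r = {}" if qr: "q \<in> generation f p n" "r \<in> generation f p m" "q \<noteq> r" "n \<le> m" for q r n m
  proof (cases "n = m")
    case True
    then show ?thesis using generation_disjoint[of q f p n r] qr unfolding major_def by blast
  next
    case False
    then have "cube r \<subseteq> (\<Union>q\<in>generation f p (Suc n). cube q)"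
      using generation_cover_decreasing[of "Suc n" m f p] qr by auto
    show ?thesis
    proof (rule ccontr)
      assume "major f q \<inter> major f r \<noteq> {}"
      then obtain x where x: "x \<in> major f q" "x \<in> major f r" by blast
      then have "x \<in> cube r" unfolding major_def by blast
      with \<open>cube r \<subseteq> _\<close> obtain q' s where s: "q' \<in> generation f p n" "s \<in> children f q'" "x \<in> cube s" by auto
      then have "x \<in> cube q'" using child_subset by blast
      moreover have "x \<in> cube q" using x(1) by (simp add: major_def)
      ultimately have "q' = q" using generation_disjoint s(1) qr(1) by blast
      then show False using s x(1) unfolding major_def by blast
    qed
  qed
  obtain n m where "q \<in> generation f p n" "r \<in> generation f p m" using assms by (auto simp: sparse_family_def)
  then show ?thesis using *[of q n r m] *[of r m q n] assms(3) by (cases "n \<le> m") auto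
qed

lemma vol_le_major:
  assumes f: "f \<in> L2"
  shows "ennreal (vol q) \<le> 2 * emeasure lebesgue (major f q)"
proof -
  have "ennreal (vol q / 2) + ennreal (vol q / 2) = emeasure lebesgue (cube q)"
    by (simp add: emeasure_cube ennreal_plus[symmetric] del: ennreal_plus)
  also have "\<dots> \<le> emeasure lebesgue (major f q \<union> (\<Union>r\<in>children f q. cube r))"
    by (intro emeasure_mono) (auto simp: major_def)
  also have "\<dots> \<le> emeasure lebesgue (major f q) + emeasure lebesgue (\<Union>r\<in>children f q. cube r)"
    by (intro emeasure_subadditive) auto
  also have "\<dots> \<le> emeasure lebesgue (major f q) + ennreal (vol q / 2)"
    by (intro add_left_mono children_measure f)
  finally have "ennreal (vol q / 2) \<le> emeasure lebesgue (major f q)"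
    by (simp add: ennreal_add_left_cancel_le add.commute)
  then have "2 * ennreal (vol q / 2) \<le> 2 * emeasure lebesgue (major f q)" by (rule mult_left_mono) simp
  moreover have "2 * ennreal (vol q / 2) = ennreal (vol q)" using ennreal_mult'[of 2 "vol q / 2"] by simp
  ultimately show ?thesis by simp
qed

lemma generation_measure:
  assumes f: "f \<in> L2"
  shows "emeasure lebesgue (\<Union>q\<in>generation f p n. cube q) \<le> ennreal (vol p / 2 ^ n)"
proof (induction n)
  case 0
  then show ?case by (simp add: emeasure_cube)
next
  case (Suc n)
  have d: "disjoint_family_on (\<lambda>q. \<Union>r\<in>children f q. cube r) (generation f p n)"
    "disjoint_family_on cube (generation f p n)"
    unfolding disjoint_family_on_def using generation_disjoint[of _ f p n] child_subset by blast+
  have "emeasure lebesgue (\<Union>q\<in>generation f p (Suc n). cube q)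
      = emeasure lebesgue (\<Union>q\<in>generation f p n. \<Union>r\<in>children f q. cube r)" by (rule arg_cong[where f="emeasure lebesgue"]) auto
  also have "\<dots> = (\<integral>\<^sup>+q. emeasure lebesgue (\<Union>r\<in>children f q. cube r) \<partial>count_space (generation f p n))"
    using d(1) by (intro emeasure_UN_countable) auto
  also have "\<dots> \<le> (\<integral>\<^sup>+q. ennreal (1/2) * emeasure lebesgue (cube q) \<partial>count_space (generation f p n))"
  proof (rule nn_integral_mono)
    fix q :: "int \<times> (int ^ 'n)"
    have "ennreal (1/2) * emeasure lebesgue (cube q) = ennreal (1/2 * vol q)"
      unfolding emeasure_cube by (rule ennreal_mult'[symmetric]) simp
    then show "emeasure lebesgue (\<Union>r\<in>children f q. cube r) \<le> ennreal (1/2) * emeasure lebesgue (cube q)"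
      using children_measure[OF f, of q] by simp
  qed
  also have "\<dots> = ennreal (1/2) * (\<integral>\<^sup>+q. emeasure lebesgue (cube q) \<partial>count_space (generation f p n))"
    by (rule nn_integral_cmult) auto
  also have "(\<integral>\<^sup>+q. emeasure lebesgue (cube q) \<partial>count_space (generation f p n)) = emeasure lebesgue (\<Union>q\<in>generation f p n. cube q)"
    using d(2) by (intro emeasure_UN_countable[symmetric]) auto
  also have "ennreal (1/2) * \<dots> \<le> ennreal (1/2) * ennreal (vol p / 2 ^ n)"
    by (intro mult_left_mono Suc.IH) simp
  also have "\<dots> = ennreal (1/2 * (vol p / 2 ^ n))" by (rule ennreal_mult'[symmetric]) simp
  also have "1/2 * (vol p / 2 ^ n) = vol p / 2 ^ Suc n" by simp
  finally show ?case .
qed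

text \<open>A point in no major part lies in cubes of all generations, and their unions have measure at most \<open>vol p / 2 ^ n\<close>.\<close>

lemma AE_major:
  assumes f: "f \<in> L2"
  shows "AE x in lebesgue. x \<in> cube p \<longrightarrow> (\<exists>n. \<exists>q\<in>generation f p n. x \<in> major f q)"
proof -
  define Z where "Z = (\<Inter>n. \<Union>q\<in>generation f p n. cube q)"
  have gs: "(\<Union>q\<in>generation f p n. cube q) \<in> sets lebesgue" for n by (intro sets.countable_UN') auto
  have Zs: "Z \<in> sets lebesgue" unfolding Z_def using gs by (intro sets.countable_INT) auto
  have "emeasure lebesgue Z \<le> ennreal (vol p / 2 ^ n)" for n
  proof -
    have "emeasure lebesgue Z \<le> emeasure lebesgue (\<Union>q\<in>generation f p n. cube q)"
      using gs by (intro emeasure_mono) (auto simp: Z_def)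
    then show ?thesis using generation_measure[OF f] by (rule order_trans)
  qed
  moreover have "(\<lambda>n. ennreal (vol p / 2 ^ n)) \<longlonglongrightarrow> 0"
  proof -
    have "(\<lambda>n. vol p * (1/2) ^ n) \<longlonglongrightarrow> vol p * 0" by (intro tendsto_intros LIMSEQ_power_zero) auto
    then have "(\<lambda>n. ennreal (vol p * (1/2) ^ n)) \<longlonglongrightarrow> ennreal 0" by (intro tendsto_ennrealI) simp
    then show ?thesis by (simp add: power_one_over)
  qed
  ultimately have "emeasure lebesgue Z \<le> 0" by (intro LIMSEQ_le_const) auto
  then have "Z \<in> null_sets lebesgue" using Zs by auto
  then have "AE x in lebesgue. x \<notin> Z" by (rule AE_not_in)
  then show ?thesis
  proof eventually_elim
    case (elim x)
    show ?case
    proof (intro impI, rule ccontr)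
      assume x: "x \<in> cube p" and none: "\<not> (\<exists>n. \<exists>q\<in>generation f p n. x \<in> major f q)"
      have "x \<in> (\<Union>q\<in>generation f p n. cube q)" for n
      proof (induction n)
        case (Suc n)
        then obtain q where q: "q \<in> generation f p n" "x \<in> cube q" by blast
        then have "x \<in> (\<Union>r\<in>children f q. cube r)" using none unfolding major_def by blast
        then show ?case using q(1) by auto
      qed (use x in simp)
      then show False using elim by (auto simp: Z_def)
    qed
  qed
qed

text \<open>Following a point down the generations, each step from a cube to a child costs the average of the cube left behind; the descent ends at the
cube whose major part contains the point.\<close>

theorem sparse_domination:
  assumes f: "f \<in> L2"
  shows "AE x in lebesgue. x \<in> cube p \<longrightarrow> ennreal (cmod (T (cutoff (triple p) f) x))
    \<le> (\<integral>\<^sup>+q. ennreal (step_const * triple_average f q) * indicator (cube q) x \<partial>count_space (sparse_family f p))"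
proof -
  have "AE x in lebesgue. \<forall>q. x \<in> major f q \<longrightarrow> cmod (T (cutoff (triple q) f) x) \<le> stop_const * triple_average f q"
    unfolding AE_all_countable major_def using outside_children_bound[OF f] by blast
  moreover have "AE x in lebesgue. \<forall>q. \<forall>r. r \<in> children f q \<longrightarrow> x \<in> cube r \<longrightarrow>
    cmod (T (cutoff (triple q) f) x) \<le> step_const * triple_average f q + cmod (T (cutoff (triple r) f) x)"
    unfolding AE_all_countable
  proof (intro allI)
    fix q r
    show "AE x in lebesgue. r \<in> children f q \<longrightarrow> x \<in> cube r \<longrightarrow>
      cmod (T (cutoff (triple q) f) x) \<le> step_const * triple_average f q + cmod (T (cutoff (triple r) f) x)"
      using child_step[OF f, of r q] by (cases "r \<in> children f q") auto
  qed
  ultimately show ?thesis using AE_major[OF f, of p]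
  proof eventually_elim
    case (elim x)
    \<comment> \<open>The levels of the cubes in \<open>F\<close> ensure that the next cube is not counted twice.\<close>
    have chain: "\<exists>F. finite F \<and> F \<subseteq> sparse_family f p \<and> (\<forall>r\<in>F. x \<in> cube r \<and> fst r < fst q) \<and>
        cmod (T (cutoff (triple p) f) x) \<le> (\<Sum>r\<in>F. step_const * triple_average f r) + cmod (T (cutoff (triple q) f) x)"
      if "q \<in> generation f p n" "x \<in> cube q" for q n
      using that
    proof (induction n arbitrary: q)
      case 0
      then show ?case by (intro exI[of _ "{}"]) auto
    next
      case (Suc n)
      then obtain q' where q': "q' \<in> generation f p n" "q \<in> children f q'" by auto
      have x': "x \<in> cube q'" using child_subset[OF q'(2)] Suc.prems by blast
      obtain F where F: "finite F" "F \<subseteq> sparse_family f p" "\<forall>r\<in>F. x \<in> cube r \<and> fst r < fst q'"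
        "cmod (T (cutoff (triple p) f) x) \<le> (\<Sum>r\<in>F. step_const * triple_average f r) + cmod (T (cutoff (triple q') f) x)"
        using Suc.IH[OF q'(1) x'] by blast
      have lev: "fst q' < fst q" by (rule child_level_less[OF f q'(2)])
      have nF: "q' \<notin> F" using F(3) by blast
      have "cmod (T (cutoff (triple q') f) x) \<le> step_const * triple_average f q' + cmod (T (cutoff (triple q) f) x)"
        using elim(2) q'(2) Suc.prems(2) by blast
      then have "cmod (T (cutoff (triple p) f) x) \<le> (\<Sum>r\<in>insert q' F. step_const * triple_average f r) + cmod (T (cutoff (triple q) f) x)"
        using F(1,4) nF by simp
      moreover have "insert q' F \<subseteq> sparse_family f p" using F(2) q'(1) by (auto simp: sparse_family_def)
      moreover have "\<forall>r\<in>insert q' F. x \<in> cube r \<and> fst r < fst q" using F(3) x' lev by force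
      ultimately show ?case using F(1) by (intro exI[of _ "insert q' F"]) auto
    qed
    show ?case
    proof
      assume "x \<in> cube p"
      then obtain n q where q: "q \<in> generation f p n" "x \<in> major f q" using elim(3) by blast
      then have xq: "x \<in> cube q" by (simp add: major_def)
      obtain F where F: "finite F" "F \<subseteq> sparse_family f p" "\<forall>r\<in>F. x \<in> cube r \<and> fst r < fst q"
        "cmod (T (cutoff (triple p) f) x) \<le> (\<Sum>r\<in>F. step_const * triple_average f r) + cmod (T (cutoff (triple q) f) x)"
        using chain[OF q(1) xq] by blast
      have nF: "q \<notin> F" using F(3) by blast
      have "cmod (T (cutoff (triple q) f) x) \<le> stop_const * triple_average f q" using elim(1) q(2) by blast
      also have "\<dots> \<le> step_const * triple_average f q" by (intro mult_right_mono stop_const_le_step_const) simp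
      finally have le: "cmod (T (cutoff (triple p) f) x) \<le> (\<Sum>r\<in>insert q F. step_const * triple_average f r)"
        using F(1,4) nF by simp
      have sub: "insert q F \<subseteq> sparse_family f p" using F(2) q(1) by (auto simp: sparse_family_def)
      have sc: "0 \<le> step_const" using stop_const(1) stop_const_le_step_const by linarith
      have "ennreal (cmod (T (cutoff (triple p) f) x)) \<le> (\<Sum>r\<in>insert q F. ennreal (step_const * triple_average f r))"
        using le sc by (subst sum_ennreal) (auto intro!: ennreal_leI)
      also have "\<dots> = (\<Sum>r\<in>insert q F. ennreal (step_const * triple_average f r) * indicator (cube r) x)"
        by (rule sum.cong) (use F(3) xq in auto)
      also have "\<dots> = (\<integral>\<^sup>+r. ennreal (step_const * triple_average f r) * indicator (cube r) x \<partial>count_space (insert q F))"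
        using F(1) by (subst nn_integral_count_space_finite) auto
      also have "\<dots> \<le> (\<integral>\<^sup>+r. ennreal (step_const * triple_average f r) * indicator (cube r) x \<partial>count_space (sparse_family f p))"
        using sub by (subst (1 2) nn_integral_count_space_indicator) (auto intro!: nn_integral_mono simp: indicator_def)
      finally show "ennreal (cmod (T (cutoff (triple p) f) x))
        \<le> (\<integral>\<^sup>+q. ennreal (step_const * triple_average f q) * indicator (cube q) x \<partial>count_space (sparse_family f p))" .
    qed
  qed
qed

end

section \<open>Sparse sums and the characteristic of a weight\<close>

locale a2_weight =
  fixes w :: "real ^ 'n \<Rightarrow> real"
  assumes A2: "w \<in> A2"
begin

definition W :: real where "W = enn2real (A2_char w)"

definition dual :: "(real ^ 'n) measure" where
  "dual = density lebesgue (\<lambda>x. ennreal (inverse (w x)))"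

lemma w_measurable [measurable]: "w \<in> borel_measurable lebesgue"
  using A2 by (simp add: A2_def weight_def)

lemma w_pos: "AE x in lebesgue. 0 < w x"
  using A2 by (simp add: A2_def weight_def)

lemma sets_weighted [simp, measurable_cong]: "sets (weighted w) = sets lebesgue" "space (weighted w) = UNIV"
  by (simp_all add: weighted_def)

lemma sets_dual [simp, measurable_cong]: "sets dual = sets lebesgue" "space dual = UNIV"
  by (simp_all add: dual_def)

lemma emeasure_weighted: "S \<in> sets lebesgue \<Longrightarrow> emeasure (weighted w) S = (\<integral>\<^sup>+x\<in>S. ennreal (w x) \<partial>lebesgue)"
  unfolding weighted_def by (rule emeasure_density) auto

lemma emeasure_dual: "S \<in> sets lebesgue \<Longrightarrow> emeasure dual S = (\<integral>\<^sup>+x\<in>S. ennreal (inverse (w x)) \<partial>lebesgue)"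
  unfolding dual_def by (rule emeasure_density) auto

lemma A2_char_eq: "A2_char w = ennreal W"
  using A2 by (simp add: W_def A2_def)

lemma positive_mass:
  assumes S: "S \<in> sets lebesgue" "0 < emeasure lebesgue S"
  shows "0 < emeasure (weighted w) S" "0 < emeasure dual S"
proof -
  have *: "0 < (\<integral>\<^sup>+x\<in>S. ennreal (u x) \<partial>lebesgue)"
    if u: "u \<in> borel_measurable lebesgue" "AE x in lebesgue. 0 < u x" for u :: "real ^ 'n \<Rightarrow> real"
  proof (rule ccontr)
    assume "\<not> 0 < (\<integral>\<^sup>+x\<in>S. ennreal (u x) \<partial>lebesgue)"
    then have "(\<integral>\<^sup>+x\<in>S. ennreal (u x) \<partial>lebesgue) = 0" by simp
    then have "AE x in lebesgue. ennreal (u x) * indicator S x = 0"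
      using u S by (subst (asm) nn_integral_0_iff_AE) auto
    then have "AE x in lebesgue. x \<notin> S" using u(2) by eventually_elim (auto simp: indicator_def split: if_splits)
    then have "S \<in> null_sets lebesgue" using S(1) by (simp add: AE_iff_null_sets)
    then show False using S(2) by auto
  qed
  show "0 < emeasure (weighted w) S" unfolding emeasure_weighted[OF S(1)] by (rule *) (use w_pos in auto)
  show "0 < emeasure dual S" unfolding emeasure_dual[OF S(1)] by (rule *) (use w_pos in auto)
qed

lemma weighted_compact_finite:
  assumes "compact C" shows "emeasure (weighted w) C < \<infinity>"
proof -
  have "integrable lebesgue (\<lambda>x. indicator C x *\<^sub>R w x)"
    using A2 assms by (simp add: A2_def weight_def set_integrable_def)
  then have "(\<integral>\<^sup>+x. ennreal (norm (indicator C x *\<^sub>R w x)) \<partial>lebesgue) < \<infinity>"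
    by (simp add: integrable_iff_bounded)
  moreover have "emeasure (weighted w) C \<le> (\<integral>\<^sup>+x. ennreal (norm (indicator C x *\<^sub>R w x)) \<partial>lebesgue)"
    unfolding emeasure_weighted[OF compact_lebesgue(1)[OF assms]]
    by (intro nn_integral_mono) (auto simp: indicator_def intro!: ennreal_leI)
  ultimately show ?thesis by (rule le_less_trans[rotated])
qed

text \<open>The integral of \<open>1 / w\<close> is finite because that of \<open>w\<close> is positive.\<close>

lemma A2_cube:
  assumes "I \<in> cubes" "emeasure lebesgue I = ennreal V" "0 < V"
  shows "emeasure (weighted w) I * emeasure dual I \<le> ennreal (W * V\<^sup>2)"
    "emeasure (weighted w) I < \<infinity>" "emeasure dual I < \<infinity>"
proof -
  have comp: "compact I" using assms(1) by (auto simp: cubes_def)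
  have I: "I \<in> sets lebesgue" by (rule compact_lebesgue(1)[OF comp])
  show fw: "emeasure (weighted w) I < \<infinity>" by (rule weighted_compact_finite[OF comp])
  have "average w I * average (\<lambda>x. inverse (w x)) I \<le> ennreal W"
    unfolding A2_char_eq[symmetric] A2_char_def by (rule SUP_upper[OF assms(1)])
  moreover have "average w I = emeasure (weighted w) I * ennreal (1 / V)"
    using assms by (simp add: average_def emeasure_weighted[OF I] divide_ennreal_def inverse_ennreal inverse_eq_divide)
  moreover have "average (\<lambda>x. inverse (w x)) I = emeasure dual I * ennreal (1 / V)"
    using assms by (simp add: average_def emeasure_dual[OF I] divide_ennreal_def inverse_ennreal inverse_eq_divide)
  ultimately have prod: "(emeasure (weighted w) I * ennreal (1 / V)) * (emeasure dual I * ennreal (1 / V)) \<le> ennreal W" by simp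
  have "ennreal (1 / V\<^sup>2) * (emeasure (weighted w) I * emeasure dual I) \<le> ennreal W"
  proof -
    have e: "ennreal (1 / V) * ennreal (1 / V) = ennreal (1 / V\<^sup>2)"
      using assms(3) by (simp add: ennreal_mult'[symmetric] power2_eq_square)
    have "(emeasure (weighted w) I * ennreal (1 / V)) * (emeasure dual I * ennreal (1 / V))
        = (ennreal (1 / V) * ennreal (1 / V)) * (emeasure (weighted w) I * emeasure dual I)"
      by (simp only: mult_ac)
    then show ?thesis using prod unfolding e by simp
  qed
  then have "emeasure (weighted w) I * emeasure dual I \<le> ennreal (W / (1 / V\<^sup>2))"
    using assms(3) by (intro ennreal_divide_bound) auto
  then show le: "emeasure (weighted w) I * emeasure dual I \<le> ennreal (W * V\<^sup>2)" by simp
  have "0 < emeasure (weighted w) I" using positive_mass(1)[OF I] assms by simp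
  moreover have "emeasure (weighted w) I * emeasure dual I < \<infinity>" using le by (rule le_less_trans) simp
  ultimately show "emeasure dual I < \<infinity>"
    by (auto simp: ennreal_mult_less_top)
qed

lemma A2_triple:
  "emeasure (weighted w) (triple p) * emeasure dual (triple p) \<le> ennreal (W * (3 ^ CARD('n) * vol p)\<^sup>2)"
  "emeasure (weighted w) (triple p) < \<infinity>" "emeasure dual (triple p) < \<infinity>"
proof -
  obtain I where I: "I \<in> cubes" "triple p \<subseteq> I" "emeasure lebesgue I = ennreal (3 ^ CARD('n) * vol p)"
    using triple_in_cbox[of p] by blast
  have V: "0 < 3 ^ CARD('n) * vol p" by simp
  have Is: "I \<in> sets lebesgue" using I(1) by (auto simp: cubes_def)
  have m: "emeasure (weighted w) (triple p) \<le> emeasure (weighted w) I" "emeasure dual (triple p) \<le> emeasure dual I"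
    using I(2) Is by (auto intro!: emeasure_mono)
  note A = A2_cube[OF I(1,3) V]
  show "emeasure (weighted w) (triple p) < \<infinity>" "emeasure dual (triple p) < \<infinity>"
    using le_less_trans[OF m(1) A(2)] le_less_trans[OF m(2) A(3)] by auto
  have "emeasure (weighted w) (triple p) * emeasure dual (triple p) \<le> emeasure (weighted w) I * emeasure dual I"
    using m by (rule mult_mono) auto
  then show "emeasure (weighted w) (triple p) * emeasure dual (triple p) \<le> ennreal (W * (3 ^ CARD('n) * vol p)\<^sup>2)"
    using A(1) by (rule order_trans)
qed

lemma weighted_cube_finite: "emeasure (weighted w) (cube p) < \<infinity>"
proof -
  have "emeasure (weighted w) (cube p) \<le> emeasure (weighted w) (triple p)"
    by (intro emeasure_mono cube_subset_triple) auto
  then show ?thesis using A2_triple(2) by (rule le_less_trans)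
qed

lemma sigma_finite_of_cubes:
  fixes M :: "(real ^ 'n) measure"
  assumes "sets M = sets lebesgue" "\<And>p. emeasure M (triple p) < \<infinity>"
  shows "sigma_finite_measure M"
proof
  have sp: "space M = UNIV" using sets_eq_imp_space_eq[OF assms(1)] by simp
  have "\<Union>(range (triple :: int \<times> (int ^ 'n) \<Rightarrow> _)) = UNIV"
    using exists_cube[of 0] cube_subset_triple by blast
  then show "\<exists>A. countable A \<and> A \<subseteq> sets M \<and> \<Union>A = space M \<and> (\<forall>a\<in>A. emeasure M a \<noteq> \<infinity>)"
    using assms(2) by (intro exI[of _ "range (triple :: int \<times> (int ^ 'n) \<Rightarrow> _)"]) (auto simp: assms(1) sp less_top[symmetric])
qed

lemma sigma_finite: "sigma_finite_measure (weighted w)" "sigma_finite_measure dual"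
  by (auto intro!: sigma_finite_of_cubes A2_triple)

text \<open>The inequality of arithmetic and geometric means for \<open>s a\<^sup>2 / w\<close> and \<open>b\<^sup>2 w / s\<close>, integrated. It plays the part of the
Cauchy-Schwarz inequality; the free parameter \<open>s\<close> is chosen at the very end, which avoids square roots of
sums.\<close>

lemma geometric_mean_bound:
  assumes E: "E \<in> sets lebesgue" and ab: "0 \<le> a" "0 \<le> b" and s: "0 < s"
  shows "2 * (ennreal (a * b) * emeasure lebesgue E)
    \<le> ennreal s * (ennreal (a\<^sup>2) * emeasure dual E) + ennreal (1 / s) * (ennreal (b\<^sup>2) * emeasure (weighted w) E)"
proof -
  have "2 * (ennreal (a * b) * emeasure lebesgue E) = (\<integral>\<^sup>+x. ennreal (2 * (a * b)) * indicator E x \<partial>lebesgue)"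
  proof -
    have e: "ennreal (2 * (a * b)) = 2 * ennreal (a * b)" using ennreal_mult'[of 2 "a * b"] by simp
    show ?thesis unfolding nn_integral_cmult_indicator[OF E] e by (simp only: mult.assoc)
  qed
  also have "\<dots> \<le> (\<integral>\<^sup>+x. ennreal (s * a\<^sup>2) * (ennreal (inverse (w x)) * indicator E x)
      + ennreal (1 / s * b\<^sup>2) * (ennreal (w x) * indicator E x) \<partial>lebesgue)"
  proof (rule nn_integral_mono_AE)
    show "AE x in lebesgue. ennreal (2 * (a * b)) * indicator E x
      \<le> ennreal (s * a\<^sup>2) * (ennreal (inverse (w x)) * indicator E x) + ennreal (1 / s * b\<^sup>2) * (ennreal (w x) * indicator E x)"
      using w_pos
    proof eventually_elim
      case (elim x)
      have "2 * (a * b) \<le> s * a\<^sup>2 * inverse (w x) + 1 / s * b\<^sup>2 * w x"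
      proof -
        have "0 \<le> (s * a - b * w x)\<^sup>2" by simp
        then have "2 * (a * b) * (s * w x) \<le> s\<^sup>2 * a\<^sup>2 + b\<^sup>2 * (w x)\<^sup>2"
          by (simp add: power2_eq_square algebra_simps)
        then have "2 * (a * b) \<le> (s\<^sup>2 * a\<^sup>2 + b\<^sup>2 * (w x)\<^sup>2) / (s * w x)"
          using s elim by (simp add: pos_le_divide_eq)
        also have "\<dots> = s * a\<^sup>2 * inverse (w x) + 1 / s * b\<^sup>2 * w x"
          using s elim by (simp add: power2_eq_square field_simps)
        finally show ?thesis .
      qed
      then have "ennreal (2 * (a * b)) \<le> ennreal (s * a\<^sup>2 * inverse (w x) + 1 / s * b\<^sup>2 * w x)"
        by (rule ennreal_leI)
      also have "\<dots> = ennreal (s * a\<^sup>2) * ennreal (inverse (w x)) + ennreal (1 / s * b\<^sup>2) * ennreal (w x)"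
        using s elim by (simp add: ennreal_plus ennreal_mult'[symmetric])
      finally show ?case by (auto simp: indicator_def)
    qed
  qed
  also have "\<dots> = ennreal (s * a\<^sup>2) * emeasure dual E + ennreal (1 / s * b\<^sup>2) * emeasure (weighted w) E"
    unfolding emeasure_dual[OF E] emeasure_weighted[OF E] using E
    by (subst nn_integral_add) (auto simp: nn_integral_cmult)
  also have "\<dots> = ennreal s * (ennreal (a\<^sup>2) * emeasure dual E) + ennreal (1 / s) * (ennreal (b\<^sup>2) * emeasure (weighted w) E)"
    using s ennreal_mult'[of s "a\<^sup>2"] ennreal_mult'[of "1/s" "b\<^sup>2"] by (simp add: mult.assoc)
  finally show ?thesis .
qed

text \<open>\<open>geometric_mean_bound\<close> on a single triple, with \<open>s\<close> chosen so that its first term is the measure of the triple.\<close>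

lemma W_ge_1: "1 \<le> W"
proof -
  define p :: "int \<times> (int ^ 'n)" where "p = (0, 0)"
  define V where "V = 3 ^ CARD('n) * vol p"
  have V: "0 < V" by (simp add: V_def)
  have pos: "0 < emeasure (weighted w) (triple p)" "0 < emeasure dual (triple p)"
    using positive_mass[OF triple_lebesgue, of p] by (simp_all add: emeasure_triple)
  obtain x where x: "emeasure (weighted w) (triple p) = ennreal x" "0 < x"
    using pos(1) A2_triple(2)[of p] by (cases "emeasure (weighted w) (triple p)") auto
  obtain y where y: "emeasure dual (triple p) = ennreal y" "0 < y"
    using pos(2) A2_triple(3)[of p] by (cases "emeasure dual (triple p)") auto
  define s where "s = V / y"
  have s: "0 < s" using V y by (simp add: s_def)
  have "ennreal x * ennreal y \<le> ennreal (W * V\<^sup>2)" using A2_triple(1)[of p] by (simp add: x y V_def)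
  then have "ennreal (x * y) \<le> ennreal (W * V\<^sup>2)" using x y by (simp add: ennreal_mult')
  moreover have "0 < x * y" using x y by simp
  ultimately have xy: "x * y \<le> W * V\<^sup>2" by (simp add: ennreal_le_iff2)
  have "2 * (ennreal 1 * ennreal V) \<le> ennreal s * (ennreal 1 * ennreal y) + ennreal (1 / s) * (ennreal 1 * ennreal x)"
    using geometric_mean_bound[OF triple_lebesgue _ _ s, of 1 1 p] by (simp add: x y emeasure_triple V_def)
  moreover have "2 * (ennreal 1 * ennreal V) = ennreal (2 * V)" using ennreal_mult'[of 2 V] by simp
  moreover have "ennreal s * (ennreal 1 * ennreal y) + ennreal (1 / s) * (ennreal 1 * ennreal x) = ennreal (s * y + 1 / s * x)"
    using s x y by (simp add: ennreal_mult'[symmetric] ennreal_plus[symmetric] del: ennreal_plus)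
  ultimately have "ennreal (2 * V) \<le> ennreal (s * y + 1 / s * x)" by (simp only:)
  moreover have "0 < s * y + 1 / s * x" using s x y by (intro add_pos_pos mult_pos_pos) auto
  ultimately have "2 * V \<le> s * y + 1 / s * x"
    by (simp only: ennreal_le_iff[OF less_imp_le])
  also have "s * y = V" using y by (simp add: s_def)
  also have "1 / s * x = x * y / V" by (simp add: s_def)
  finally have "V\<^sup>2 \<le> x * y" using V by (simp add: power2_eq_square pos_le_divide_eq)
  then have "1 * V\<^sup>2 \<le> W * V\<^sup>2" using xy by linarith
  then show ?thesis using V by (simp add: mult_le_cancel_right)
qed

text \<open>With \<open>\<phi> = \<bar>f\<bar> w\<close>, the \<open>\<sigma>\<close>-integral of \<open>\<phi>\<close> over a set is the integral of \<open>\<bar>f\<bar>\<close>, and the \<open>\<sigma>\<close>-integral of \<open>\<phi>\<^sup>2\<close> is the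
\<open>w\<close>-integral of \<open>\<bar>f\<bar>\<^sup>2\<close>. The maximal theorem is applied in each of the at most \<open>3 ^ d\<close> classes of triples.\<close>

lemma dual_maximal:
  fixes f :: "real ^ 'n \<Rightarrow> complex"
  assumes f: "f \<in> L2" and a: "\<And>q. q \<in> S \<Longrightarrow> 0 \<le> a q"
    "\<And>q. q \<in> S \<Longrightarrow> ennreal (a q) * emeasure dual (triple q) \<le> ennreal (mass f (triple q))"
    and E: "\<And>q. q \<in> S \<Longrightarrow> E q \<in> sets lebesgue" "\<And>q. q \<in> S \<Longrightarrow> E q \<subseteq> triple q" "disjoint_family_on E S"
  shows "(\<integral>\<^sup>+q. ennreal ((a q)\<^sup>2) * emeasure dual (E q) \<partial>count_space S)
    \<le> ennreal (8 * 3 ^ CARD('n)) * (\<integral>\<^sup>+x. ennreal ((cmod (f x))\<^sup>2) \<partial>weighted w)"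
proof -
  have fm [measurable]: "f \<in> borel_measurable lebesgue" using f by auto
  define \<phi> where "\<phi> x = cmod (f x) * \<bar>w x\<bar>" for x
  have phi [measurable]: "\<phi> \<in> borel_measurable lebesgue" unfolding \<phi>_def by measurable
  define F where "F = (\<integral>\<^sup>+x. ennreal ((cmod (f x))\<^sup>2) \<partial>weighted w)"
  have phi2: "(\<integral>\<^sup>+x. ennreal ((\<phi> x)\<^sup>2) \<partial>dual) = F"
  proof -
    have "(\<integral>\<^sup>+x. ennreal ((\<phi> x)\<^sup>2) \<partial>dual) = (\<integral>\<^sup>+x. ennreal (inverse (w x)) * ennreal ((\<phi> x)\<^sup>2) \<partial>lebesgue)"
      unfolding dual_def by (rule nn_integral_density) auto
    also have "\<dots> = (\<integral>\<^sup>+x. ennreal (w x) * ennreal ((cmod (f x))\<^sup>2) \<partial>lebesgue)"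
    proof (rule nn_integral_cong_AE)
      show "AE x in lebesgue. ennreal (inverse (w x)) * ennreal ((\<phi> x)\<^sup>2) = ennreal (w x) * ennreal ((cmod (f x))\<^sup>2)"
        using w_pos
      proof eventually_elim
        case (elim x)
        have "inverse (w x) * (\<phi> x)\<^sup>2 = w x * (cmod (f x))\<^sup>2"
          using elim by (simp add: \<phi>_def power2_eq_square field_simps)
        then show ?case using elim by (simp add: ennreal_mult'[symmetric])
      qed
    qed
    also have "\<dots> = F" unfolding F_def weighted_def by (rule nn_integral_density[symmetric]) auto
    finally show ?thesis .
  qed
  have phi1: "(\<integral>\<^sup>+x\<in>triple q. ennreal (\<phi> x) \<partial>dual) = ennreal (mass f (triple q))" for q
  proof -
    have "(\<integral>\<^sup>+x\<in>triple q. ennreal (\<phi> x) \<partial>dual) = (\<integral>\<^sup>+x. ennreal (inverse (w x)) * (ennreal (\<phi> x) * indicator (triple q) x) \<partial>lebesgue)"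
      unfolding dual_def by (rule nn_integral_density) auto
    also have "\<dots> = (\<integral>\<^sup>+x\<in>triple q. ennreal (cmod (f x)) \<partial>lebesgue)"
    proof (rule nn_integral_cong_AE)
      show "AE x in lebesgue. ennreal (inverse (w x)) * (ennreal (\<phi> x) * indicator (triple q) x) = ennreal (cmod (f x)) * indicator (triple q) x"
        using w_pos
      proof eventually_elim
        case (elim x)
        have "inverse (w x) * \<phi> x = cmod (f x)" using elim by (simp add: \<phi>_def field_simps)
        then have "ennreal (inverse (w x)) * ennreal (\<phi> x) = ennreal (cmod (f x))"
          using elim by (simp add: ennreal_mult'[symmetric])
        then show ?case by (simp add: mult.assoc[symmetric])
      qed
    qed
    also have "\<dots> = ennreal (mass f (triple q))" by (rule nn_mass[OF L2_local(2)[OF f]])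
    finally show ?thesis .
  qed
  let ?R = "range (triple_class :: int \<times> (int ^ 'n) \<Rightarrow> _)"
  define g where "g q = ennreal ((a q)\<^sup>2) * emeasure dual (E q)" for q
  define Sc where "Sc c = {q\<in>S. triple_class q = c}" for c
  have each: "(\<integral>\<^sup>+q. g q \<partial>count_space (Sc c)) \<le> 8 * F" for c
    unfolding g_def phi2[symmetric]
  proof (rule laminar_maximal_L2[where A=triple])
    show "sigma_finite_measure dual" by (rule sigma_finite(2))
    show "triple i \<inter> triple j = {} \<or> triple i \<subseteq> triple j \<or> triple j \<subseteq> triple i"
      if "i \<in> Sc c" "j \<in> Sc c" for i j using that by (intro triples_laminar) (auto simp: Sc_def)
    show "disjoint_family_on E (Sc c)" using E(3) by (auto simp: Sc_def disjoint_family_on_def)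
    show "ennreal (a i) * emeasure dual (triple i) \<le> (\<integral>\<^sup>+x\<in>triple i. ennreal (\<phi> x) \<partial>dual)" if "i \<in> Sc c" for i
      unfolding phi1 using a(2) that by (simp add: Sc_def)
    show "emeasure dual (triple i) < \<infinity>" for i by (rule A2_triple(3))
    show "0 \<le> \<phi> x" for x by (simp add: \<phi>_def)
  qed (use a E in \<open>auto simp: Sc_def\<close>)
  have "(\<integral>\<^sup>+q. g q \<partial>count_space S) = (\<integral>\<^sup>+q. g q * indicator S q \<partial>count_space UNIV)"
    by (rule nn_integral_count_space_indicator) simp
  also have "\<dots> = (\<integral>\<^sup>+q. (\<Sum>c\<in>?R. g q * indicator (Sc c) q) \<partial>count_space UNIV)"
  proof (rule nn_integral_cong)
    fix q
    have "(\<Sum>c\<in>?R. g q * indicator (Sc c) q) = (\<Sum>c\<in>?R. if c = triple_class q then g q * indicator S q else 0)"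
      by (rule sum.cong) (auto simp: Sc_def indicator_def)
    also have "\<dots> = g q * indicator S q" using finite_range_triple_class(1) by (subst sum.delta) auto
    finally show "g q * indicator S q = (\<Sum>c\<in>?R. g q * indicator (Sc c) q)" ..
  qed
  also have "\<dots> = (\<Sum>c\<in>?R. \<integral>\<^sup>+q. g q * indicator (Sc c) q \<partial>count_space UNIV)"
    by (rule nn_integral_sum) auto
  also have "\<dots> = (\<Sum>c\<in>?R. \<integral>\<^sup>+q. g q \<partial>count_space (Sc c))"
    by (intro sum.cong refl nn_integral_count_space_indicator[symmetric]) simp
  also have "\<dots> \<le> (\<Sum>c\<in>?R. 8 * F)" by (intro sum_mono each)
  also have "\<dots> = of_nat (card ?R) * (8 * F)" by simp
  also have "\<dots> \<le> of_nat (3 ^ CARD('n)) * (8 * F)"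
    by (intro mult_right_mono of_nat_mono finite_range_triple_class(2)) auto
  also have "\<dots> = ennreal (8 * 3 ^ CARD('n)) * F"
    by (simp add: ennreal_mult' ennreal_power[symmetric] mult_ac)
  finally show ?thesis by (simp add: g_def F_def)
qed

lemma weighted_maximal_indicator:
  assumes H: "H \<in> sets lebesgue" and b: "\<And>q. q \<in> S \<Longrightarrow> 0 \<le> b q"
    "\<And>q. q \<in> S \<Longrightarrow> ennreal (b q) * emeasure (weighted w) (cube q) \<le> emeasure (weighted w) (cube q \<inter> H)"
    and E: "\<And>q. q \<in> S \<Longrightarrow> E q \<in> sets lebesgue" "\<And>q. q \<in> S \<Longrightarrow> E q \<subseteq> cube q" "disjoint_family_on E S"
  shows "(\<integral>\<^sup>+q. ennreal ((b q)\<^sup>2) * emeasure (weighted w) (E q) \<partial>count_space S) \<le> 8 * emeasure (weighted w) H"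
proof -
  let ?h = "indicator H :: real ^ 'n \<Rightarrow> real"
  have "(\<integral>\<^sup>+q. ennreal ((b q)\<^sup>2) * emeasure (weighted w) (E q) \<partial>count_space S)
      \<le> 8 * (\<integral>\<^sup>+x. ennreal ((?h x)\<^sup>2) \<partial>weighted w)"
  proof (rule laminar_maximal_L2[where A=cube])
    show "sigma_finite_measure (weighted w)" by (rule sigma_finite(1))
    show "cube i \<inter> cube j = {} \<or> cube i \<subseteq> cube j \<or> cube j \<subseteq> cube i" for i j :: "int \<times> (int ^ 'n)"
      using cubes_laminar[of i j] cube_subset_anc[of i] cube_subset_anc[of j] by blast
    show "emeasure (weighted w) (cube i) < \<infinity>" for i by (rule weighted_cube_finite)
    have "(\<integral>\<^sup>+x\<in>cube i. ennreal (?h x) \<partial>weighted w) = emeasure (weighted w) (cube i \<inter> H)" for i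
    proof -
      have "(\<integral>\<^sup>+x\<in>cube i. ennreal (?h x) \<partial>weighted w) = (\<integral>\<^sup>+x. indicator (cube i \<inter> H) x \<partial>weighted w)"
        by (intro nn_integral_cong) (auto simp: indicator_def)
      also have "\<dots> = emeasure (weighted w) (cube i \<inter> H)" by (rule nn_integral_indicator) (use H in auto)
      finally show ?thesis .
    qed
    then show "ennreal (b i) * emeasure (weighted w) (cube i) \<le> (\<integral>\<^sup>+x\<in>cube i. ennreal (?h x) \<partial>weighted w)"
      if "i \<in> S" for i using b(2) that by simp
  qed (use b E H in auto)
  also have "(\<integral>\<^sup>+x. ennreal ((?h x)\<^sup>2) \<partial>weighted w) = (\<integral>\<^sup>+x. indicator H x \<partial>weighted w)"
    by (intro nn_integral_cong) (auto simp: indicator_def)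
  also have "\<dots> = emeasure (weighted w) H" using H by simp
  finally show ?thesis .
qed

text \<open>The only place where the characteristic of the weight is used quantitatively, and it enters linearly.\<close>

lemma sparse_pairing:
  fixes f :: "real ^ 'n \<Rightarrow> complex"
  assumes f: "f \<in> L2" and H: "H \<in> sets lebesgue" and s: "0 < s"
    and E: "\<And>q. q \<in> S \<Longrightarrow> E q \<in> sets lebesgue" "\<And>q. q \<in> S \<Longrightarrow> E q \<subseteq> cube q" "disjoint_family_on E S"
    and sparse: "\<And>q. q \<in> S \<Longrightarrow> ennreal (vol q) \<le> 2 * emeasure lebesgue (E q)"
  shows "(\<integral>\<^sup>+q. ennreal (triple_average f q) * emeasure (weighted w) (cube q \<inter> H) \<partial>count_space S)
    \<le> ennreal (8 * 9 ^ CARD('n) * W) * (ennreal s * (\<integral>\<^sup>+x. ennreal ((cmod (f x))\<^sup>2) \<partial>weighted w)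
        + ennreal (1 / s) * emeasure (weighted w) H)"
proof -
  define F where "F = (\<integral>\<^sup>+x. ennreal ((cmod (f x))\<^sup>2) \<partial>weighted w)"
  define ds where "ds q = enn2real (emeasure dual (triple q))" for q
  define ws where "ws q = enn2real (emeasure (weighted w) (cube q))" for q
  define hs where "hs q = enn2real (emeasure (weighted w) (cube q \<inter> H))" for q
  have ds: "emeasure dual (triple q) = ennreal (ds q)" "0 < ds q" for q
    using A2_triple(3)[of q] positive_mass(2)[OF triple_lebesgue, of q]
    by (auto simp: ds_def emeasure_triple enn2real_positive_iff less_top)
  have ws: "emeasure (weighted w) (cube q) = ennreal (ws q)" "0 < ws q" for q
    using weighted_cube_finite[of q] positive_mass(1)[OF cube_lebesgue, of q]
    by (auto simp: ws_def emeasure_cube enn2real_positive_iff less_top)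
  have hs: "emeasure (weighted w) (cube q \<inter> H) = ennreal (hs q)" for q
  proof -
    have "emeasure (weighted w) (cube q \<inter> H) \<le> emeasure (weighted w) (cube q)" by (intro emeasure_mono) auto
    then have "emeasure (weighted w) (cube q \<inter> H) < top" using weighted_cube_finite[of q] by (auto intro: le_less_trans)
    then show ?thesis by (simp add: hs_def)
  qed
  have hs0: "0 \<le> hs q" for q by (simp add: hs_def)
  define a where "a q = mass f (triple q) / ds q" for q
  define b where "b q = hs q / ws q" for q
  have a0: "0 \<le> a q" and b0: "0 \<le> b q" for q using ds(2)[of q] ws(2)[of q] hs0[of q] by (simp_all add: a_def b_def)
  \<comment> \<open>The characteristic controls the dual measure of the triple against the weight of the smaller set \<open>cube q\<close>.\<close>
  have A: "ds q * ws q \<le> W * (3 ^ CARD('n) * vol q)\<^sup>2" for q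
  proof -
    have "ennreal (ws q) * ennreal (ds q) \<le> emeasure (weighted w) (triple q) * emeasure dual (triple q)"
      unfolding ds(1)[symmetric] ws(1)[symmetric] by (intro mult_right_mono emeasure_mono cube_subset_triple) auto
    also have "\<dots> \<le> ennreal (W * (3 ^ CARD('n) * vol q)\<^sup>2)" by (rule A2_triple(1))
    finally have "ennreal (ws q * ds q) \<le> ennreal (W * (3 ^ CARD('n) * vol q)\<^sup>2)"
      using ws(2)[of q] by (simp add: ennreal_mult')
    then show ?thesis using W_ge_1 by (simp add: ennreal_le_iff mult.commute)
  qed
  let ?d = "3 ^ CARD('n) :: real"
  have termwise: "ennreal (triple_average f q) * emeasure (weighted w) (cube q \<inter> H)
      \<le> ennreal (?d * W) * (ennreal s * (ennreal ((a q)\<^sup>2) * emeasure dual (E q))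
          + ennreal (1 / s) * (ennreal ((b q)\<^sup>2) * emeasure (weighted w) (E q)))" if q: "q \<in> S" for q
  proof -
    have "triple_average f q * hs q = a q * b q * (ds q * ws q) / (?d * vol q)"
      using ds(2)[of q] ws(2)[of q] by (simp add: triple_average_def a_def b_def)
    also have "\<dots> \<le> a q * b q * (W * (?d * vol q)\<^sup>2) / (?d * vol q)"
      using a0 b0 by (intro divide_right_mono mult_left_mono A mult_nonneg_nonneg) auto
    also have "\<dots> = (?d * W) * (a q * b q * vol q)" by (simp add: power2_eq_square)
    finally have "ennreal (triple_average f q) * ennreal (hs q) \<le> ennreal ((?d * W) * (a q * b q * vol q))"
      by (simp add: ennreal_mult'[symmetric] ennreal_leI)
    also have "\<dots> = ennreal (?d * W) * (ennreal (a q * b q) * ennreal (vol q))"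
      using W_ge_1 a0[of q] b0[of q] by (simp add: ennreal_mult')
    also have "\<dots> \<le> ennreal (?d * W) * (ennreal (a q * b q) * (2 * emeasure lebesgue (E q)))"
      by (intro mult_left_mono sparse q) auto
    also have "\<dots> = ennreal (?d * W) * (2 * (ennreal (a q * b q) * emeasure lebesgue (E q)))"
      by (simp only: mult_ac)
    also have "\<dots> \<le> ennreal (?d * W) * (ennreal s * (ennreal ((a q)\<^sup>2) * emeasure dual (E q))
          + ennreal (1 / s) * (ennreal ((b q)\<^sup>2) * emeasure (weighted w) (E q)))"
      by (intro mult_left_mono geometric_mean_bound E q a0 b0 s) auto
    finally show ?thesis unfolding hs .
  qed
  have m1: "(\<integral>\<^sup>+q. ennreal ((a q)\<^sup>2) * emeasure dual (E q) \<partial>count_space S) \<le> ennreal (8 * 3 ^ CARD('n)) * F"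
    unfolding F_def
  proof (rule dual_maximal[OF f])
    show "E q \<subseteq> triple q" if "q \<in> S" for q using E(2)[OF that] cube_subset_triple by blast
    show "ennreal (a q) * emeasure dual (triple q) \<le> ennreal (mass f (triple q))" for q
      unfolding ds(1) using ds(2)[of q] a0[of q] by (simp add: ennreal_mult'[symmetric] a_def)
  qed (use a0 E in auto)
  have m2: "(\<integral>\<^sup>+q. ennreal ((b q)\<^sup>2) * emeasure (weighted w) (E q) \<partial>count_space S) \<le> 8 * emeasure (weighted w) H"
  proof (rule weighted_maximal_indicator[OF H])
    show "ennreal (b q) * emeasure (weighted w) (cube q) \<le> emeasure (weighted w) (cube q \<inter> H)" for q
      unfolding ws(1) hs using ws(2)[of q] b0[of q] by (simp add: ennreal_mult'[symmetric] b_def)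
  qed (use b0 E in auto)
  have "(\<integral>\<^sup>+q. ennreal (triple_average f q) * emeasure (weighted w) (cube q \<inter> H) \<partial>count_space S)
      \<le> (\<integral>\<^sup>+q. ennreal (?d * W) * (ennreal s * (ennreal ((a q)\<^sup>2) * emeasure dual (E q))
          + ennreal (1 / s) * (ennreal ((b q)\<^sup>2) * emeasure (weighted w) (E q))) \<partial>count_space S)"
    by (intro nn_integral_mono termwise) simp
  also have "\<dots> = ennreal (?d * W) * (ennreal s * (\<integral>\<^sup>+q. ennreal ((a q)\<^sup>2) * emeasure dual (E q) \<partial>count_space S)
      + ennreal (1 / s) * (\<integral>\<^sup>+q. ennreal ((b q)\<^sup>2) * emeasure (weighted w) (E q) \<partial>count_space S))"
    by (simp add: nn_integral_cmult nn_integral_add)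
  also have "\<dots> \<le> ennreal (?d * W) * (ennreal s * (ennreal (8 * ?d) * F) + ennreal (1 / s) * (ennreal (8 * ?d) * emeasure (weighted w) H))"
  proof (intro mult_left_mono add_mono m1)
    have "8 * emeasure (weighted w) H \<le> ennreal (8 * ?d) * emeasure (weighted w) H"
    proof (rule mult_right_mono)
      have "ennreal 8 \<le> ennreal (8 * ?d)" by (rule ennreal_leI) simp
      then show "8 \<le> ennreal (8 * ?d)" by simp
    qed simp
    with m2 show "(\<integral>\<^sup>+q. ennreal ((b q)\<^sup>2) * emeasure (weighted w) (E q) \<partial>count_space S) \<le> ennreal (8 * ?d) * emeasure (weighted w) H"
      by (rule order_trans)
  qed auto
  also have "\<dots> = (ennreal (?d * W) * ennreal (8 * ?d)) * (ennreal s * F + ennreal (1 / s) * emeasure (weighted w) H)"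
    by (simp only: distrib_left mult_ac)
  also have "ennreal (?d * W) * ennreal (8 * ?d) = ennreal (8 * 9 ^ CARD('n) * W)"
  proof -
    have "ennreal (?d * W) * ennreal (8 * ?d) = ennreal ((?d * W) * (8 * ?d))"
      by (rule ennreal_mult'[symmetric]) (use W_ge_1 in simp)
    also have "(?d * W) * (8 * ?d) = 8 * (3 * 3) ^ CARD('n) * W" by (simp only: power_mult_distrib mult_ac)
    finally show ?thesis by simp
  qed
  finally show ?thesis by (simp add: F_def)
qed

end

section \<open>From sparse domination to the weak type bound\<close>

lemma ennreal_sqrt_ennreal [simp]: "ennreal_sqrt (ennreal a) = ennreal (sqrt a)"
proof (cases "0 \<le> a")
  case True
  then show ?thesis by (simp add: ennreal_sqrt_def)
next
  case False
  then have "ennreal a = 0" "sqrt a \<le> 0" by (simp_all add: ennreal_neg)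
  then show ?thesis by (simp add: ennreal_sqrt_def ennreal_neg)
qed

lemma ennreal_sqrt_bound:
  assumes "0 < t" "0 < c" "F < \<infinity>" "ennreal (t\<^sup>2) * m \<le> ennreal (c\<^sup>2) * F"
  shows "ennreal t * ennreal_sqrt m \<le> ennreal c * ennreal_sqrt F"
proof -
  obtain Fr where F: "F = ennreal Fr" "0 \<le> Fr" using assms(3) by (cases F) auto
  have "ennreal (t\<^sup>2) * m \<le> ennreal (c\<^sup>2 * Fr)" using assms(4) F by (simp add: ennreal_mult')
  then have "m \<le> ennreal (c\<^sup>2 * Fr / t\<^sup>2)" using assms(1) by (intro ennreal_divide_bound) auto
  then obtain mr where m: "m = ennreal mr" "0 \<le> mr" by (cases m) (auto simp: top_unique)
  have "ennreal (t\<^sup>2 * mr) \<le> ennreal (c\<^sup>2 * Fr)" using assms(4) F m by (simp add: ennreal_mult')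
  then have "t\<^sup>2 * mr \<le> c\<^sup>2 * Fr" using F by (simp add: ennreal_le_iff)
  then have "sqrt (t\<^sup>2 * mr) \<le> sqrt (c\<^sup>2 * Fr)" by (rule real_sqrt_le_mono)
  then have "t * sqrt mr \<le> c * sqrt Fr" using assms(1,2) by (simp add: real_sqrt_mult)
  then have "ennreal (t * sqrt mr) \<le> ennreal (c * sqrt Fr)" by (rule ennreal_leI)
  then show ?thesis using assms(1,2) F m by (simp add: ennreal_mult')
qed

locale cz_a2 = cz T K \<epsilon> B + a2_weight w
  for T :: "(real ^ 'n \<Rightarrow> complex) \<Rightarrow> (real ^ 'n \<Rightarrow> complex)" and K \<epsilon> B and w :: "real ^ 'n \<Rightarrow> real"
begin

definition D :: real where "D = step_const * (8 * 9 ^ CARD('n) * W)"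

lemma step_const_pos: "0 < step_const"
  using stop_const(1) stop_const_le_step_const by linarith

lemma D_pos: "0 < D"
  using step_const_pos W_ge_1 by (simp add: D_def)

text \<open>On \<open>H\<close> the sparse sum exceeds \<open>t\<close>, so \<open>t w(H)\<close> is at most the pairing. For \<open>s = 2 D / t\<close> the term with \<open>w(H)\<close> is half of the
left-hand side and, being finite, can be absorbed.\<close>

lemma local_weak_bound:
  assumes f: "f \<in> L2" and t: "0 < t"
  shows "ennreal (t\<^sup>2) * emeasure (weighted w) (cube p \<inter> {x. t < cmod (T (cutoff (triple p) f) x)})
    \<le> ennreal ((2 * D)\<^sup>2) * (\<integral>\<^sup>+x. ennreal ((cmod (f x))\<^sup>2) \<partial>weighted w)"
proof -
  define F where "F = (\<integral>\<^sup>+x. ennreal ((cmod (f x))\<^sup>2) \<partial>weighted w)"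
  define H where "H = cube p \<inter> {x. t < cmod (T (cutoff (triple p) f) x)}"
  have H [measurable]: "H \<in> sets lebesgue"
    unfolding H_def by (intro sets.Int cube_lebesgue superlevel_lebesgue T_measurable L2_local f)
  let ?S = "sparse_family f p"
  have Hfin: "emeasure (weighted w) H < \<infinity>"
  proof -
    have "emeasure (weighted w) H \<le> emeasure (weighted w) (cube p)" by (intro emeasure_mono) (auto simp: H_def)
    then show ?thesis using weighted_cube_finite by (rule le_less_trans)
  qed
  show ?thesis
  proof (cases "F < \<infinity>")
    case False
    then have "F = \<infinity>" using less_top[of F] by auto
    then have "ennreal ((2 * D)\<^sup>2) * F = \<infinity>" using D_pos by (simp add: ennreal_mult_top)
    then show ?thesis by (simp add: F_def)
  next
    case True
    then obtain Fr where F: "F = ennreal Fr" "0 \<le> Fr" by (cases F) auto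
    obtain h where h: "emeasure (weighted w) H = ennreal h" "0 \<le> h" using Hfin by (cases "emeasure (weighted w) H") auto
    define s where "s = 2 * D / t"
    have s: "0 < s" using D_pos t by (simp add: s_def)
    have "ennreal t * emeasure (weighted w) H = (\<integral>\<^sup>+x. ennreal t * indicator H x \<partial>weighted w)"
      using H by (simp add: nn_integral_cmult_indicator)
    also have "\<dots> \<le> (\<integral>\<^sup>+x. (\<integral>\<^sup>+q. ennreal (step_const * triple_average f q) * indicator (cube q) x * indicator H x \<partial>count_space ?S) \<partial>weighted w)"
    proof (rule nn_integral_mono_AE)
      have "AE x in lebesgue. ennreal t * indicator H x
        \<le> (\<integral>\<^sup>+q. ennreal (step_const * triple_average f q) * indicator (cube q) x * indicator H x \<partial>count_space ?S)"
        using sparse_domination[OF f, of p]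
      proof eventually_elim
        case (elim x)
        show ?case
        proof (cases "x \<in> H")
          case True
          then have t_le: "ennreal t \<le> ennreal (cmod (T (cutoff (triple p) f) x))" and x: "x \<in> cube p"
            by (auto simp: H_def intro!: ennreal_leI)
          show ?thesis using order_trans[OF t_le elim[rule_format, OF x]] True by simp
        qed simp
      qed
      then show "AE x in weighted w. ennreal t * indicator H x
        \<le> (\<integral>\<^sup>+q. ennreal (step_const * triple_average f q) * indicator (cube q) x * indicator H x \<partial>count_space ?S)"
        unfolding weighted_def by (subst AE_density) (auto elim: eventually_mono)
    qed
    also have "\<dots> = (\<integral>\<^sup>+q. \<integral>\<^sup>+x. ennreal (step_const * triple_average f q) * indicator (cube q) x * indicator H x \<partial>weighted w \<partial>count_space ?S)"
      by (rule nn_integral_count_space_nn_integral) auto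
    also have "\<dots> = (\<integral>\<^sup>+q. ennreal step_const * (ennreal (triple_average f q) * emeasure (weighted w) (cube q \<inter> H)) \<partial>count_space ?S)"
    proof (rule nn_integral_cong)
      fix q
      have "(\<integral>\<^sup>+x. ennreal (step_const * triple_average f q) * indicator (cube q) x * indicator H x \<partial>weighted w)
          = (\<integral>\<^sup>+x. ennreal (step_const * triple_average f q) * indicator (cube q \<inter> H) x \<partial>weighted w)"
        by (intro nn_integral_cong) (auto simp: indicator_def)
      also have "\<dots> = ennreal (step_const * triple_average f q) * emeasure (weighted w) (cube q \<inter> H)"
        by (rule nn_integral_cmult_indicator) auto
      finally show "(\<integral>\<^sup>+x. ennreal (step_const * triple_average f q) * indicator (cube q) x * indicator H x \<partial>weighted w)
          = ennreal step_const * (ennreal (triple_average f q) * emeasure (weighted w) (cube q \<inter> H))"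
        using step_const_pos by (simp add: ennreal_mult' mult.assoc)
    qed
    also have "\<dots> = ennreal step_const * (\<integral>\<^sup>+q. ennreal (triple_average f q) * emeasure (weighted w) (cube q \<inter> H) \<partial>count_space ?S)"
      by (rule nn_integral_cmult) auto
    also have "\<dots> \<le> ennreal step_const * (ennreal (8 * 9 ^ CARD('n) * W) * (ennreal s * F + ennreal (1 / s) * emeasure (weighted w) H))"
      unfolding F_def
    proof (intro mult_left_mono sparse_pairing[OF f H s])
      show "major f q \<in> sets lebesgue" for q by (rule major_sets)
      show "major f q \<subseteq> cube q" for q by (auto simp: major_def)
      show "disjoint_family_on (major f) ?S" unfolding disjoint_family_on_def using major_disjoint by blast
      show "ennreal (vol q) \<le> 2 * emeasure lebesgue (major f q)" for q by (rule vol_le_major[OF f])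
    qed simp
    also have "\<dots> = ennreal (D * (s * Fr + h / s))"
    proof -
      have e: "ennreal s * F + ennreal (1 / s) * emeasure (weighted w) H = ennreal (s * Fr + 1 / s * h)"
        unfolding F(1) h(1) using s F(2) h(2)
        by (subst ennreal_plus) (auto simp: ennreal_mult'[symmetric])
      show ?thesis unfolding e D_def using step_const_pos W_ge_1
        by (simp add: ennreal_mult'[symmetric] mult.assoc del: ennreal_plus)
    qed
    finally have "ennreal (t * h) \<le> ennreal (D * (s * Fr + h / s))"
      using t by (simp add: h(1) ennreal_mult')
    moreover have "0 \<le> D * (s * Fr + h / s)" using D_pos s F(2) h(2) by simp
    ultimately have "t * h \<le> D * (s * Fr + h / s)" by (simp only: ennreal_le_iff)
    also have "\<dots> = 2 * D\<^sup>2 * Fr / t + t * h / 2"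
      using t D_pos by (simp add: s_def power2_eq_square field_simps)
    finally have "t * h / 2 \<le> 2 * D\<^sup>2 * Fr / t" by linarith
    then have "t\<^sup>2 * h \<le> (2 * D)\<^sup>2 * Fr" using t by (simp add: power2_eq_square field_simps)
    then have "ennreal (t\<^sup>2 * h) \<le> ennreal ((2 * D)\<^sup>2 * Fr)" by (rule ennreal_leI)
    then show ?thesis unfolding F_def[symmetric] H_def[symmetric] F(1) h(1) by (simp add: ennreal_mult')
  qed
qed

text \<open>The ancestors of \<open>p\<close> increase to an orthant and \<open>f\<close> restricted to their triples converges to \<open>f\<close>. Along a subsequence the images
converge almost everywhere, so a point where \<open>\<bar>T f\<bar> > t\<close> eventually lies in the sets where the approximations exceed \<open>t / 2\<close>, and
Fatou's lemma applies.\<close>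

lemma orthant_weak_bound:
  assumes f: "f \<in> L2" and t: "0 < t"
  shows "ennreal (t\<^sup>2) * emeasure (weighted w) ((\<Union>k. cube (anc k p)) \<inter> {x. t < cmod (T f x)})
    \<le> ennreal ((4 * D)\<^sup>2) * (\<integral>\<^sup>+x. ennreal ((cmod (f x))\<^sup>2) \<partial>weighted w)"
proof -
  define F where "F = (\<integral>\<^sup>+x. ennreal ((cmod (f x))\<^sup>2) \<partial>weighted w)"
  define G where "G = (\<Union>k. cube (anc k p)) \<inter> {x. t < cmod (T f x)}"
  define u where "u k = cutoff (triple (anc k p)) f" for k
  define H where "H k = cube (anc k p) \<inter> {x. t / 2 < cmod (T (u k) x)}" for k
  have uL2: "u k \<in> L2" for k unfolding u_def by (rule L2_local(1)[OF f])
  have G [measurable]: "G \<in> sets lebesgue"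
    unfolding G_def by (intro sets.Int superlevel_lebesgue T_measurable f) auto
  have H [measurable]: "H k \<in> sets lebesgue" for k
    unfolding H_def by (intro sets.Int cube_lebesgue superlevel_lebesgue T_measurable uL2)
  have lim: "(\<lambda>k. energy (\<lambda>x. u k x - f x)) \<longlonglongrightarrow> 0"
  proof (rule energy_dominated_convergence[OF _ _ _ _ L2_square_integrable[OF f]])
    show "AE x in lebesgue. (\<lambda>k. u k x) \<longlonglongrightarrow> f x"
    proof (rule AE_I2, rule tendsto_eventually)
      fix x
      obtain j where j: "x \<in> triple (anc j p)" using exists_anc_triple by blast
      have "x \<in> triple (anc k p)" if "j \<le> k" for k using triple_anc_mono[OF that, of p] j by blast
      then show "\<forall>\<^sub>F k in sequentially. u k x = f x"
        by (intro eventually_sequentiallyI[of j]) (simp add: u_def cutoff_def)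
    qed
    show "(cmod (u k x - f x))\<^sup>2 \<le> (cmod (f x))\<^sup>2" for k x by (simp add: u_def cutoff_def)
  qed (use L2_measurable[OF uL2] L2_measurable[OF f] in auto)
  have dL2: "(\<lambda>x. T (u k) x - T f x) \<in> L2" for k by (intro L2_diff T_L2 uL2 f)
  have limT: "(\<lambda>k. energy (\<lambda>x. T (u k) x - T f x)) \<longlonglongrightarrow> 0"
  proof (rule Lim_null_comparison[OF always_eventually], rule allI)
    show "norm (energy (\<lambda>x. T (u k) x - T f x)) \<le> B\<^sup>2 * energy (\<lambda>x. u k x - f x)" for k
      using energy_T_diff_le[OF uL2 f] by simp
    show "(\<lambda>k. B\<^sup>2 * energy (\<lambda>x. u k x - f x)) \<longlonglongrightarrow> 0" by (rule tendsto_mult_right_zero[OF lim])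
  qed
  have "\<exists>r. strict_mono r \<and> (AE x in lebesgue. (\<lambda>n. (cmod (T (u (r n)) x - T f x))\<^sup>2) \<longlonglongrightarrow> 0)"
  proof (rule tendsto_L1_AE_subseq)
    show "integrable lebesgue (\<lambda>x. (cmod (T (u n) x - T f x))\<^sup>2)" for n by (rule L2_square_integrable[OF dL2])
    show "(\<lambda>n. LINT x|lebesgue. norm ((cmod (T (u n) x - T f x))\<^sup>2)) \<longlonglongrightarrow> 0"
      using limT by (simp add: energy_def)
  qed
  then obtain r where r: "strict_mono r" "AE x in lebesgue. (\<lambda>n. (cmod (T (u (r n)) x - T f x))\<^sup>2) \<longlonglongrightarrow> 0" by blast
  have AEl: "AE x in lebesgue. (indicator G x :: ennreal) \<le> liminf (\<lambda>n. indicator (H (r n)) x)"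
    using r(2)
  proof eventually_elim
    case (elim x)
    show ?case
    proof (cases "x \<in> G")
      case True
      then obtain k where k: "x \<in> cube (anc k p)" and tx: "t < cmod (T f x)" by (auto simp: G_def)
      have "\<forall>\<^sub>F n in sequentially. (cmod (T (u (r n)) x - T f x))\<^sup>2 < (t / 2)\<^sup>2"
        by (rule order_tendstoD(2)[OF elim]) (use t in simp)
      moreover have "\<forall>\<^sub>F n in sequentially. k \<le> n" by (rule eventually_ge_at_top)
      ultimately have "\<forall>\<^sub>F n in sequentially. (1 :: ennreal) \<le> indicator (H (r n)) x"
      proof eventually_elim
        case (elim n)
        have "cmod (T (u (r n)) x - T f x) < t / 2" using elim(1) by (rule power2_less_imp_less) (use t in simp)
        then have "t / 2 < cmod (T (u (r n)) x)"
          using tx norm_triangle_ineq2[of "T f x" "T (u (r n)) x"] by (simp add: norm_minus_commute)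
        moreover have "x \<in> cube (anc (r n) p)"
        proof -
          have "k \<le> r n" using elim(2) seq_suble[OF r(1), of n] by linarith
          then have "anc (r n) p = anc (r n - k) (anc k p)" by (simp add: anc_anc)
          then show ?thesis using cube_subset_anc[of "anc k p" "r n - k"] k by auto
        qed
        ultimately show ?case by (simp add: H_def)
      qed
      then have "1 \<le> liminf (\<lambda>n. indicator (H (r n)) x :: ennreal)" by (rule Liminf_bounded)
      then show ?thesis using True by simp
    qed simp
  qed
  define X where "X = ennreal ((2 * D)\<^sup>2 / (t / 2)\<^sup>2) * F"
  have HX: "emeasure (weighted w) (H k) \<le> X" for k
  proof -
    have "ennreal ((t / 2)\<^sup>2) * emeasure (weighted w) (H k)
        \<le> ennreal ((2 * D)\<^sup>2) * F"
      unfolding H_def u_def F_def by (rule local_weak_bound[OF f]) (use t in simp)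
    then have "ennreal (1 / (t / 2)\<^sup>2) * (ennreal ((t / 2)\<^sup>2) * emeasure (weighted w) (H k))
        \<le> ennreal (1 / (t / 2)\<^sup>2) * (ennreal ((2 * D)\<^sup>2) * F)" by (rule mult_left_mono) simp
    moreover have "ennreal (1 / (t / 2)\<^sup>2) * (ennreal ((t / 2)\<^sup>2) * emeasure (weighted w) (H k)) = emeasure (weighted w) (H k)"
    proof -
      have "ennreal (1 / (t / 2)\<^sup>2) * ennreal ((t / 2)\<^sup>2) = ennreal (1 / (t / 2)\<^sup>2 * (t / 2)\<^sup>2)"
        by (rule ennreal_mult'[symmetric]) simp
      also have "1 / (t / 2)\<^sup>2 * (t / 2)\<^sup>2 = 1" using t by simp
      finally show ?thesis by (simp add: mult.assoc[symmetric])
    qed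
    moreover have "ennreal (1 / (t / 2)\<^sup>2) * (ennreal ((2 * D)\<^sup>2) * F) = X"
    proof -
      have "ennreal (1 / (t / 2)\<^sup>2) * ennreal ((2 * D)\<^sup>2) = ennreal (1 / (t / 2)\<^sup>2 * (2 * D)\<^sup>2)"
        by (rule ennreal_mult'[symmetric]) simp
      then show ?thesis by (simp add: X_def mult.assoc[symmetric])
    qed
    ultimately show ?thesis by simp
  qed
  have "emeasure (weighted w) G = (\<integral>\<^sup>+x. indicator G x \<partial>weighted w)" by simp
  also have "\<dots> \<le> (\<integral>\<^sup>+x. liminf (\<lambda>n. indicator (H (r n)) x) \<partial>weighted w)"
  proof (rule nn_integral_mono_AE)
    show "AE x in weighted w. (indicator G x :: ennreal) \<le> liminf (\<lambda>n. indicator (H (r n)) x)"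
      unfolding weighted_def using AEl by (subst AE_density) (auto elim: eventually_mono)
  qed
  also have "\<dots> \<le> liminf (\<lambda>n. \<integral>\<^sup>+x. indicator (H (r n)) x \<partial>weighted w)"
    by (rule nn_integral_liminf) auto
  also have "\<dots> = liminf (\<lambda>n. emeasure (weighted w) (H (r n)))" by simp
  also have "\<dots> \<le> liminf (\<lambda>n. X)" by (rule Liminf_mono) (simp add: HX)
  also have "\<dots> = X" by (rule Liminf_const) simp
  finally have "ennreal (t\<^sup>2) * emeasure (weighted w) G \<le> ennreal (t\<^sup>2) * X" by (rule mult_left_mono) simp
  also have "\<dots> = ennreal ((4 * D)\<^sup>2) * F"
  proof -
    have "ennreal (t\<^sup>2) * ennreal ((2 * D)\<^sup>2 / (t / 2)\<^sup>2) = ennreal (t\<^sup>2 * ((2 * D)\<^sup>2 / (t / 2)\<^sup>2))"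
      by (rule ennreal_mult'[symmetric]) simp
    also have "t\<^sup>2 * ((2 * D)\<^sup>2 / (t / 2)\<^sup>2) = (4 * D)\<^sup>2" using t by (simp add: power2_eq_square field_simps)
    finally show ?thesis by (simp add: X_def mult.assoc[symmetric])
  qed
  finally show ?thesis by (simp add: G_def F_def)
qed

end

text \<open>A cube of level \<open>0\<close> at one of these positions has ancestors at the same position; they increase to one of the \<open>2 ^ d\<close> orthants.\<close>

definition orthants :: "(int ^ 'n) set" where
  "orthants = {v. \<forall>i. v $ i \<in> {-1, 0}}"

lemma finite_orthants: "finite (orthants :: (int ^ 'n) set)"
proof -
  let ?f = "\<lambda>h. (\<chi> i. h i) :: int ^ 'n" and ?X = "(UNIV::'n set) \<rightarrow>\<^sub>E {-1, 0::int}"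
  have "orthants \<subseteq> ?f ` ?X"
  proof
    fix c :: "int ^ 'n" assume "c \<in> orthants"
    then have "c = ?f (($) c)" "($) c \<in> ?X" by (auto simp: vec_eq_iff orthants_def)
    then show "c \<in> ?f ` ?X" by blast
  qed
  moreover have "finite ?X" by (intro finite_PiE) auto
  ultimately show ?thesis using finite_subset by blast
qed

lemma exists_orthant:
  fixes x :: "real ^ 'n"
  shows "\<exists>v\<in>orthants. x \<in> (\<Union>k. cube (anc k (0, v)))"
proof -
  obtain q :: "int \<times> (int ^ 'n)" where q: "fst q = 0" "x \<in> cube q" using exists_cube[of 0 x] by (elim exE conjE)
  have "\<exists>j. \<forall>k\<ge>j. snd q $ i div 2 ^ k \<in> {-1, 0}" for i by (rule int_div_power2_cases)
  then obtain j where j: "\<And>i k. j i \<le> k \<Longrightarrow> snd q $ i div 2 ^ k \<in> {-1, 0}" by metis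
  define J where "J = Max (range j)"
  have "j i \<le> J" for i unfolding J_def by (rule Max_ge) auto
  then have v: "snd (anc J q) \<in> orthants" using j by (auto simp: orthants_def anc_def)
  have "(m::int) div 2 ^ J = m" if "m \<in> {-1, 0}" for m
    using that by (auto simp: div_eq_minus1)
  then have "anc J (0, snd (anc J q)) = anc J q"
    using v q(1) by (auto simp: anc_def orthants_def vec_eq_iff)
  then have "x \<in> cube (anc J (0, snd (anc J q)))" using q(2) cube_subset_anc[of q J] by auto
  then show ?thesis using v by blast
qed

definition (in cz) total_const :: real where
  "total_const = sqrt (card (orthants :: (int ^ 'n) set)) * 4 * (step_const * (8 * 9 ^ CARD('n)))"

lemma (in cz_a2) weak_norm_le: "weak_norm w T \<le> ennreal (total_const * W)"
  unfolding weak_norm_def operator_norm_def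
proof (rule Inf_lower, rule CollectI, rule ballI)
  fix f assume "f \<in> L2 \<inter> L2_space (weighted w)"
  then have f: "f \<in> L2" and fw: "(\<integral>\<^sup>+x. ennreal ((cmod (f x))\<^sup>2) \<partial>weighted w) < \<infinity>"
    by (auto simp: L2_space_iff_nn)
  define F where "F = (\<integral>\<^sup>+x. ennreal ((cmod (f x))\<^sup>2) \<partial>weighted w)"
  let ?V = "orthants :: (int ^ 'n) set"
  define m where "m = real (card ?V)"
  have "?V \<noteq> {}" using exists_orthant[of 0] by blast
  then have m: "0 < m" using finite_orthants by (simp add: m_def card_gt_0_iff)
  have c: "total_const * W = sqrt m * (4 * D)" by (simp add: total_const_def m_def D_def)
  have c_pos: "0 < total_const * W" unfolding c using m D_pos by simp
  show "weak_L2_norm (weighted w) (T f) \<le> ennreal (total_const * W) * L2_norm (weighted w) f"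
    unfolding weak_L2_norm_def L2_norm_def
  proof (rule SUP_least, rule ennreal_sqrt_bound[OF _ c_pos fw])
    fix t :: real assume "t \<in> {0<..}"
    then show t: "0 < t" by simp
    let ?G = "{x. t < cmod (T f x)}"
    have G: "?G \<in> sets lebesgue" by (intro superlevel_lebesgue T_measurable f)
    have Gv: "(\<Union>k. cube (anc k (0, v))) \<inter> ?G \<in> sets lebesgue" for v :: "int ^ 'n"
      by (intro sets.Int G) auto
    have "emeasure (weighted w) ?G \<le> emeasure (weighted w) (\<Union>v\<in>?V. (\<Union>k. cube (anc k (0, v))) \<inter> ?G)"
    proof (rule emeasure_mono)
      show "?G \<subseteq> (\<Union>v\<in>?V. (\<Union>k. cube (anc k (0, v))) \<inter> ?G)" using exists_orthant by blast
      show "(\<Union>v\<in>?V. (\<Union>k. cube (anc k (0, v))) \<inter> ?G) \<in> sets (weighted w)"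
        unfolding sets_weighted using finite_orthants Gv by (intro sets.finite_UN)
    qed
    also have "\<dots> \<le> (\<Sum>v\<in>?V. emeasure (weighted w) ((\<Union>k. cube (anc k (0, v))) \<inter> ?G))"
      by (rule emeasure_subadditive_finite[OF finite_orthants]) (use Gv in auto)
    finally have "ennreal (t\<^sup>2) * emeasure (weighted w) ?G
        \<le> ennreal (t\<^sup>2) * (\<Sum>v\<in>?V. emeasure (weighted w) ((\<Union>k. cube (anc k (0, v))) \<inter> ?G))"
      by (rule mult_left_mono) simp
    also have "\<dots> = (\<Sum>v\<in>?V. ennreal (t\<^sup>2) * emeasure (weighted w) ((\<Union>k. cube (anc k (0, v))) \<inter> ?G))"
      by (rule sum_distrib_left)
    also have "\<dots> \<le> (\<Sum>v\<in>?V. ennreal ((4 * D)\<^sup>2) * F)"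
      unfolding F_def by (intro sum_mono orthant_weak_bound f t)
    also have "\<dots> = ennreal m * (ennreal ((4 * D)\<^sup>2) * F)"
      by (simp add: m_def ennreal_of_nat_eq_real_of_nat)
    also have "\<dots> = ennreal ((total_const * W)\<^sup>2) * F"
    proof -
      have "ennreal m * ennreal ((4 * D)\<^sup>2) = ennreal (m * (4 * D)\<^sup>2)"
        by (rule ennreal_mult'[symmetric]) (use m in simp)
      also have "m * (4 * D)\<^sup>2 = (total_const * W)\<^sup>2" unfolding c using m by (simp add: power_mult_distrib)
      finally show ?thesis by (simp add: mult.assoc[symmetric])
    qed
    finally show "ennreal (t\<^sup>2) * emeasure (weighted w) {x \<in> space (weighted w). t < cmod (T f x)}
      \<le> ennreal ((total_const * W)\<^sup>2) * (\<integral>\<^sup>+x. ennreal ((cmod (f x))\<^sup>2) \<partial>weighted w)"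
      by (simp add: F_def)
  qed
qed

lemma L2_norm_energy: "f \<in> L2 \<Longrightarrow> L2_norm lebesgue f = ennreal (sqrt (energy f))"
  by (simp add: L2_norm_def nn_energy)

text \<open>The norm is an infimum of admissible constants; enlarging the bound by \<open>1\<close> gives an admissible one.\<close>

lemma strong_norm_energy:
  assumes "bounded_on_L2 T" "strong_norm T \<le> ennreal N" "f \<in> L2"
  shows "energy (T f) \<le> (max N 0 + 1)\<^sup>2 * energy f"
proof -
  let ?B = "max N 0 + 1"
  have Tf: "T f \<in> L2" using assms(1,3) by (simp add: bounded_on_L2_def)
  have "strong_norm T < ennreal ?B"
    by (rule le_less_trans[OF assms(2)]) (simp add: ennreal_less_iff max_def)
  then obtain b where b: "\<forall>f\<in>L2. L2_norm lebesgue (T f) \<le> b * L2_norm lebesgue f" "b < ennreal ?B"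
    unfolding strong_norm_def operator_norm_def Inf_less_iff by blast
  have "ennreal (sqrt (energy (T f))) \<le> b * ennreal (sqrt (energy f))"
    using b(1) assms(3) by (simp add: L2_norm_energy[OF Tf, symmetric] L2_norm_energy[OF assms(3), symmetric])
  also have "\<dots> \<le> ennreal ?B * ennreal (sqrt (energy f))"
    using less_imp_le[OF b(2)] by (rule mult_right_mono) simp
  also have "\<dots> = ennreal (?B * sqrt (energy f))" by (rule ennreal_mult'[symmetric]) simp
  finally have "sqrt (energy (T f)) \<le> ?B * sqrt (energy f)"
    by (subst (asm) ennreal_le_iff) auto
  then have "(sqrt (energy (T f)))\<^sup>2 \<le> (?B * sqrt (energy f))\<^sup>2" by (rule power_mono) simp
  then show ?thesis by (simp add: power_mult_distrib)
qed

lemma cz_operator_imp_cz: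
  fixes T :: "(real ^ 'a \<Rightarrow> complex) \<Rightarrow> (real ^ 'a \<Rightarrow> complex)"
  assumes "0 < \<epsilon>" "cz_operator \<epsilon> T" "strong_norm T \<le> ennreal N"
  shows "\<exists>K. cz T K \<epsilon> (max N 0 + 1)"
proof -
  obtain K where bT: "bounded_on_L2 T" and K: "cz_kernel \<epsilon> K" "has_kernel T K"
    using assms(2) by (auto simp: cz_operator_def)
  define K' where "K' x y = (if x = y then 0 else K x y)" for x y
  have ker: "cz_kernel \<epsilon> K'"
    unfolding cz_kernel_def
  proof (intro conjI allI impI)
    fix x y :: "real ^ 'a" assume "x \<noteq> y"
    then show "cmod (K' x y) \<le> 1 / norm (x - y) powr real CARD('a)"
      using K(1) by (simp add: cz_kernel_def K'_def)
  next
    fix x x' y :: "real ^ 'a" assume a: "x \<noteq> y \<and> norm (x - x') \<le> norm (x - y) / 2"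
    then have "x' \<noteq> y" by auto
    then have "K' x y = K x y" "K' x' y = K x' y" "K' y x = K y x" "K' y x' = K y x'"
      using a by (auto simp: K'_def)
    then show "cmod (K' x y - K' x' y) + cmod (K' y x - K' y x')
        \<le> norm (x - x') powr \<epsilon> / norm (x - y) powr (real CARD('a) + \<epsilon>)"
      using K(1) a by (simp add: cz_kernel_def)
  qed
  have hk: "has_kernel T K'"
    unfolding has_kernel_def
  proof (intro allI impI)
    fix f g :: "real ^ 'a \<Rightarrow> complex"
    assume fg: "continuous_on UNIV f \<and> compact (support f) \<and>
      continuous_on UNIV g \<and> compact (support g) \<and> support f \<inter> support g = {}"
    have "f x = 0 \<or> g x = 0" for x
      using fg closure_subset[of "{x. f x \<noteq> 0}"] closure_subset[of "{x. g x \<noteq> 0}"]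
      unfolding support_def by blast
    then have e: "K' x y * f y * g x = K x y * f y * g x" for x y by (auto simp: K'_def)
    show "(LINT x|lebesgue. T f x * g x) = (LINT x|lebesgue. LINT y|lebesgue. K' x y * f y * g x)"
      unfolding e using K(2) fg unfolding has_kernel_def by blast
  qed
  have "cz T K' \<epsilon> (max N 0 + 1)"
  proof
    show "energy (T f) \<le> (max N 0 + 1)\<^sup>2 * energy f" if "f \<in> L2" for f
      by (rule strong_norm_energy[OF bT assms(3) that])
    show "K' x x = 0" for x by (simp add: K'_def)
  qed (use assms(1) ker hk bT in \<open>auto simp: bounded_on_L2_def\<close>)
  then show ?thesis by blast
qed

theorem theorem2p4:
  fixes \<epsilon> N :: real
  assumes "0 < \<epsilon>"
  shows "\<exists>c\<^sub>1>0. \<forall>T :: (real ^ 'n \<Rightarrow> complex) \<Rightarrow> (real ^ 'n \<Rightarrow> complex).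
           cz_operator \<epsilon> T \<and> strong_norm T \<le> ennreal N \<longrightarrow>
           (\<forall>w\<in>A2. weak_norm w T
              \<le> ennreal (c\<^sub>1 * enn2real (A2_char w) * ln (1 + enn2real (A2_char w))))"
proof -
  \<comment> \<open>The maximum makes the constant positive even if there is no operator to which the bound applies.\<close>
  define C where "C = max 1 (cz.total_const TYPE('n) \<epsilon> (max N 0 + 1))"
  show ?thesis
  proof (intro exI[of _ "C / ln 2"] conjI allI impI ballI)
    show "0 < C / ln 2" by (simp add: C_def)
    fix T :: "(real ^ 'n \<Rightarrow> complex) \<Rightarrow> (real ^ 'n \<Rightarrow> complex)" and w :: "real ^ 'n \<Rightarrow> real"
    assume T: "cz_operator \<epsilon> T \<and> strong_norm T \<le> ennreal N" and w: "w \<in> A2"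
    obtain K where "cz T K \<epsilon> (max N 0 + 1)" using cz_operator_imp_cz[OF assms] T by blast
    then interpret cz T K \<epsilon> "max N 0 + 1" .
    interpret a2_weight w by unfold_locales (rule w)
    interpret cz_a2 T K \<epsilon> "max N 0 + 1" w ..
    have C: "total_const \<le> C" "0 < C" by (auto simp: C_def)
    have "ln 2 \<le> ln (1 + W)" using W_ge_1 by simp
    then have "1 \<le> ln (1 + W) / ln 2" by (simp add: pos_le_divide_eq)
    then have "C * W * 1 \<le> C * W * (ln (1 + W) / ln 2)"
      using C W_ge_1 by (intro mult_left_mono) auto
    moreover have "total_const * W \<le> C * W" using C W_ge_1 by (intro mult_right_mono) auto
    ultimately have "total_const * W \<le> C * W * (ln (1 + W) / ln 2)" by linarith
    also have "\<dots> = C / ln 2 * W * ln (1 + W)" by simp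
    finally have "total_const * W \<le> C / ln 2 * W * ln (1 + W)" .
    then have "ennreal (total_const * W) \<le> ennreal (C / ln 2 * W * ln (1 + W))" by (rule ennreal_leI)
    with weak_norm_le show "weak_norm w T
        \<le> ennreal (C / ln 2 * enn2real (A2_char w) * ln (1 + enn2real (A2_char w)))"
      unfolding W_def[symmetric] by (rule order_trans)
  qed
qed

end
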